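(* Let $\{g_k\}_{k\in\mathbb{N}}\subset L^2(\Omega)$ be such that $\|g-g_k\|\le\delta_k\to0$ as $k\to\infty$ (with $\delta_k>0$). Let $J$ be the total variation functional on $L^2(\Omega)$, let $\Gamma$ be Morozov's discrepancy principle with parameter $\rho>1$ and assume that $\lim_{k\to\infty}\Gamma(\delta_k,g_k)=\infty$. Write $n_k=\Gamma(\delta_k,g_k)$, $u_k=\mathcal{R}_{n_k}(g_k)$ and $\xi_k=K^*\mathcal{R}^*_{n_k}(g_k)\in\partial J(u_k)$. Then, with $u^\dagger$ a $J$-minimizing solution of $Ku=g$, $$\lim_{k\to\infty}J(u_k)=J(u^\dagger),\qquad\lim_{k\to\infty}D_J^{\xi_k}(u^\dagger,u_k)=0,\qquad\|Ku_k-g\|=\mathcal{O}\big(t_{n_k}^{-1/2}\big).$$ Moreover, $\{u_k\}_{k\in\mathbb{N}}$ has a subsequence which converges strictly to a $J$-minimizing solution of $Ku=g$.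
   Context: $\Omega\subset\mathbb{R}^2$ is open and bounded, $K:L^2(\Omega)\to L^2(\Omega)$ is linear and bounded with adjoint $K^*$ (so $H_1=H_2=L^2(\Omega)$), and $J:L^2(\Omega)\to\mathbb{R}\cup\{\infty\}$ is $J(u)=|\mathrm{D}u|(\Omega)$ (total variation of the distributional derivative) if $u\in\mathrm{BV}(\Omega)$ and $J(u)=+\infty$ otherwise. It is assumed that for every $c\in\mathbb{R}$ every sequence in $\{u:\|Ku\|^2+J(u)\le c\}$ has a weakly convergent subsequence in $L^2(\Omega)$. The element $g$ is attainable: $Ku=g$ for some $u$ with $J(u)<\infty$. A $J$-minimizing solution of $Ku=g$ is a minimizer of $J(u)$ subject to $Ku=g$. Strict convergence means convergence with respect to the metric $\tilde d(u,v)=\|u-v\|_{L^1}+|J(u)-J(v)|$ on $\mathrm{BV}(\Omega)$. Augmented Lagrangian method: $\{\tau_n\}_{n\ge1}$ is a fixed sequence of positive numbers, $t_n:=\sum_{k=1}^n\tau_k$, with $t_n\to+\infty$ and $\sup_k\tau_k<\infty$. Given data $g^\delta$ and a fixed starting element $p_0^\delta=p_0\in L^2(\Omega)$, for $n=1,2,\dots$ $$u_n^\delta\in\operatorname{argmin}_{u}\Big(\tfrac{\tau_n}{2}\|Ku-g^\delta\|^2+J(u)-\langle p_{n-1}^\delta,Ku-g^\delta\rangle\Big),\qquad p_n^\delta=p_{n-1}^\delta+\tau_n(g^\delta-Ku_n^\delta).$$ Set $\mathcal{R}_n(g^\delta):=u_n^\delta$ and $\mathcal{R}_n^*(g^\delta):=p_n^\delta$;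 one has $K^*p_n^\delta\in\partial J(u_n^\delta)$. Morozov's discrepancy principle with $\rho>1$ is the stopping rule $\Gamma(\delta,g^\delta):=\min\{n\in\mathbb{N}, n\ge1:\ \|Ku_n^\delta-g^\delta\|<\rho\delta\}$ (this minimum exists whenever $\|g^\delta-g\|\le\delta$). For $\xi\in\partial J(u)$ the Bregman distance is $D_J^\xi(v,u)=J(v)-J(u)-\langle\xi,v-u\rangle$. *)

theory Defs
  imports "HOL-Analysis.Analysis" "HOL-Library.Landau_Symbols"
begin

section \<open>The Hilbert space of square-integrable functions on a planar domain\<close>

text \<open>
  Elements of \<open>L\<^sup>2(\<Omega>)\<close> are represented by functions on the whole plane, of which only the
  restriction to \<open>\<Omega>\<close> matters. Equality in \<open>L\<^sup>2(\<Omega>)\<close> is equality almost everywhere on \<open>\<Omega>\<close>.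
\<close>

type_synonym plane = "real ^ 2"
type_synonym scalar_field = "plane \<Rightarrow> real"

definition L1 :: "plane set \<Rightarrow> scalar_field set" where
  "L1 \<Omega> = {u. integrable (lebesgue_on \<Omega>) u}"

definition L2 :: "plane set \<Rightarrow> scalar_field set" where
  "L2 \<Omega> = {u. u \<in> borel_measurable (lebesgue_on \<Omega>)
              \<and> integrable (lebesgue_on \<Omega>) (\<lambda>x. (u x)\<^sup>2)}"

definition ae_eq :: "plane set \<Rightarrow> scalar_field \<Rightarrow> scalar_field \<Rightarrow> bool" where
  "ae_eq \<Omega> u v \<longleftrightarrow> (AE x in lebesgue_on \<Omega>. u x = v x)"

definition ip :: "plane set \<Rightarrow> scalar_field \<Rightarrow> scalar_field \<Rightarrow> real" where
  "ip \<Omega> u v = (\<integral>x. u x * v x \<partial>lebesgue_on \<Omega>)"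

definition nrm :: "plane set \<Rightarrow> scalar_field \<Rightarrow> real" where
  "nrm \<Omega> u = sqrt (ip \<Omega> u u)"

definition L1_nrm :: "plane set \<Rightarrow> scalar_field \<Rightarrow> real" where
  "L1_nrm \<Omega> u = (\<integral>x. \<bar>u x\<bar> \<partial>lebesgue_on \<Omega>)"

definition weakly_converges ::
    "plane set \<Rightarrow> (nat \<Rightarrow> scalar_field) \<Rightarrow> scalar_field \<Rightarrow> bool" where
  "weakly_converges \<Omega> w v \<longleftrightarrow> v \<in> L2 \<Omega> \<and> (\<forall>k. w k \<in> L2 \<Omega>)
     \<and> (\<forall>h\<in>L2 \<Omega>. (\<lambda>k. ip \<Omega> (w k) h) \<longlonglongrightarrow> ip \<Omega> v h)"

text \<open>
  Together with linearity, the norm bound forces an operator to respect equality almost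
  everywhere.
\<close>

definition bounded_operator :: "plane set \<Rightarrow> (scalar_field \<Rightarrow> scalar_field) \<Rightarrow> bool" where
  "bounded_operator \<Omega> K \<longleftrightarrow>
     (\<forall>u\<in>L2 \<Omega>. K u \<in> L2 \<Omega>)
   \<and> (\<forall>u\<in>L2 \<Omega>. \<forall>v\<in>L2 \<Omega>. ae_eq \<Omega> (K (\<lambda>x. u x + v x)) (\<lambda>x. K u x + K v x))
   \<and> (\<forall>c. \<forall>u\<in>L2 \<Omega>. ae_eq \<Omega> (K (\<lambda>x. c * u x)) (\<lambda>x. c * K u x))
   \<and> (\<exists>C. \<forall>u\<in>L2 \<Omega>. nrm \<Omega> (K u) \<le> C * nrm \<Omega> u)"

text \<open>The adjoint exists and is unique up to equality almost everywhere.\<close>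

definition is_adjoint ::
    "plane set \<Rightarrow> (scalar_field \<Rightarrow> scalar_field) \<Rightarrow> (scalar_field \<Rightarrow> scalar_field) \<Rightarrow> bool" where
  "is_adjoint \<Omega> K Kadj \<longleftrightarrow>
     (\<forall>v\<in>L2 \<Omega>. Kadj v \<in> L2 \<Omega>)
   \<and> (\<forall>u\<in>L2 \<Omega>. \<forall>v\<in>L2 \<Omega>. ip \<Omega> (K u) v = ip \<Omega> u (Kadj v))"


section \<open>Total variation and functions of bounded variation\<close>

text \<open>
  Test fields are the \<open>C\<^sup>1\<close> vector fields with compact support in \<open>\<Omega>\<close>, extended by zero to the
  plane.
\<close>

definition test_fields :: "plane set \<Rightarrow> (plane \<Rightarrow> plane) set" where
  "test_fields \<Omega> = {\<phi>. (\<forall>x. \<phi> differentiable (at x))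
     \<and> (\<forall>v. continuous_on UNIV (\<lambda>x. frechet_derivative \<phi> (at x) v))
     \<and> compact (closure {x. \<phi> x \<noteq> 0}) \<and> closure {x. \<phi> x \<noteq> 0} \<subseteq> \<Omega>}"

definition divergence :: "(plane \<Rightarrow> plane) \<Rightarrow> scalar_field" where
  "divergence \<phi> x = (\<Sum>i\<in>UNIV. frechet_derivative \<phi> (at x) (axis i 1) $ i)"

text \<open>
  The distributional derivative \<open>Du\<close> as a functional on test fields, and the total variation
  over \<open>\<Omega>\<close> of such a functional, with the Euclidean norm on the values of the fields.
\<close>

definition distr_deriv :: "plane set \<Rightarrow> scalar_field \<Rightarrow> (plane \<Rightarrow> plane) \<Rightarrow> real" where
  "distr_deriv \<Omega> u \<phi> = - (\<integral>x. u x * divergence \<phi> x \<partial>lebesgue_on \<Omega>)"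

definition total_variation :: "plane set \<Rightarrow> ((plane \<Rightarrow> plane) \<Rightarrow> real) \<Rightarrow> ereal" where
  "total_variation \<Omega> T = (SUP \<phi>\<in>{\<phi> \<in> test_fields \<Omega>. \<forall>x. norm (\<phi> x) \<le> 1}. ereal (T \<phi>))"

definition BV :: "plane set \<Rightarrow> scalar_field set" where
  "BV \<Omega> = {u \<in> L1 \<Omega>. total_variation \<Omega> (distr_deriv \<Omega> u) < \<infinity>}"

definition TV :: "plane set \<Rightarrow> scalar_field \<Rightarrow> ereal" where
  "TV \<Omega> u = (if u \<in> BV \<Omega> then total_variation \<Omega> (distr_deriv \<Omega> u) else \<infinity>)"

text \<open>\<open>TV\<close> is finite on \<open>BV\<close>, so that \<open>real_of_ereal\<close> loses nothing below.\<close>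

definition strict_dist :: "plane set \<Rightarrow> scalar_field \<Rightarrow> scalar_field \<Rightarrow> real" where
  "strict_dist \<Omega> u v =
     L1_nrm \<Omega> (\<lambda>x. u x - v x) + \<bar>real_of_ereal (TV \<Omega> u) - real_of_ereal (TV \<Omega> v)\<bar>"

definition strictly_converges ::
    "plane set \<Rightarrow> (nat \<Rightarrow> scalar_field) \<Rightarrow> scalar_field \<Rightarrow> bool" where
  "strictly_converges \<Omega> w v \<longleftrightarrow>
     (\<forall>k. w k \<in> BV \<Omega>) \<and> v \<in> BV \<Omega> \<and> (\<lambda>k. strict_dist \<Omega> (w k) v) \<longlonglongrightarrow> 0"


section \<open>Subgradients, Bregman distance, minimizing solutions\<close>

definition subdifferential ::
    "plane set \<Rightarrow> (scalar_field \<Rightarrow> ereal) \<Rightarrow> scalar_field \<Rightarrow> scalar_field set" where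
  "subdifferential \<Omega> J u = {\<xi> \<in> L2 \<Omega>. u \<in> L2 \<Omega> \<and> J u < \<infinity>
     \<and> (\<forall>v\<in>L2 \<Omega>. J v \<ge> J u + ereal (ip \<Omega> \<xi> (\<lambda>x. v x - u x)))}"

definition bregman ::
    "plane set \<Rightarrow> (scalar_field \<Rightarrow> ereal) \<Rightarrow> scalar_field \<Rightarrow> scalar_field \<Rightarrow> scalar_field \<Rightarrow> ereal"
  where
  "bregman \<Omega> J \<xi> v u = J v - J u - ereal (ip \<Omega> \<xi> (\<lambda>x. v x - u x))"

definition minimizing_solution ::
    "plane set \<Rightarrow> (scalar_field \<Rightarrow> ereal) \<Rightarrow> (scalar_field \<Rightarrow> scalar_field) \<Rightarrow> scalar_field
      \<Rightarrow> scalar_field \<Rightarrow> bool" where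
  "minimizing_solution \<Omega> J K g u \<longleftrightarrow>
     is_arg_min J (\<lambda>v. v \<in> L2 \<Omega> \<and> ae_eq \<Omega> (K v) g) u"


section \<open>Augmented Lagrangian method and Morozov's discrepancy principle\<close>

text \<open>
  The sequences \<open>u\<close> (from index 1 on) and \<open>p\<close> (from index 0 on) are iterates of the method for
  the data \<open>h\<close>; the minimizer in each step need not be unique.
\<close>

definition augmented_lagrangian ::
    "plane set \<Rightarrow> (scalar_field \<Rightarrow> ereal) \<Rightarrow> (scalar_field \<Rightarrow> scalar_field) \<Rightarrow> (nat \<Rightarrow> real)
      \<Rightarrow> scalar_field \<Rightarrow> scalar_field \<Rightarrow> (nat \<Rightarrow> scalar_field) \<Rightarrow> (nat \<Rightarrow> scalar_field) \<Rightarrow> bool"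
  where
  "augmented_lagrangian \<Omega> J K \<tau> p0 h u p \<longleftrightarrow>
     (\<forall>n. p n \<in> L2 \<Omega>) \<and> ae_eq \<Omega> (p 0) p0
   \<and> (\<forall>n\<ge>1.
        is_arg_min
          (\<lambda>v. ereal (\<tau> n / 2 * (nrm \<Omega> (\<lambda>x. K v x - h x))\<^sup>2) + J v
                - ereal (ip \<Omega> (p (n - 1)) (\<lambda>x. K v x - h x)))
          (\<lambda>v. v \<in> L2 \<Omega>) (u n)
      \<and> ae_eq \<Omega> (p n) (\<lambda>x. p (n - 1) x + \<tau> n * (h x - K (u n) x)))"

text \<open>\<open>R n h\<close> is the \<open>n\<close>-th primal iterate for the data \<open>h\<close>.\<close>

definition morozov ::
    "plane set \<Rightarrow> (scalar_field \<Rightarrow> scalar_field) \<Rightarrow> (nat \<Rightarrow> scalar_field \<Rightarrow> scalar_field)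
      \<Rightarrow> real \<Rightarrow> real \<Rightarrow> scalar_field \<Rightarrow> nat" where
  "morozov \<Omega> K R \<rho> \<delta> h = (LEAST n. n \<ge> 1 \<and> nrm \<Omega> (\<lambda>x. K (R n h) x - h x) < \<rho> * \<delta>)"

end

theory Submission
  imports Defs
begin

text \<open>
  Let \<open>r\<^sub>n = K u\<^sub>n - h\<close> be the residuals for data \<open>h\<close> with \<open>\<parallel>g - h\<parallel> \<le> \<delta>\<close> and \<open>D\<^sub>n\<close> the Bregman distance of
  a minimizing solution from \<open>u\<^sub>n\<close>. The subgradient inequalities give
  \<open>D\<^sub>n \<le> D\<^sub>n\<^sub>-\<^sub>1 + \<tau>\<^sub>n \<parallel>r\<^sub>n\<parallel> (\<delta> - \<parallel>r\<^sub>n\<parallel>)\<close>, so before the discrepancy principle stops the iteration,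
  \<open>D\<^sub>n\<close> decreases and \<open>\<delta>\<^sup>2 (t\<^sub>n - t\<^sub>m)\<close> is bounded by a multiple of \<open>D\<^sub>m\<close>. For exact data the residuals decay
  faster than \<open>t\<^sub>n\<^sup>-\<^sup>1\<^sup>/\<^sup>2\<close> while \<open>\<parallel>p\<^sub>n\<parallel>\<close> grows at most like \<open>t\<^sub>n\<^sup>1\<^sup>/\<^sup>2\<close>, whence \<open>D\<^sub>m \<rightarrow> 0\<close> as \<open>m \<rightarrow> \<infinity>\<close> by weak
  compactness and lower semicontinuity. The iterates \<open>p\<^sub>m\<close> depend Lipschitz continuously on the data
  for every fixed \<open>m\<close>, so for noisy data \<open>D\<^sub>m\<close> is as small as desired once \<open>m\<close> is large and then \<open>k\<close> is
  large. Hence the Bregman distance at the stopping index and \<open>\<delta>\<^sub>k\<^sup>2 t\<^sub>n\<^sub>k\<close> tend to \<open>0\<close>.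

  Strict convergence needs convergence in \<open>L\<^sup>1\<close> without any regularity of the boundary: weak convergence
  in \<open>L\<^sup>2\<close> makes averages over small balls converge, total variation controls the distance to these
  averages locally, and boundedness in \<open>L\<^sup>2\<close> controls the mass near the boundary.
\<close>

section \<open>The space of square-integrable functions\<close>

text \<open>A subgradient of the form \<open>Kadj p\<close> need not exist at a minimizing solution,
  so the multipliers \<open>p n\<close> may be unbounded. Convergence of the total variation
  therefore hinges on the pairing of \<open>p n\<close> with \<open>K (u n) - g\<close>, where
  growth of one factor has to be beaten by decay of the other. The Bregman distance is handled as
  \<open>bregman_gap c g n\<close>, which sees a solution only through its total variation
  \<open>c\<close> and its image \<open>g\<close>; one number thus serves all minimizing solutions.
  Minimizers in a step need not be unique, hence stability in the data is stated for
  \<open>p n\<close>, residuals and gaps, not for \<open>u n\<close>. At the stopping index the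
  residual may lie below the noise level, so the last step may raise the gap, but only by a multiple
  of its step size times the squared noise level; there the boundedness of the step sizes enters.
  Finally, \<open>L2 \<Omega>\<close> consists of functions, not classes: the update rule and the
  linearity of \<open>K\<close> hold almost everywhere, and they are used through norms and inner
  products, which do not see null sets.\<close>

lemma L2_mult_integrable:
  assumes "u \<in> L2 \<Omega>" "v \<in> L2 \<Omega>"
  shows "integrable (lebesgue_on \<Omega>) (\<lambda>x. u x * v x)"
proof (rule Bochner_Integration.integrable_bound)
  show "integrable (lebesgue_on \<Omega>) (\<lambda>x. (u x)\<^sup>2 + (v x)\<^sup>2)"
    using assms by (auto simp: L2_def)
  show "(\<lambda>x. u x * v x) \<in> borel_measurable (lebesgue_on \<Omega>)"
    using assms by (auto simp: L2_def)
  have "\<bar>a * b\<bar> \<le> a\<^sup>2 + b\<^sup>2" for a b :: real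
  proof -
    have "2 * (\<bar>a\<bar> * \<bar>b\<bar>) \<le> \<bar>a\<bar>\<^sup>2 + \<bar>b\<bar>\<^sup>2"
      using sum_squares_bound[of "\<bar>a\<bar>" "\<bar>b\<bar>"] by (simp add: mult.assoc)
    moreover have "0 \<le> \<bar>a\<bar> * \<bar>b\<bar>" by simp
    ultimately have "\<bar>a\<bar> * \<bar>b\<bar> \<le> \<bar>a\<bar>\<^sup>2 + \<bar>b\<bar>\<^sup>2" by linarith
    then show ?thesis by (simp add: abs_mult)
  qed
  then show "AE x in lebesgue_on \<Omega>. norm (u x * v x) \<le> norm ((u x)\<^sup>2 + (v x)\<^sup>2)"
    by simp
qed

lemma L2_add [intro, simp]:
  assumes "u \<in> L2 \<Omega>" "v \<in> L2 \<Omega>"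
  shows "(\<lambda>x. u x + v x) \<in> L2 \<Omega>"
proof -
  have "integrable (lebesgue_on \<Omega>) (\<lambda>x. (u x)\<^sup>2 + (v x)\<^sup>2 + 2 * (u x * v x))"
    using assms L2_mult_integrable[OF assms] by (auto simp: L2_def)
  then show ?thesis
    using assms by (auto simp: L2_def power2_sum mult.assoc)
qed

lemma L2_scale [intro, simp]:
  assumes "u \<in> L2 \<Omega>"
  shows "(\<lambda>x. c * u x) \<in> L2 \<Omega>"
  using assms by (auto simp: L2_def power_mult_distrib)

lemma L2_uminus [intro, simp]:
  assumes "u \<in> L2 \<Omega>"
  shows "(\<lambda>x. - u x) \<in> L2 \<Omega>"
  using L2_scale[OF assms, of "-1"] by simp

lemma L2_diff [intro, simp]:
  assumes "u \<in> L2 \<Omega>" "v \<in> L2 \<Omega>"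
  shows "(\<lambda>x. u x - v x) \<in> L2 \<Omega>"
  using L2_add[OF assms(1) L2_uminus[OF assms(2)]] by simp

lemma L2_zero [intro, simp]: "(\<lambda>x. 0) \<in> L2 \<Omega>"
  by (auto simp: L2_def)

lemma ip_commute: "ip \<Omega> u v = ip \<Omega> v u"
  by (simp add: ip_def mult.commute)

lemma ip_add_left:
  assumes "u \<in> L2 \<Omega>" "v \<in> L2 \<Omega>" "w \<in> L2 \<Omega>"
  shows "ip \<Omega> (\<lambda>x. u x + v x) w = ip \<Omega> u w + ip \<Omega> v w"
  using L2_mult_integrable[of u \<Omega> w] L2_mult_integrable[of v \<Omega> w] assms
  by (simp add: ip_def distrib_right)

lemma ip_scale_left: "ip \<Omega> (\<lambda>x. c * u x) w = c * ip \<Omega> u w"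
  by (simp add: ip_def mult.assoc)

lemma ip_uminus_left: "ip \<Omega> (\<lambda>x. - u x) w = - ip \<Omega> u w"
  using ip_scale_left[of \<Omega> "-1" u w] by simp

lemma ip_diff_left:
  assumes "u \<in> L2 \<Omega>" "v \<in> L2 \<Omega>" "w \<in> L2 \<Omega>"
  shows "ip \<Omega> (\<lambda>x. u x - v x) w = ip \<Omega> u w - ip \<Omega> v w"
  using L2_mult_integrable[of u \<Omega> w] L2_mult_integrable[of v \<Omega> w] assms
  by (simp add: ip_def left_diff_distrib)

lemma ip_add_right:
  assumes "u \<in> L2 \<Omega>" "v \<in> L2 \<Omega>" "w \<in> L2 \<Omega>"
  shows "ip \<Omega> w (\<lambda>x. u x + v x) = ip \<Omega> w u + ip \<Omega> w v"
  using ip_add_left[OF assms] by (simp add: ip_commute)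

lemma ip_scale_right: "ip \<Omega> w (\<lambda>x. c * u x) = c * ip \<Omega> w u"
  using ip_scale_left[of \<Omega> c u w] by (simp add: ip_commute)

lemma ip_uminus_right: "ip \<Omega> w (\<lambda>x. - u x) = - ip \<Omega> w u"
  using ip_uminus_left[of \<Omega> u w] by (simp add: ip_commute)

lemma ip_diff_right:
  assumes "u \<in> L2 \<Omega>" "v \<in> L2 \<Omega>" "w \<in> L2 \<Omega>"
  shows "ip \<Omega> w (\<lambda>x. u x - v x) = ip \<Omega> w u - ip \<Omega> w v"
  using ip_diff_left[OF assms] by (simp add: ip_commute)

lemmas ip_linear = ip_add_left ip_add_right ip_diff_left ip_diff_right ip_scale_left
  ip_scale_right ip_uminus_left ip_uminus_right

lemma ip_ge_zero [simp]: "0 \<le> ip \<Omega> u u"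
  by (simp add: ip_def)

lemma nrm_ge_zero [simp]: "0 \<le> nrm \<Omega> u"
  by (simp add: nrm_def)

lemma nrm_squared: "(nrm \<Omega> u)\<^sup>2 = ip \<Omega> u u"
  by (simp add: nrm_def)

lemma ip_ae_cong_left:
  assumes "ae_eq \<Omega> u v" "u \<in> L2 \<Omega>" "v \<in> L2 \<Omega>" "w \<in> L2 \<Omega>"
  shows "ip \<Omega> u w = ip \<Omega> v w"
  unfolding ip_def
proof (rule integral_cong_AE)
  show "AE x in lebesgue_on \<Omega>. u x * w x = v x * w x"
    using assms(1) by (auto simp: ae_eq_def elim: eventually_mono)
qed (use assms in \<open>auto simp: L2_def\<close>)

lemma ip_ae_cong_right:
  assumes "ae_eq \<Omega> u v" "u \<in> L2 \<Omega>" "v \<in> L2 \<Omega>" "w \<in> L2 \<Omega>"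
  shows "ip \<Omega> w u = ip \<Omega> w v"
  using ip_ae_cong_left[OF assms] by (simp add: ip_commute)

lemma ae_eq_iff_diff:
  assumes "u \<in> L2 \<Omega>" "v \<in> L2 \<Omega>"
  shows "ae_eq \<Omega> u v \<longleftrightarrow> ip \<Omega> (\<lambda>x. u x - v x) (\<lambda>x. u x - v x) = 0"
proof -
  have "(\<integral>x. (u x - v x) * (u x - v x) \<partial>lebesgue_on \<Omega>) = 0
      \<longleftrightarrow> (AE x in lebesgue_on \<Omega>. (u x - v x) * (u x - v x) = 0)"
    by (rule integral_nonneg_eq_0_iff_AE)
      (use L2_mult_integrable[OF L2_diff[OF assms] L2_diff[OF assms]] in auto)
  then show ?thesis
    by (simp add: ae_eq_def ip_def)
qed

lemma ip_Cauchy_Schwarz: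
  assumes "u \<in> L2 \<Omega>" "v \<in> L2 \<Omega>"
  shows "\<bar>ip \<Omega> u v\<bar> \<le> nrm \<Omega> u * nrm \<Omega> v"
proof -
  have key: "0 \<le> ip \<Omega> u u - 2 * s * ip \<Omega> u v + s\<^sup>2 * ip \<Omega> v v" for s
  proof -
    have "0 \<le> ip \<Omega> (\<lambda>x. u x - s * v x) (\<lambda>x. u x - s * v x)"
      by simp
    also have "\<dots> = ip \<Omega> u u - 2 * s * ip \<Omega> u v + s\<^sup>2 * ip \<Omega> v v"
      using assms by (simp add: ip_linear ip_commute[of \<Omega> v u] power2_eq_square algebra_simps)
    finally show ?thesis .
  qed
  have "(ip \<Omega> u v)\<^sup>2 \<le> ip \<Omega> u u * ip \<Omega> v v"
  proof (cases "ip \<Omega> v v = 0")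
    case True
    have "ip \<Omega> u v = 0"
    proof (rule ccontr)
      assume "ip \<Omega> u v \<noteq> 0"
      \<comment> \<open>With the quadratic term gone, this value of \<open>s\<close> turns the
        nonnegative expression in \<open>key\<close> into -1.\<close>
      then show False
        using key[of "(ip \<Omega> u u + 1) / (2 * ip \<Omega> u v)"] True by (simp add: field_simps)
    qed
    then show ?thesis by simp
  next
    case False
    then have "0 < ip \<Omega> v v"
      using ip_ge_zero[of \<Omega> v] by linarith
    then show ?thesis
      using key[of "ip \<Omega> u v / ip \<Omega> v v"] by (simp add: field_simps power2_eq_square)
  qed
  also have "\<dots> = (nrm \<Omega> u * nrm \<Omega> v)\<^sup>2"
    by (simp add: power_mult_distrib nrm_squared)
  finally show ?thesis
    by (metis abs_le_square_iff abs_of_nonneg mult_nonneg_nonneg nrm_ge_zero)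
qed

lemma nrm_triangle:
  assumes "u \<in> L2 \<Omega>" "v \<in> L2 \<Omega>"
  shows "nrm \<Omega> (\<lambda>x. u x + v x) \<le> nrm \<Omega> u + nrm \<Omega> v"
proof (rule power2_le_imp_le)
  have "(nrm \<Omega> (\<lambda>x. u x + v x))\<^sup>2 = ip \<Omega> u u + 2 * ip \<Omega> u v + ip \<Omega> v v"
    using assms by (simp add: nrm_squared ip_linear ip_commute[of \<Omega> v u])
  also have "\<dots> \<le> (nrm \<Omega> u + nrm \<Omega> v)\<^sup>2"
    using ip_Cauchy_Schwarz[OF assms] by (simp add: power2_sum nrm_squared abs_le_iff)
  finally show "(nrm \<Omega> (\<lambda>x. u x + v x))\<^sup>2 \<le> (nrm \<Omega> u + nrm \<Omega> v)\<^sup>2" .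
qed simp

lemma nrm_scale: "nrm \<Omega> (\<lambda>x. c * u x) = \<bar>c\<bar> * nrm \<Omega> u"
  by (simp add: nrm_def ip_linear real_sqrt_mult flip: mult.assoc power2_eq_square)

lemma nrm_minus_commute: "nrm \<Omega> (\<lambda>x. u x - v x) = nrm \<Omega> (\<lambda>x. v x - u x)"
  using nrm_scale[of \<Omega> "-1" "\<lambda>x. u x - v x"] by simp

lemma nrm_ae_cong:
  assumes "ae_eq \<Omega> u v" "u \<in> L2 \<Omega>" "v \<in> L2 \<Omega>"
  shows "nrm \<Omega> u = nrm \<Omega> v"
  using ip_ae_cong_left[OF assms assms(2)] ip_ae_cong_right[OF assms assms(3)]
  by (simp add: nrm_def)

lemma finite_measure_lebesgue_on:
  assumes "open \<Omega>" "bounded \<Omega>"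
  shows "finite_measure (lebesgue_on \<Omega>)"
proof -
  have "\<Omega> \<in> lmeasurable"
    using assms by (intro lmeasurable_open)
  then show ?thesis
    by (intro finite_measureI)
      (auto simp: fmeasurable_def emeasure_restrict_space space_restrict_space less_top)
qed

lemma L2_bounded_measurable:
  assumes "open \<Omega>" "bounded \<Omega>" "f \<in> borel_measurable (lebesgue_on \<Omega>)"
    "\<And>x. x \<in> \<Omega> \<Longrightarrow> \<bar>f x\<bar> \<le> B"
  shows "f \<in> L2 \<Omega>"
proof -
  interpret finite_measure "lebesgue_on \<Omega>"
    using assms by (intro finite_measure_lebesgue_on)
  have "AE x in lebesgue_on \<Omega>. norm ((f x)\<^sup>2) \<le> B\<^sup>2"
    using assms(4) by (auto simp: space_restrict_space simp flip: abs_le_square_iff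
        intro!: AE_I2) (meson abs_ge_self abs_le_square_iff order_trans power2_abs)
  then have "integrable (lebesgue_on \<Omega>) (\<lambda>x. (f x)\<^sup>2)"
    using assms(3) by (intro integrable_const_bound) auto
  then show ?thesis
    using assms(3) by (simp add: L2_def)
qed

lemma L2_imp_integrable:
  assumes "open \<Omega>" "bounded \<Omega>" "u \<in> L2 \<Omega>"
  shows "integrable (lebesgue_on \<Omega>) u"
  using L2_mult_integrable[OF assms(3) L2_bounded_measurable[OF assms(1,2), of "\<lambda>x. 1" 1]]
  by simp

section \<open>Total variation on square-integrable functions\<close>

definition unit_fields :: "plane set \<Rightarrow> (plane \<Rightarrow> plane) set" where
  "unit_fields \<Omega> = {\<phi> \<in> test_fields \<Omega>. \<forall>x. norm (\<phi> x) \<le> 1}"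

lemma zero_unit_field: "(\<lambda>x. 0) \<in> unit_fields \<Omega>"
  by (simp add: unit_fields_def test_fields_def)

lemma divergence_uminus:
  assumes "\<phi> \<in> test_fields \<Omega>"
  shows "divergence (\<lambda>x. - \<phi> x) = (\<lambda>x. - divergence \<phi> x)"
proof
  fix x
  have "(\<phi> has_derivative frechet_derivative \<phi> (at x)) (at x)"
    using assms by (simp add: test_fields_def flip: frechet_derivative_works)
  then have "((\<lambda>x. - \<phi> x) has_derivative (\<lambda>h. - frechet_derivative \<phi> (at x) h)) (at x)"
    by (rule has_derivative_minus)
  note deriv = frechet_derivative_at[OF this, symmetric]
  show "divergence (\<lambda>x. - \<phi> x) x = - divergence \<phi> x"
    by (simp add: divergence_def deriv sum_negf)
qed

lemma uminus_test_field:
  assumes "\<phi> \<in> test_fields \<Omega>"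
  shows "(\<lambda>x. - \<phi> x) \<in> test_fields \<Omega>"
proof -
  have "frechet_derivative (\<lambda>x. - \<phi> x) (at x) = (\<lambda>h. - frechet_derivative \<phi> (at x) h)" for x
  proof -
    have "(\<phi> has_derivative frechet_derivative \<phi> (at x)) (at x)"
      using assms by (simp add: test_fields_def flip: frechet_derivative_works)
    then have "((\<lambda>x. - \<phi> x) has_derivative (\<lambda>h. - frechet_derivative \<phi> (at x) h)) (at x)"
      by (rule has_derivative_minus)
    from frechet_derivative_at[OF this, symmetric] show ?thesis .
  qed
  then show ?thesis
    using assms by (auto simp: test_fields_def intro!: continuous_intros)
qed

lemma uminus_unit_field: "\<phi> \<in> unit_fields \<Omega> \<Longrightarrow> (\<lambda>x. - \<phi> x) \<in> unit_fields \<Omega>"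
  by (simp add: unit_fields_def uminus_test_field)

lemma divergence_L2:
  assumes "open \<Omega>" "bounded \<Omega>" "\<phi> \<in> test_fields \<Omega>"
  shows "divergence \<phi> \<in> L2 \<Omega>"
proof -
  have "continuous_on UNIV (\<lambda>x. divergence \<phi> x)"
    using assms(3) unfolding divergence_def test_fields_def by (intro continuous_intros) auto
  then have cont: "continuous_on S (divergence \<phi>)" for S
    by (rule continuous_on_subset) simp
  have "compact (divergence \<phi> ` closure \<Omega>)"
    using assms(2) by (intro compact_continuous_image cont) simp
  then obtain B where "\<forall>y\<in>divergence \<phi> ` closure \<Omega>. norm y \<le> B"
    using compact_imp_bounded bounded_iff by blast
  then have "\<And>x. x \<in> \<Omega> \<Longrightarrow> \<bar>divergence \<phi> x\<bar> \<le> B"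
    using closure_subset by fastforce
  moreover have "divergence \<phi> \<in> borel_measurable (lebesgue_on \<Omega>)"
    using assms(1) by (intro continuous_imp_measurable_on_sets_lebesgue cont) auto
  ultimately show ?thesis
    using assms by (intro L2_bounded_measurable)
qed

lemma distr_deriv_eq_ip: "distr_deriv \<Omega> u \<phi> = - ip \<Omega> u (divergence \<phi>)"
  by (simp add: distr_deriv_def ip_def)

text \<open>A bounded domain has finite measure, so square-integrable functions are integrable and
  membership in \<open>BV\<close> only asks for a finite supremum. Where it fails the supremum is
  infinite as well, and the case distinction in \<open>TV\<close> disappears.\<close>

lemma TV_eq_SUP:
  assumes "open \<Omega>" "bounded \<Omega>" "u \<in> L2 \<Omega>"
  shows "TV \<Omega> u = (SUP \<phi>\<in>unit_fields \<Omega>. ereal (distr_deriv \<Omega> u \<phi>))"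
  using L2_imp_integrable[OF assms]
  by (auto simp: TV_def BV_def L1_def total_variation_def unit_fields_def)

lemma TV_le_iff:
  assumes "open \<Omega>" "bounded \<Omega>" "u \<in> L2 \<Omega>"
  shows "TV \<Omega> u \<le> ereal c \<longleftrightarrow> (\<forall>\<phi>\<in>unit_fields \<Omega>. distr_deriv \<Omega> u \<phi> \<le> c)"
  by (simp add: TV_eq_SUP[OF assms] SUP_le_iff)

lemma TV_nonneg:
  assumes "open \<Omega>" "bounded \<Omega>" "u \<in> L2 \<Omega>"
  shows "0 \<le> TV \<Omega> u"
proof -
  have "divergence (\<lambda>x. 0) = (\<lambda>x. 0)"
    by (rule ext) (simp add: divergence_def)
  then have "ereal (distr_deriv \<Omega> u (\<lambda>x. 0)) = 0"
    by (simp add: distr_deriv_def zero_ereal_def)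
  then show ?thesis
    unfolding TV_eq_SUP[OF assms] by (intro SUP_upper2[OF zero_unit_field]) simp
qed

lemma BV_iff_TV_finite:
  assumes "open \<Omega>" "bounded \<Omega>" "u \<in> L2 \<Omega>"
  shows "u \<in> BV \<Omega> \<longleftrightarrow> TV \<Omega> u < \<infinity>"
  by (simp add: TV_def BV_def)

lemma TV_finite_real:
  assumes "open \<Omega>" "bounded \<Omega>" "u \<in> L2 \<Omega>" "TV \<Omega> u < \<infinity>"
  obtains c where "TV \<Omega> u = ereal c" "0 \<le> c"
  using TV_nonneg[OF assms(1-3)] assms(4) by (cases "TV \<Omega> u") auto

text \<open>For a fixed test field the distributional derivative is affine along the segment. Real
  bounds \<open>a\<close> and \<open>b\<close> instead of values keep extended real arithmetic out,
  and the form \<open>a + s * (b - a)\<close> lets \<open>subgradient\<close> divide by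
  \<open>s\<close>.\<close>

lemma TV_segment_le:
  assumes "open \<Omega>" "bounded \<Omega>" "u \<in> L2 \<Omega>" "v \<in> L2 \<Omega>"
    and "TV \<Omega> u \<le> ereal a" "TV \<Omega> v \<le> ereal b" "0 \<le> s" "s \<le> 1"
  shows "TV \<Omega> (\<lambda>x. u x + s * (v x - u x)) \<le> ereal (a + s * (b - a))"
proof -
  have "distr_deriv \<Omega> (\<lambda>x. u x + s * (v x - u x)) \<phi> \<le> a + s * (b - a)" if "\<phi> \<in> unit_fields \<Omega>" for \<phi>
  proof -
    have "divergence \<phi> \<in> L2 \<Omega>"
      using that assms by (intro divergence_L2) (auto simp: unit_fields_def)
    then have "distr_deriv \<Omega> (\<lambda>x. u x + s * (v x - u x)) \<phi>
        = (1 - s) * distr_deriv \<Omega> u \<phi> + s * distr_deriv \<Omega> v \<phi>"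
      using assms by (simp add: distr_deriv_eq_ip ip_linear algebra_simps)
    also have "\<dots> \<le> (1 - s) * a + s * b"
      using assms that by (intro add_mono mult_left_mono) (auto simp: TV_le_iff)
    finally show ?thesis by (simp add: algebra_simps)
  qed
  then show ?thesis
    using assms by (simp add: TV_le_iff)
qed

text \<open>Each test field pairs with \<open>w k\<close> through a fixed square-integrable
  divergence, so the limit is taken field by field, before the supremum. The bounds
  \<open>c k\<close> take the place of a limit inferior.\<close>

lemma TV_weakly_lsc:
  assumes "open \<Omega>" "bounded \<Omega>" "weakly_converges \<Omega> w v"
    and "\<And>k. TV \<Omega> (w k) \<le> ereal (c k)" "c \<longlonglongrightarrow> c'"
  shows "TV \<Omega> v \<le> ereal c'"
proof -
  have w: "v \<in> L2 \<Omega>" "\<And>k. w k \<in> L2 \<Omega>"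
    and lim: "\<And>h. h \<in> L2 \<Omega> \<Longrightarrow> (\<lambda>k. ip \<Omega> (w k) h) \<longlonglongrightarrow> ip \<Omega> v h"
    using assms(3) by (auto simp: weakly_converges_def)
  have "distr_deriv \<Omega> v \<phi> \<le> c'" if \<phi>: "\<phi> \<in> unit_fields \<Omega>" for \<phi>
  proof -
    have "(\<lambda>k. distr_deriv \<Omega> (w k) \<phi>) \<longlonglongrightarrow> distr_deriv \<Omega> v \<phi>"
      unfolding distr_deriv_eq_ip
      using \<phi> assms by (intro tendsto_minus lim divergence_L2) (auto simp: unit_fields_def)
    moreover have "distr_deriv \<Omega> (w k) \<phi> \<le> c k" for k
      using assms(4)[of k] w \<phi> assms(1,2) by (simp add: TV_le_iff)
    ultimately show ?thesis
      using assms(5) by (intro LIMSEQ_le) auto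
  qed
  then show ?thesis
    using assms w by (simp add: TV_le_iff)
qed

section \<open>Translations of smooth functions and total variation\<close>

definition has_cont_gradient :: "('a::euclidean_space \<Rightarrow> real) \<Rightarrow> ('a \<Rightarrow> 'a) \<Rightarrow> bool" where
  "has_cont_gradient f G \<longleftrightarrow>
     continuous_on UNIV G \<and> (\<forall>x. (f has_derivative (\<lambda>v. G x \<bullet> v)) (at x))"

lemma has_cont_gradient_imp_continuous:
  assumes "has_cont_gradient f G"
  shows "continuous_on S f"
  by (rule continuous_on_subset[of UNIV])
    (use assms in \<open>auto simp: has_cont_gradient_def
      intro!: continuous_at_imp_continuous_on has_derivative_continuous\<close>)

lemma has_cont_gradient_add:
  assumes "has_cont_gradient f F" "has_cont_gradient g G"
  shows "has_cont_gradient (\<lambda>x. f x + g x) (\<lambda>x. F x + G x)"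
  using assms unfolding has_cont_gradient_def
  by (auto simp: inner_add_left intro!: continuous_intros derivative_eq_intros)

lemma has_cont_gradient_mult:
  assumes "has_cont_gradient f F" "has_cont_gradient g G"
  shows "has_cont_gradient (\<lambda>x. f x * g x) (\<lambda>x. g x *\<^sub>R F x + f x *\<^sub>R G x)"
  using assms has_cont_gradient_imp_continuous[OF assms(1)]
    has_cont_gradient_imp_continuous[OF assms(2)]
  unfolding has_cont_gradient_def
  by (auto simp: inner_add_left mult.commute
      intro!: continuous_intros derivative_eq_intros)

lemma has_cont_gradient_compose_real:
  fixes f :: "'a::euclidean_space \<Rightarrow> real"
  assumes "has_cont_gradient f F" "continuous_on UNIV h'"
    and "\<And>t. (h has_real_derivative h' t) (at t)"
  shows "has_cont_gradient (\<lambda>x. h (f x)) (\<lambda>x. h' (f x) *\<^sub>R F x)"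
proof -
  have "((\<lambda>x. h (f x)) has_derivative (\<lambda>v. h' (f x) *\<^sub>R F x \<bullet> v)) (at x)" for x
  proof -
    have "(f has_derivative (\<lambda>v. F x \<bullet> v)) (at x)"
      using assms(1) by (simp add: has_cont_gradient_def)
    moreover have "(h has_derivative (*) (h' (f x))) (at (f x))"
      using assms(3) by (simp add: has_field_derivative_def)
    ultimately show ?thesis
      using has_derivative_compose by fastforce
  qed
  moreover have "continuous_on UNIV (\<lambda>x. h' (f x) *\<^sub>R F x)"
    using assms(1) has_cont_gradient_imp_continuous[OF assms(1)]
    by (auto simp: has_cont_gradient_def
        intro!: continuous_intros continuous_on_compose2[OF assms(2)])
  ultimately show ?thesis
    by (simp add: has_cont_gradient_def)
qed

text \<open>Polynomials are the smooth functions that \<open>integral_cutoff_abs_le\<close> obtains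
  from the Stone-Weierstrass theorem, in place of mollified ones. In the linear case the gradient is
  the representing vector \<open>adjoint f 1\<close>.\<close>

lemma real_polynomial_function_has_cont_gradient:
  fixes p :: "'a::euclidean_space \<Rightarrow> real"
  assumes "real_polynomial_function p"
  shows "\<exists>G. has_cont_gradient p G"
  using assms
proof induction
  case (linear f)
  then have "linear f"
    by (rule bounded_linear.linear)
  then have "f v = adjoint f 1 \<bullet> v" for v
    using adjoint_works[of f v 1] by (simp add: inner_commute)
  then have "f = (\<lambda>v. adjoint f 1 \<bullet> v)"
    by blast
  then have "(f has_derivative (\<lambda>v. adjoint f 1 \<bullet> v)) (at x)" for x
    using bounded_linear_imp_has_derivative[OF linear, of "at x"] by simp
  then show ?case
    unfolding has_cont_gradient_def by (intro exI[of _ "\<lambda>x. adjoint f 1"]) auto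
next
  case (const c)
  then show ?case
    unfolding has_cont_gradient_def by (intro exI[of _ "\<lambda>x. 0"]) (simp add: inner_zero_left[abs_def])
qed (blast intro: has_cont_gradient_add has_cont_gradient_mult)+

text \<open>The positive part has a corner at 0, its square has none: the first order remainder is
  at most \<open>(s - t)\<^sup>2\<close>. This is the profile of \<open>cutoff\<close>.\<close>

lemma max_zero_squared_has_derivative:
  "((\<lambda>t. (max 0 t)\<^sup>2) has_real_derivative 2 * max 0 t) (at (t::real))"
proof -
  have bound: "\<bar>(max 0 s)\<^sup>2 - (max 0 t)\<^sup>2 - 2 * max 0 t * (s - t)\<bar> \<le> \<bar>s - t\<bar> * \<bar>s - t\<bar>" for s
  proof (cases "0 \<le> s"; cases "0 \<le> t")
    assume "0 \<le> s" "0 \<le> t"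
    then have "(max 0 s)\<^sup>2 - (max 0 t)\<^sup>2 - 2 * max 0 t * (s - t) = (s - t) * (s - t)"
      by (simp add: power2_eq_square algebra_simps)
    then show ?thesis
      by (simp add: abs_mult)
  next
    assume "0 \<le> s" "\<not> 0 \<le> t"
    then show ?thesis
      using mult_mono[of s "s - t" s "s - t"] by (simp add: power2_eq_square)
  next
    assume st: "\<not> 0 \<le> s" "0 \<le> t"
    then have "t * (t - 2 * s) \<le> (t - s) * (t - s)"
      by (simp add: algebra_simps)
    moreover have "0 \<le> t * (t - 2 * s)"
      using st by simp
    moreover have "(max 0 s)\<^sup>2 - (max 0 t)\<^sup>2 - 2 * max 0 t * (s - t) = t * (t - 2 * s)"
      using st by (simp add: power2_eq_square algebra_simps)
    ultimately show ?thesis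
      using st by simp
  qed simp
  have "((\<lambda>s. ((max 0 s)\<^sup>2 - (max 0 t)\<^sup>2) / (s - t) - 2 * max 0 t) \<longlongrightarrow> 0) (at t)"
  proof (rule Lim_null_comparison)
    show "\<forall>\<^sub>F s in at t. norm (((max 0 s)\<^sup>2 - (max 0 t)\<^sup>2) / (s - t) - 2 * max 0 t) \<le> \<bar>s - t\<bar>"
    proof (rule eventually_at_filter[THEN iffD2], rule always_eventually, intro allI impI)
      fix s assume "s \<noteq> t"
      then have "\<bar>((max 0 s)\<^sup>2 - (max 0 t)\<^sup>2) / (s - t) - 2 * max 0 t\<bar>
          = \<bar>(max 0 s)\<^sup>2 - (max 0 t)\<^sup>2 - 2 * max 0 t * (s - t)\<bar> / \<bar>s - t\<bar>"
        by (simp add: divide_diff_eq_iff flip: abs_divide)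
      also have "\<dots> \<le> \<bar>s - t\<bar>"
        using bound[of s] \<open>s \<noteq> t\<close> by (simp add: divide_le_eq)
      finally show "norm (((max 0 s)\<^sup>2 - (max 0 t)\<^sup>2) / (s - t) - 2 * max 0 t) \<le> \<bar>s - t\<bar>"
        by simp
    qed
    have "((\<lambda>s. \<bar>s - t\<bar>) \<longlongrightarrow> \<bar>t - t\<bar>) (at t)"
      by (intro tendsto_intros)
    then show "((\<lambda>s. \<bar>s - t\<bar>) \<longlongrightarrow> 0) (at t)"
      by simp
  qed
  then show ?thesis
    by (simp add: has_field_derivative_iff LIM_zero_iff)
qed

text \<open>The squared distance is smooth at the centre \<open>a\<close>, and the outer square
  removes the kink at the sphere of radius \<open>r\<close>, which makes an elementary bump of class
  C1. For positive \<open>r\<close> it is at least 9/16 on the ball of half the radius.\<close>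

definition cutoff :: "'a::euclidean_space \<Rightarrow> real \<Rightarrow> 'a \<Rightarrow> real" where
  "cutoff a r x = (max 0 (1 - (norm (x - a))\<^sup>2 / r\<^sup>2))\<^sup>2"

lemma cutoff_has_cont_gradient: "\<exists>G. has_cont_gradient (cutoff a r) G"
proof -
  have "has_cont_gradient (\<lambda>x. 1 - (norm (x - a))\<^sup>2 / r\<^sup>2) (\<lambda>x. (- 2 / r\<^sup>2) *\<^sub>R (x - a))"
    unfolding has_cont_gradient_def power2_norm_eq_inner divide_inverse
    by (auto intro!: continuous_intros derivative_eq_intros
        simp: fun_eq_iff inner_commute algebra_simps)
  moreover have "continuous_on UNIV (\<lambda>t::real. 2 * max 0 t)"
    by (intro continuous_intros)
  ultimately show ?thesis
    unfolding cutoff_def[abs_def]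
    using has_cont_gradient_compose_real[OF _ _ max_zero_squared_has_derivative] by blast
qed

lemma cutoff_nonneg: "0 \<le> cutoff a r x"
  by (simp add: cutoff_def)

lemma cutoff_le_one: "cutoff a r x \<le> 1"
  unfolding cutoff_def by (intro power_le_one) (auto simp: max_def)

lemma cutoff_eq_zero:
  assumes "0 < r" "x \<notin> cball a r"
  shows "cutoff a r x = 0"
proof -
  have "r\<^sup>2 \<le> (norm (x - a))\<^sup>2"
    using assms by (intro power_mono) (auto simp: dist_norm norm_minus_commute)
  then show ?thesis
    using assms by (simp add: cutoff_def max_def)
qed

lemma cutoff_ge_half:
  assumes "0 < r" "x \<in> ball a (r / 2)"
  shows "1 / 2 \<le> cutoff a r x"
proof -
  have "(norm (x - a))\<^sup>2 \<le> (r / 2)\<^sup>2"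
    using assms by (intro power_mono) (auto simp: dist_norm norm_minus_commute)
  then have "3 / 4 \<le> 1 - (norm (x - a))\<^sup>2 / r\<^sup>2"
    using assms by (simp add: field_simps)
  then have "3 / 4 \<le> max 0 (1 - (norm (x - a))\<^sup>2 / r\<^sup>2)"
    by (rule max.coboundedI2)
  then have "(3 / 4)\<^sup>2 \<le> cutoff a r x"
    unfolding cutoff_def by (rule power_mono) simp
  then show ?thesis
    by (rule order_trans[rotated]) (simp add: power2_eq_square)
qed

text \<open>
  The difference of \<open>\<psi>\<close> and its translate by \<open>y\<close> is the divergence of the field
  \<open>x \<mapsto> (\<integral>\<^sub>0\<^sup>1 \<psi> (x - t y) dt) y\<close>, whose norm is at most that of \<open>y\<close>.
\<close>

lemma segment_average_gradient:
  fixes \<psi> :: "'a::euclidean_space \<Rightarrow> real" and y :: 'a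
  assumes "has_cont_gradient \<psi> G"
  defines "c \<equiv> \<lambda>x. integral (cbox 0 1) (\<lambda>t::real. \<psi> (x - t *\<^sub>R y))"
    and "C \<equiv> \<lambda>x. integral (cbox 0 1) (\<lambda>t::real. G (x - t *\<^sub>R y))"
  shows "has_cont_gradient c C" and "C x \<bullet> y = \<psi> x - \<psi> (x - y)"
proof -
  have G: "continuous_on UNIV G" and D: "\<And>x. (\<psi> has_derivative (\<lambda>v. G x \<bullet> v)) (at x)"
    using assms(1) by (auto simp: has_cont_gradient_def)
  have cG: "continuous_on S (\<lambda>t. G (x - t *\<^sub>R y))" for x and S :: "real set"
    by (intro continuous_on_compose2[OF G] continuous_intros) auto
  have c\<psi>: "continuous_on S (\<lambda>t. \<psi> (x - t *\<^sub>R y))" for x and S :: "real set"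
    by (intro continuous_on_compose2[OF has_cont_gradient_imp_continuous[OF assms(1), of UNIV]]
        continuous_intros) auto
  have "(c has_derivative (\<lambda>v. C x \<bullet> v)) (at x)" for x
  proof -
    have "((\<lambda>x. integral (cbox 0 1) (\<lambda>t::real. \<psi> (x - t *\<^sub>R y))) has_derivative
        blinfun_apply (integral (cbox 0 1) (\<lambda>t. blinfun_inner_right (G (x - t *\<^sub>R y))))) (at x)"
    proof (rule leibniz_rule)
      show "((\<lambda>x. \<psi> (x - t *\<^sub>R y)) has_derivative
          blinfun_apply (blinfun_inner_right (G (x - t *\<^sub>R y)))) (at x)" for x t
      proof -
        have "((\<lambda>x. x - t *\<^sub>R y) has_derivative (\<lambda>v. v)) (at x)"
          by (auto intro!: derivative_eq_intros)
        from has_derivative_compose[OF this D] show ?thesis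
          by (simp add: blinfun_inner_right.rep_eq)
      qed
      show "(\<lambda>t. \<psi> (x - t *\<^sub>R y)) integrable_on cbox 0 1" for x
        by (intro integrable_continuous c\<psi>)
      show "continuous_on (UNIV \<times> cbox 0 (1::real))
          (\<lambda>(x, t). blinfun_inner_right (G (x - t *\<^sub>R y)))"
        unfolding split_def
        by (intro bounded_linear.continuous_on[OF bounded_linear_blinfun_inner_right]
            continuous_on_compose2[OF G] continuous_intros) auto
    qed auto
    moreover have "integral (cbox 0 1) (\<lambda>t::real. blinfun_inner_right (G (x - t *\<^sub>R y)))
        = blinfun_inner_right (C x)"
      unfolding C_def
      using integral_linear[OF integrable_continuous[OF cG] bounded_linear_blinfun_inner_right]
      by (simp add: o_def)
    ultimately show ?thesis
      by (simp add: c_def blinfun_inner_right.rep_eq)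
  qed
  moreover have "continuous_on UNIV C"
    unfolding C_def
    by (rule integral_continuous_on_param)
      (auto simp: split_def intro!: continuous_on_compose2[OF G] continuous_intros)
  ultimately show "has_cont_gradient c C"
    by (simp add: has_cont_gradient_def)
  \<comment> \<open>This integrand is the derivative of \<open>\<psi>\<close> along the segment from
    \<open>x\<close> to \<open>x - y\<close>, so its integral is known from the end points as well
    as from \<open>C\<close>.\<close>
  have "((\<lambda>t. - G (x - t *\<^sub>R y) \<bullet> y) has_integral \<psi> (x - 1 *\<^sub>R y) - \<psi> (x - 0 *\<^sub>R y)) {0..1}"
  proof (rule fundamental_theorem_of_calculus)
    fix t :: real assume "t \<in> {0..1}"
    have "((\<lambda>t. x - t *\<^sub>R y) has_derivative (\<lambda>s. - (s *\<^sub>R y))) (at t within {0..1})"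
      by (auto intro!: derivative_eq_intros)
    from has_derivative_compose[OF this D]
    show "((\<lambda>t. \<psi> (x - t *\<^sub>R y)) has_vector_derivative - G (x - t *\<^sub>R y) \<bullet> y)
        (at t within {0..1})"
      by (simp add: has_vector_derivative_def)
  qed simp
  moreover have "((\<lambda>t. - G (x - t *\<^sub>R y) \<bullet> y) has_integral - C x \<bullet> y) {0..1}"
  proof -
    have "((\<lambda>t. G (x - t *\<^sub>R y)) has_integral C x) (cbox 0 (1::real))"
      unfolding C_def by (intro integrable_integral integrable_continuous cG)
    from has_integral_linear[OF this bounded_linear_inner_left[of "- y"]] show ?thesis
      by (simp add: o_def)
  qed
  ultimately have "- C x \<bullet> y = \<psi> (x - 1 *\<^sub>R y) - \<psi> (x - 0 *\<^sub>R y)"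
    by (rule has_integral_unique[rotated])
  then show "C x \<bullet> y = \<psi> x - \<psi> (x - y)"
    by simp
qed

text \<open>Dual form of the bound on the mean modulus of continuity by the total variation. The
  test function is shifted rather than \<open>u\<close>, so no values of \<open>u\<close> outside
  \<Omega> occur; the ball enlarged by \<open>norm y\<close> has to lie in \<Omega> because it holds
  the support of the field.\<close>

lemma translation_le_TV:
  assumes dom: "open \<Omega>" "bounded \<Omega>" and u: "u \<in> L2 \<Omega>" "TV \<Omega> u \<le> ereal T"
    and grad: "has_cont_gradient \<psi> G" and bound: "\<And>x. \<bar>\<psi> x\<bar> \<le> 1"
    and supp: "\<And>x. x \<notin> cball a r \<Longrightarrow> \<psi> x = 0" "cball a (r + norm y) \<subseteq> \<Omega>"
  shows "ip \<Omega> u (\<lambda>x. \<psi> x - \<psi> (x - y)) \<le> norm y * T"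
proof (cases "y = 0")
  case True
  then show ?thesis by (simp add: ip_def)
next
  case False
  define c where "c = (\<lambda>x. integral (cbox 0 1) (\<lambda>t::real. \<psi> (x - t *\<^sub>R y)))"
  define C where "C = (\<lambda>x. integral (cbox 0 1) (\<lambda>t::real. G (x - t *\<^sub>R y)))"
  \<comment> \<open>The inverse normalises \<open>y\<close>, and the sign cancels the minus in
    \<open>distr_deriv\<close>.\<close>
  define k where "k = - inverse (norm y)"
  define \<phi> where "\<phi> = (\<lambda>x. (k * c x) *\<^sub>R y)"
  have cC: "has_cont_gradient c C" "\<And>x. C x \<bullet> y = \<psi> x - \<psi> (x - y)"
    unfolding c_def C_def by (rule segment_average_gradient[OF grad])+
  have deriv: "(\<phi> has_derivative (\<lambda>v. (k * (C x \<bullet> v)) *\<^sub>R y)) (at x)" for x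
    using cC(1) unfolding \<phi>_def has_cont_gradient_def by (auto intro!: derivative_eq_intros)
  note frechet = frechet_derivative_at[OF deriv, symmetric]
  have "\<bar>c x\<bar> \<le> 1" for x
  proof -
    have "norm (c x) \<le> integral (cbox 0 (1::real)) (\<lambda>t. 1)"
      unfolding c_def
    proof (rule integral_norm_bound_integral)
      show "(\<lambda>t. \<psi> (x - t *\<^sub>R y)) integrable_on cbox 0 1"
        by (intro integrable_continuous continuous_intros continuous_on_compose2
            [OF has_cont_gradient_imp_continuous[OF grad, of UNIV]]) auto
    qed (use bound in auto)
    then show ?thesis by simp
  qed
  then have norm_\<phi>: "norm (\<phi> x) \<le> 1" for x
    using False by (simp add: \<phi>_def k_def abs_mult field_simps)
  \<comment> \<open>For \<open>x\<close> outside the larger ball the whole segment from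
    \<open>x\<close> to \<open>x - y\<close> misses the ball that carries
    \<open>\<psi>\<close>.\<close>
  have "{x. \<phi> x \<noteq> 0} \<subseteq> cball a (r + norm y)"
  proof (rule ccontr)
    assume "\<not> ?thesis"
    then obtain x where x: "\<phi> x \<noteq> 0" "x \<notin> cball a (r + norm y)"
      by blast
    have "\<psi> (x - t *\<^sub>R y) = 0" if "t \<in> cbox 0 1" for t :: real
    proof (rule supp(1))
      have "dist a x \<le> dist a (x - t *\<^sub>R y) + norm (t *\<^sub>R y)"
        using dist_triangle[of a x "x - t *\<^sub>R y"] by (simp add: dist_norm)
      also have "norm (t *\<^sub>R y) \<le> norm y"
        using that by (simp add: mult_left_le_one_le)
      finally show "x - t *\<^sub>R y \<notin> cball a r"
        using x(2) by simp
    qed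
    then have "c x = integral (cbox 0 (1::real)) (\<lambda>t. 0)"
      unfolding c_def by (intro integral_cong) auto
    then show False
      using x(1) by (simp add: \<phi>_def)
  qed
  then have cl: "closure {x. \<phi> x \<noteq> 0} \<subseteq> cball a (r + norm y)"
    by (simp add: closure_minimal)
  have "\<phi> \<in> test_fields \<Omega>"
    unfolding test_fields_def mem_Collect_eq
  proof (intro conjI allI)
    show "\<phi> differentiable at x" for x
      using deriv by (auto simp: differentiable_def)
    show "continuous_on UNIV (\<lambda>x. frechet_derivative \<phi> (at x) v)" for v
      using cC(1) unfolding frechet has_cont_gradient_def by (auto intro!: continuous_intros)
    show "compact (closure {x. \<phi> x \<noteq> 0})"
      using cl bounded_subset[OF bounded_cball] by (simp add: compact_eq_bounded_closed)
    show "closure {x. \<phi> x \<noteq> 0} \<subseteq> \<Omega>"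
      using cl supp(2) by blast
  qed
  then have "distr_deriv \<Omega> u \<phi> \<le> T"
    using norm_\<phi> u dom by (simp add: TV_le_iff unit_fields_def)
  moreover have "divergence \<phi> = (\<lambda>x. k * (\<psi> x - \<psi> (x - y)))"
  proof
    fix x
    have "divergence \<phi> x = k * (\<Sum>i\<in>UNIV. C x $ i * y $ i)"
      by (simp add: divergence_def frechet inner_axis sum_distrib_left mult.assoc)
    also have "(\<Sum>i\<in>UNIV. C x $ i * y $ i) = C x \<bullet> y"
      by (simp add: inner_vec_def)
    also have "\<dots> = \<psi> x - \<psi> (x - y)"
      by (rule cC(2))
    finally show "divergence \<phi> x = k * (\<psi> x - \<psi> (x - y))"
      .
  qed
  ultimately have "inverse (norm y) * ip \<Omega> u (\<lambda>x. \<psi> x - \<psi> (x - y)) \<le> T"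
    by (simp only: distr_deriv_eq_ip ip_scale_right) (simp add: k_def)
  then show ?thesis
    using False by (simp add: field_simps)
qed

section \<open>Averages over balls\<close>

text \<open>The weighted L1 norm is the integral of \<open>f\<close> against
  \<open>cutoff a r\<close> times the sign of \<open>f\<close>. Approximating the sign almost
  everywhere by continuous functions, and these uniformly by polynomials, gives admissible
  \<open>\<psi>\<close>; dominated convergence passes the bound on.\<close>

lemma integral_cutoff_abs_le:
  assumes dom: "open \<Omega>" "bounded \<Omega>" and f: "integrable (lebesgue_on \<Omega>) f"
    and r: "0 < r" "cball a r \<subseteq> \<Omega>"
    and le: "\<And>\<psi> G. \<lbrakk>has_cont_gradient \<psi> G; \<And>x. \<bar>\<psi> x\<bar> \<le> 1; \<And>x. x \<notin> cball a r \<Longrightarrow> \<psi> x = 0\<rbrakk>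
      \<Longrightarrow> (\<integral>x. f x * \<psi> x \<partial>lebesgue_on \<Omega>) \<le> c"
  shows "(\<integral>x. cutoff a r x * \<bar>f x\<bar> \<partial>lebesgue_on \<Omega>) \<le> c"
proof -
  have \<Omega>: "\<Omega> \<in> sets lebesgue"
    using dom by auto
  have "(\<lambda>x. sgn (f x)) \<in> borel_measurable (lebesgue_on \<Omega>)"
    using f by simp
  then have "(\<lambda>x. sgn (f x)) measurable_on \<Omega>"
    using \<Omega> by (simp add: measurable_on_iff_borel_measurable)
  then obtain Z g where Z: "negligible Z" and g: "\<And>n. continuous_on UNIV (g n)"
    and lim: "\<And>x. x \<notin> Z \<Longrightarrow> (\<lambda>n::nat. g n x) \<longlonglongrightarrow> (if x \<in> \<Omega> then sgn (f x) else 0)"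
    unfolding measurable_on_def by blast
  \<comment> \<open>Clipping to [-1, 1] keeps the pointwise limit, since the sign already lies
    there.\<close>
  define h where "h n x = max (- 1) (min 1 (g n x))" for n x
  have "\<exists>p. real_polynomial_function p \<and> (\<forall>x\<in>closure \<Omega>. \<bar>h n x - p x\<bar> < inverse (real (Suc n)))" for n
  proof -
    have "continuous_on (closure \<Omega>) (h n)"
      unfolding h_def by (intro continuous_intros continuous_on_subset[OF g]) auto
    then show ?thesis
      using dom by (elim Stone_Weierstrass_real_polynomial_function[rotated]) auto
  qed
  then obtain p where p: "\<And>n. real_polynomial_function (p n)"
    and hp: "\<And>n x. x \<in> closure \<Omega> \<Longrightarrow> \<bar>h n x - p n x\<bar> < inverse (real (Suc n))"
    by metis
  \<comment> \<open>The polynomial may overshoot 1 by \<open>inverse (real (Suc n))\<close>; the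
    factor \<open>s n\<close> restores the bound and tends to 1.\<close>
  define s where "s n = inverse (1 + inverse (real (Suc n)))" for n
  define \<psi> where "\<psi> n x = cutoff a r x * (s n * p n x)" for n x
  have s: "0 < s n" "s n * (1 + inverse (real (Suc n))) = 1" for n
  proof -
    have "0 < 1 + inverse (real (Suc n))"
      by (intro add_pos_pos) auto
    then show "0 < s n" "s n * (1 + inverse (real (Suc n))) = 1"
      unfolding s_def by (simp_all del: of_nat_Suc)
  qed
  have \<psi>_bound: "\<bar>\<psi> n x\<bar> \<le> 1" for n x
  proof (cases "x \<in> cball a r")
    case True
    then have "\<bar>h n x - p n x\<bar> < inverse (real (Suc n))"
      using r closure_subset by (intro hp) blast
    moreover have "\<bar>h n x\<bar> \<le> 1"
      by (auto simp: h_def)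
    ultimately have "\<bar>p n x\<bar> \<le> 1 + inverse (real (Suc n))"
      by linarith
    then have "s n * \<bar>p n x\<bar> \<le> 1"
      using mult_left_mono[of "\<bar>p n x\<bar>" _ "s n"] s[of n] by fastforce
    then show ?thesis
      unfolding \<psi>_def using s(1)[of n] cutoff_nonneg[of a r x] cutoff_le_one[of a r x]
      by (simp add: abs_mult mult_le_one)
  next
    case False
    then have "cutoff a r x = 0"
      using r(1) by (rule cutoff_eq_zero[rotated])
    then show ?thesis
      by (simp add: \<psi>_def)
  qed
  have \<psi>_le: "(\<integral>x. f x * \<psi> n x \<partial>lebesgue_on \<Omega>) \<le> c" for n
  proof -
    obtain G where G: "has_cont_gradient (cutoff a r) G"
      using cutoff_has_cont_gradient by blast
    have "real_polynomial_function (\<lambda>x. s n * p n x)"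
      by (intro real_polynomial_function.intros(2,4) p)
    then obtain P where "has_cont_gradient (\<lambda>x. s n * p n x) P"
      using real_polynomial_function_has_cont_gradient by blast
    from has_cont_gradient_mult[OF G this] have
      "has_cont_gradient (\<psi> n) (\<lambda>x. (s n * p n x) *\<^sub>R G x + cutoff a r x *\<^sub>R P x)"
      by (simp add: \<psi>_def[abs_def])
    then show ?thesis
    proof (rule le)
      show "\<bar>\<psi> n x\<bar> \<le> 1" for x
        by (rule \<psi>_bound)
      show "\<psi> n x = 0" if "x \<notin> cball a r" for x
        using cutoff_eq_zero[OF r(1) that] by (simp add: \<psi>_def)
    qed
  qed
  have "AE x in lebesgue_on \<Omega>. x \<notin> Z"
  proof -
    have "AE x in lebesgue. x \<notin> Z"
      using Z by (auto simp: negligible_iff_null_sets intro: AE_not_in)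
    then show ?thesis
      using \<Omega> by (auto simp: AE_restrict_space_iff elim: eventually_mono)
  qed
  then have "AE x in lebesgue_on \<Omega>. (\<lambda>n. f x * \<psi> n x) \<longlonglongrightarrow> cutoff a r x * \<bar>f x\<bar>"
  proof (rule AE_mp, intro AE_I2 impI)
    fix x assume x: "x \<in> space (lebesgue_on \<Omega>)" "x \<notin> Z"
    then have "x \<in> \<Omega>"
      by (simp add: space_restrict_space)
    then have "(\<lambda>n. h n x) \<longlonglongrightarrow> max (- 1) (min 1 (sgn (f x)))"
      unfolding h_def using lim[OF x(2)] by (auto intro!: tendsto_intros)
    moreover have "max (- 1) (min 1 (sgn (f x))) = sgn (f x)"
      by (auto simp: sgn_if)
    moreover have "(\<lambda>n. h n x - p n x) \<longlonglongrightarrow> 0"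
    proof (rule Lim_null_comparison)
      show "\<forall>\<^sub>F n in sequentially. norm (h n x - p n x) \<le> inverse (real (Suc n))"
        using hp \<open>x \<in> \<Omega>\<close> closure_subset by (intro always_eventually allI) (fastforce intro: less_imp_le)
      show "(\<lambda>n. inverse (real (Suc n))) \<longlonglongrightarrow> 0"
        by (rule LIMSEQ_inverse_real_of_nat)
    qed
    ultimately have "(\<lambda>n. h n x - (h n x - p n x)) \<longlonglongrightarrow> sgn (f x) - 0"
      by (intro tendsto_diff) auto
    then have "(\<lambda>n. p n x) \<longlonglongrightarrow> sgn (f x)"
      by simp
    moreover have "s \<longlonglongrightarrow> inverse (1 + 0)"
      unfolding s_def by (intro tendsto_intros LIMSEQ_inverse_real_of_nat) auto
    ultimately have "(\<lambda>n. f x * \<psi> n x) \<longlonglongrightarrow> f x * (cutoff a r x * (inverse (1 + 0) * sgn (f x)))"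
      unfolding \<psi>_def by (intro tendsto_intros)
    then show "(\<lambda>n. f x * \<psi> n x) \<longlonglongrightarrow> cutoff a r x * \<bar>f x\<bar>"
      by (simp add: abs_sgn mult_ac)
  qed
  moreover have meas: "cutoff a r \<in> borel_measurable (lebesgue_on \<Omega>)"
      "p n \<in> borel_measurable (lebesgue_on \<Omega>)" for n
  proof -
    obtain G P where "has_cont_gradient (cutoff a r) G" "has_cont_gradient (p n) P"
      using cutoff_has_cont_gradient real_polynomial_function_has_cont_gradient[OF p] by blast
    then show "cutoff a r \<in> borel_measurable (lebesgue_on \<Omega>)"
        "p n \<in> borel_measurable (lebesgue_on \<Omega>)"
      using has_cont_gradient_imp_continuous \<Omega>
      by (blast intro: continuous_imp_measurable_on_sets_lebesgue)+
  qed
  ultimately have "(\<lambda>n. \<integral>x. f x * \<psi> n x \<partial>lebesgue_on \<Omega>)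
      \<longlonglongrightarrow> (\<integral>x. cutoff a r x * \<bar>f x\<bar> \<partial>lebesgue_on \<Omega>)"
  proof (intro integral_dominated_convergence[where w = "\<lambda>x. \<bar>f x\<bar>"])
    show "AE x in lebesgue_on \<Omega>. norm (f x * \<psi> n x) \<le> \<bar>f x\<bar>" for n
      using \<psi>_bound by (auto simp: abs_mult mult_left_le)
  qed (use f meas in \<open>auto simp: \<psi>_def\<close>)
  then show ?thesis
    using \<psi>_le by (intro LIMSEQ_le_const2) auto
qed

text \<open>A product majorant gives absolute integrability, which licenses both exchanges of
  integrals in \<open>ball_averages_bound\<close>.\<close>

lemma (in pair_sigma_finite) integrable_product_bound:
  fixes f :: "_ \<Rightarrow> real"
  assumes "f \<in> borel_measurable (M1 \<Otimes>\<^sub>M M2)" "integrable M1 a" "integrable M2 b"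
    and le: "\<And>x y. \<bar>f (x, y)\<bar> \<le> \<bar>a x :: real\<bar> * \<bar>b y :: real\<bar>"
  shows "integrable (M1 \<Otimes>\<^sub>M M2) f"
proof -
  have meas: "(\<lambda>p. a (fst p) * b (snd p)) \<in> borel_measurable (M1 \<Otimes>\<^sub>M M2)"
    using assms(2,3) by measurable
  have "integrable (M1 \<Otimes>\<^sub>M M2) (\<lambda>p. a (fst p) * b (snd p))"
    using assms(2,3) meas by (intro Fubini_integrable) (auto simp: abs_mult)
  then show ?thesis
    using assms(1) by (rule Bochner_Integration.integrable_bound) (use le in \<open>auto simp: abs_mult\<close>)
qed

lemma lborel_integral_reflect:
  fixes f :: "'a::euclidean_space \<Rightarrow> real"
  assumes "f \<in> borel_measurable borel"
  shows "(\<integral>y. f (x - y) \<partial>lborel) = (\<integral>z. f z \<partial>lborel)"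
proof -
  have "lborel = distr lborel borel (\<lambda>y. x - y)"
    by (subst lborel_affine[of "- 1" x]) (auto simp: density_1)
  then have "(\<integral>z. f z \<partial>lborel) = (\<integral>z. f z \<partial>distr lborel borel (\<lambda>y. x - y))"
    by simp
  also have "\<dots> = (\<integral>y. f (x - y) \<partial>lborel)"
    using assms by (intro integral_distr) auto
  finally show ?thesis ..
qed

lemma indicator_cball_L2:
  assumes "open \<Omega>" "bounded \<Omega>"
  shows "indicator (cball z e) \<in> L2 \<Omega>"
proof (rule L2_bounded_measurable[OF assms])
  show "indicator (cball z e) \<in> borel_measurable (lebesgue_on \<Omega>)"
    by (intro borel_measurable_indicator measurable_restrict_space1) auto
  show "\<bar>indicator (cball z e) x\<bar> \<le> (1::real)" for x
    by (simp add: indicator_def)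
qed

lemma L2_abs [intro, simp]:
  assumes "u \<in> L2 \<Omega>"
  shows "(\<lambda>x. \<bar>u x\<bar>) \<in> L2 \<Omega>"
  using assms by (auto simp: L2_def)

lemma nrm_abs [simp]: "nrm \<Omega> (\<lambda>x. \<bar>u x\<bar>) = nrm \<Omega> u"
  by (simp add: nrm_def ip_def)

lemma L1_nrm_le_nrm:
  assumes "open \<Omega>" "bounded \<Omega>" "u \<in> L2 \<Omega>"
  shows "(\<integral>x. \<bar>u x\<bar> \<partial>lebesgue_on \<Omega>) \<le> nrm \<Omega> u * nrm \<Omega> (\<lambda>x. 1)"
proof -
  have "(\<lambda>x. 1) \<in> L2 \<Omega>"
    by (rule L2_bounded_measurable[OF assms(1,2)]) auto
  from ip_Cauchy_Schwarz[OF L2_abs[OF assms(3)] this] show ?thesis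
    by (simp add: ip_def)
qed

lemma abs_ip_indicator_le:
  assumes "open \<Omega>" "bounded \<Omega>" "u \<in> L2 \<Omega>"
  shows "\<bar>ip \<Omega> u (indicator (cball z e))\<bar> \<le> (\<integral>x. \<bar>u x\<bar> \<partial>lebesgue_on \<Omega>)"
proof -
  have "\<bar>ip \<Omega> u (indicator (cball z e))\<bar>
      \<le> (\<integral>x. \<bar>u x * indicator (cball z e) x\<bar> \<partial>lebesgue_on \<Omega>)"
    unfolding ip_def by (rule integral_abs_bound)
  also have "\<dots> \<le> (\<integral>x. \<bar>u x\<bar> \<partial>lebesgue_on \<Omega>)"
    using L2_imp_integrable[OF assms] L2_mult_integrable[OF assms(3) indicator_cball_L2[OF assms(1,2)]]
    by (intro integral_mono) (auto simp: indicator_def)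
  finally show ?thesis .
qed

text \<open>Here the centre of the ball varies. Writing its indicator as
  \<open>indicator (cball 0 e) (x - z)\<close> makes the integrand jointly measurable in
  \<open>z\<close> and \<open>x\<close>.\<close>

lemma ball_average_measurable:
  assumes dom: "open \<Omega>" "bounded \<Omega>" and u: "u \<in> L2 \<Omega>"
  shows "(\<lambda>z. ip \<Omega> u (indicator (cball z e))) \<in> borel_measurable lborel"
proof -
  interpret finite_measure "lebesgue_on \<Omega>"
    using dom by (rule finite_measure_lebesgue_on)
  have [measurable]: "u \<in> borel_measurable (lebesgue_on \<Omega>)"
    using u by (simp add: L2_def)
  have [measurable]: "(indicator (cball 0 e) :: plane \<Rightarrow> real) \<in> borel_measurable borel"
    by (intro borel_measurable_indicator) auto
  have [measurable]: "(\<lambda>x. x) \<in> lebesgue_on \<Omega> \<rightarrow>\<^sub>M borel"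
    by (intro measurable_restrict_space1) (simp add: id_borel_measurable_lebesgue[unfolded id_def])
  have [measurable]: "snd \<in> lborel \<Otimes>\<^sub>M lebesgue_on \<Omega> \<rightarrow>\<^sub>M (borel :: plane measure)"
    by (rule measurable_compose[OF measurable_snd]) measurable
  have "(\<lambda>(z, x). u x * indicator (cball 0 e) (x - z)) \<in> borel_measurable (lborel \<Otimes>\<^sub>M lebesgue_on \<Omega>)"
    unfolding split_def by measurable
  then have "(\<lambda>z. \<integral>x. u x * indicator (cball 0 e) (x - z) \<partial>lebesgue_on \<Omega>) \<in> borel_measurable lborel"
    by (rule borel_measurable_lebesgue_integral)
  moreover have "indicator (cball 0 e) (x - z) = (indicator (cball z e) x :: real)" for x z :: plane
    by (auto simp: indicator_def dist_norm norm_minus_commute)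
  ultimately show ?thesis
    unfolding ip_def by simp
qed

lemma ball_average_integrable:
  assumes dom: "open \<Omega>" "bounded \<Omega>" and u: "u \<in> L2 \<Omega>"
  shows "integrable lborel (\<lambda>z. indicator (cball a r) z * \<bar>ip \<Omega> u (indicator (cball z e))\<bar>)"
proof (rule Bochner_Integration.integrable_bound)
  show "integrable lborel (\<lambda>z. indicator (cball a r) z * (\<integral>x. \<bar>u x\<bar> \<partial>lebesgue_on \<Omega>))"
    by (intro integrable_mult_left integrable_real_indicator emeasure_bounded_finite) auto
  have [measurable]: "(indicator (cball a r) :: plane \<Rightarrow> real) \<in> borel_measurable lborel"
    by (intro borel_measurable_indicator) auto
  note [measurable] = ball_average_measurable[OF assms]
  show "(\<lambda>z. indicator (cball a r) z * \<bar>ip \<Omega> u (indicator (cball z e))\<bar>) \<in> borel_measurable lborel"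
    by measurable
qed (use abs_ip_indicator_le[OF assms] in \<open>auto simp: indicator_def\<close>)

text \<open>The pairing of \<open>u\<close> with \<open>\<psi>\<close> is averaged over shifts
  \<open>y\<close> of length at most \<open>e\<close>. Replacing \<open>\<psi>\<close> by its shift
  costs at most \<open>e * T\<close> for each \<open>y\<close>, by \<open>translation_le_TV\<close>;
  the shifted pairings become, after an exchange of integrals, \<open>\<psi>\<close> against the
  integrals of \<open>u\<close> over balls. These are left unnormalised, hence the factor in
  front.\<close>

lemma ball_averages_bound:
  assumes dom: "open \<Omega>" "bounded \<Omega>" and u: "u \<in> L2 \<Omega>" "TV \<Omega> u \<le> ereal T"
    and e: "0 < e" "cball a (r + e) \<subseteq> \<Omega>"
    and grad: "has_cont_gradient \<psi> G" and bound: "\<And>x. \<bar>\<psi> x\<bar> \<le> 1"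
    and supp: "\<And>x. x \<notin> cball a r \<Longrightarrow> \<psi> x = 0"
  shows "measure lborel (cball (0::plane) e) * ip \<Omega> u \<psi>
    \<le> (\<integral>z. indicator (cball a r) z * \<bar>ip \<Omega> u (indicator (cball z e))\<bar> \<partial>lborel)
      + measure lborel (cball (0::plane) e) * (e * T)"
proof -
  interpret fin: finite_measure "lebesgue_on \<Omega>"
    using dom by (rule finite_measure_lebesgue_on)
  interpret pair_sigma_finite "lebesgue_on \<Omega>" "lborel :: plane measure"
    by unfold_locales
  define m where "m = measure lborel (cball (0::plane) e)"
  define I where "I y = (indicator (cball (0::plane) e) y :: real)" for y
  have cont: "continuous_on UNIV \<psi>"
    using has_cont_gradient_imp_continuous[OF grad] .
  then have [measurable]: "\<psi> \<in> borel_measurable borel"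
    by (rule borel_measurable_continuous_onI)
  have [measurable]: "I \<in> borel_measurable borel"
    unfolding I_def by (intro borel_measurable_indicator) auto
  have [measurable]: "u \<in> borel_measurable (lebesgue_on \<Omega>)"
    using u by (simp add: L2_def)
  have [measurable]: "(\<lambda>x. x) \<in> lebesgue_on \<Omega> \<rightarrow>\<^sub>M borel"
    by (intro measurable_restrict_space1) (simp add: id_borel_measurable_lebesgue[unfolded id_def])
  have u_int: "integrable (lebesgue_on \<Omega>) u"
    using L2_imp_integrable[OF dom u(1)] .
  have ball_int: "integrable lborel (indicator (cball z s) :: plane \<Rightarrow> real)" for z s
    by (intro integrable_real_indicator emeasure_bounded_finite) auto
  have I_int: "integrable lborel I"
    unfolding I_def by (rule ball_int)
  have I_mult: "I (x - z) = indicator (cball z e) x" for x z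
    by (auto simp: I_def indicator_def dist_norm norm_minus_commute)
  have fst_meas [measurable]: "fst \<in> lebesgue_on \<Omega> \<Otimes>\<^sub>M lborel \<rightarrow>\<^sub>M (borel :: plane measure)"
    by (rule measurable_compose[OF measurable_fst]) measurable
  \<comment> \<open>The same double integral before and after the substitution
    \<open>z = x - y\<close>: in \<open>int1\<close> the indicator \<open>I\<close> bounds the
    region of \<open>y\<close>, in \<open>int2\<close> the support of \<open>\<psi>\<close> bounds
    that of \<open>z\<close>.\<close>
  have int1: "integrable (lebesgue_on \<Omega> \<Otimes>\<^sub>M lborel) (\<lambda>(x, y). u x * \<psi> (x - y) * I y)"
    unfolding split_def
  proof (rule integrable_product_bound[OF _ u_int I_int])
    show "\<bar>u (fst (x, y)) * \<psi> (fst (x, y) - snd (x, y)) * I (snd (x, y))\<bar> \<le> \<bar>u x\<bar> * \<bar>I y\<bar>" for x y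
      using bound[of "x - y"] by (auto simp: abs_mult mult_left_le intro!: mult_right_mono)
  qed measurable
  have int2: "integrable (lebesgue_on \<Omega> \<Otimes>\<^sub>M lborel) (\<lambda>(x, z). u x * \<psi> z * I (x - z))"
    unfolding split_def
  proof (rule integrable_product_bound[OF _ u_int ball_int[of a r]])
    show "\<bar>u (fst (x, y)) * \<psi> (snd (x, y)) * I (fst (x, y) - snd (x, y))\<bar>
        \<le> \<bar>u x\<bar> * \<bar>indicator (cball a r) y\<bar>" for x y
    proof (cases "y \<in> cball a r")
      case True
      then show ?thesis
        using mult_mono[OF bound[of y], of "\<bar>I (x - y)\<bar>" 1]
        by (auto simp: abs_mult mult.assoc I_def intro!: mult_left_le)
    qed (use supp in simp)
  qed measurable
  have "m * ip \<Omega> u \<psi> - (\<integral>y. I y * ip \<Omega> u (\<lambda>x. \<psi> (x - y)) \<partial>lborel)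
      = (\<integral>y. I y * ip \<Omega> u \<psi> - I y * ip \<Omega> u (\<lambda>x. \<psi> (x - y)) \<partial>lborel)"
  proof -
    have "(\<lambda>y. \<integral>x. u x * \<psi> (x - y) * I y \<partial>lebesgue_on \<Omega>)
        = (\<lambda>y. I y * ip \<Omega> u (\<lambda>x. \<psi> (x - y)))"
      unfolding ip_def by (simp add: mult.commute flip: integral_mult_right_zero)
    then have "integrable lborel (\<lambda>y. I y * ip \<Omega> u (\<lambda>x. \<psi> (x - y)))"
      using integrable_snd[OF int1] by simp
    moreover have "(\<integral>y. I y \<partial>lborel) = m"
      unfolding I_def m_def by simp
    ultimately show ?thesis
      using I_int by simp
  qed
  also have "\<dots> \<le> (\<integral>y. I y * (e * T) \<partial>lborel)"
  proof (rule integral_mono_AE')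
    show "AE y in lborel. I y * ip \<Omega> u \<psi> - I y * ip \<Omega> u (\<lambda>x. \<psi> (x - y)) \<le> I y * (e * T)"
    proof (rule AE_I2)
      fix y :: plane
      show "I y * ip \<Omega> u \<psi> - I y * ip \<Omega> u (\<lambda>x. \<psi> (x - y)) \<le> I y * (e * T)"
      proof (cases "y \<in> cball 0 e")
        case True
        have \<psi>L2: "(\<lambda>x. \<psi> (x - z)) \<in> L2 \<Omega>" for z
          using bound by (intro L2_bounded_measurable[OF dom, where B = 1]) auto
        have "0 \<le> T"
          using TV_nonneg[OF dom u(1)] u(2) by (metis ereal_less_eq(5) order_trans)
        have "cball a (r + norm y) \<subseteq> \<Omega>"
          using True e(2) by (intro order_trans[OF _ e(2)] subset_cball) auto
        then have "ip \<Omega> u (\<lambda>x. \<psi> x - \<psi> (x - y)) \<le> norm y * T"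
          using translation_le_TV[OF dom u grad bound supp] by blast
        also have "\<dots> \<le> e * T"
          using True \<open>0 \<le> T\<close> by (intro mult_right_mono) auto
        finally show ?thesis
          using True \<psi>L2[of 0] \<psi>L2[of y] u by (simp add: I_def ip_diff_right)
      qed (simp add: I_def)
    qed
    show "AE y in lborel. 0 \<le> I y * (e * T)"
      using TV_nonneg[OF dom u(1)] u(2) e(1)
      by (auto simp: I_def indicator_def intro!: mult_nonneg_nonneg) (metis ereal_less_eq(5) order_trans)
  qed (use I_int in auto)
  also have "\<dots> = m * (e * T)"
    unfolding I_def m_def by simp
  finally have main: "m * ip \<Omega> u \<psi> \<le> (\<integral>y. I y * ip \<Omega> u (\<lambda>x. \<psi> (x - y)) \<partial>lborel) + m * (e * T)"
    by simp
  have "(\<integral>y. I y * ip \<Omega> u (\<lambda>x. \<psi> (x - y)) \<partial>lborel)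
      = (\<integral>y. (\<integral>x. u x * \<psi> (x - y) * I y \<partial>lebesgue_on \<Omega>) \<partial>lborel)"
    unfolding ip_def by (simp add: mult.commute flip: integral_mult_right_zero)
  also have "\<dots> = (\<integral>x. (\<integral>y. u x * \<psi> (x - y) * I y \<partial>lborel) \<partial>lebesgue_on \<Omega>)"
    by (rule Fubini_integral[OF int1])
  also have "\<dots> = (\<integral>x. (\<integral>z. u x * \<psi> z * I (x - z) \<partial>lborel) \<partial>lebesgue_on \<Omega>)"
  proof (rule Bochner_Integration.integral_cong[OF refl])
    fix x
    have "(\<lambda>z. u x * \<psi> z * I (x - z)) \<in> borel_measurable borel"
      by measurable
    from lborel_integral_reflect[OF this, of x]
    show "(\<integral>y. u x * \<psi> (x - y) * I y \<partial>lborel) = (\<integral>z. u x * \<psi> z * I (x - z) \<partial>lborel)"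
      by simp
  qed
  also have "\<dots> = (\<integral>z. (\<integral>x. u x * \<psi> z * I (x - z) \<partial>lebesgue_on \<Omega>) \<partial>lborel)"
    by (rule Fubini_integral[OF int2, symmetric])
  also have "\<dots> = (\<integral>z. \<psi> z * ip \<Omega> u (indicator (cball z e)) \<partial>lborel)"
    unfolding ip_def I_mult by (simp add: mult_ac flip: integral_mult_right_zero)
  also have "\<dots> \<le> (\<integral>z. indicator (cball a r) z * \<bar>ip \<Omega> u (indicator (cball z e))\<bar> \<partial>lborel)"
  proof (rule integral_mono_AE')
    show "integrable lborel (\<lambda>z. indicator (cball a r) z * \<bar>ip \<Omega> u (indicator (cball z e))\<bar>)"
      by (rule ball_average_integrable[OF dom u(1)])
    show "AE z in lborel. \<psi> z * ip \<Omega> u (indicator (cball z e))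
        \<le> indicator (cball a r) z * \<bar>ip \<Omega> u (indicator (cball z e))\<bar>"
    proof (rule AE_I2)
      fix z
      have "\<psi> z * i \<le> indicator (cball a r) z * \<bar>i\<bar>" for i
      proof (cases "z \<in> cball a r")
        case True
        have "\<psi> z * i \<le> \<bar>\<psi> z\<bar> * \<bar>i\<bar>"
          by (simp flip: abs_mult)
        also have "\<dots> \<le> 1 * \<bar>i\<bar>"
          using bound by (intro mult_right_mono) auto
        finally show ?thesis
          using True by simp
      qed (simp add: supp)
      then show "\<psi> z * ip \<Omega> u (indicator (cball z e))
        \<le> indicator (cball a r) z * \<bar>ip \<Omega> u (indicator (cball z e))\<bar>" .
    qed
  qed auto
  finally show ?thesis
    using main by (simp add: m_def)
qed

section \<open>Strong convergence in the mean from bounded variation\<close>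

text \<open>The radius \<open>e\<close> is fixed so that the error \<open>e * T\<close> is small for
  all \<open>k\<close> at once. For this \<open>e\<close> the integrals over balls tend to 0 by weak
  convergence and are bounded uniformly in the centre \<open>z\<close>, so dominated convergence
  applies in \<open>z\<close>.\<close>

lemma weak_null_TV_bounded_imp_local_L1_null:
  assumes dom: "open \<Omega>" "bounded \<Omega>" and f: "\<And>k. f k \<in> L2 \<Omega>"
    and weak: "\<And>h. h \<in> L2 \<Omega> \<Longrightarrow> (\<lambda>k. ip \<Omega> (f k) h) \<longlonglongrightarrow> 0"
    and C: "\<And>k. nrm \<Omega> (f k) \<le> C" and T: "\<And>k. TV \<Omega> (f k) \<le> ereal T"
    and r: "0 < r" "cball a (2 * r) \<subseteq> \<Omega>"
  shows "(\<lambda>k. \<integral>x. cutoff a r x * \<bar>f k x\<bar> \<partial>lebesgue_on \<Omega>) \<longlonglongrightarrow> 0"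
proof (rule LIMSEQ_I)
  fix \<eta> :: real assume "0 < \<eta>"
  have T0: "0 \<le> T"
    using order_trans[OF TV_nonneg[OF dom f] T] by simp
  \<comment> \<open>The bound \<open>r\<close> keeps the enlarged ball inside
    \<open>cball a (2 * r)\<close>; \<open>T + 1\<close> avoids a division by 0 when
    \<open>T\<close> vanishes.\<close>
  define e where "e = min r (\<eta> / (2 * (T + 1)))"
  have e: "0 < e" "e \<le> r" "e * T < \<eta>"
  proof -
    show "0 < e" "e \<le> r"
      using r T0 \<open>0 < \<eta>\<close> by (auto simp: e_def)
    have "e * T \<le> \<eta> / (2 * (T + 1)) * T"
      using T0 by (intro mult_right_mono) (auto simp: e_def)
    also have "\<dots> < \<eta>"
      using T0 \<open>0 < \<eta>\<close> by (simp add: field_simps add_nonneg_pos)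
    finally show "e * T < \<eta>" .
  qed
  have sub: "cball a (r + e) \<subseteq> \<Omega>" "cball a r \<subseteq> \<Omega>"
    using e r by (auto intro!: order_trans[OF _ r(2)] subset_cball)
  define m where "m = measure lborel (cball (0::plane) e)"
  have m: "0 < m"
    unfolding m_def using e by (intro content_cball_pos)
  define A where "A k = (\<integral>z. indicator (cball a r) z * \<bar>ip \<Omega> (f k) (indicator (cball z e))\<bar> \<partial>lborel)" for k
  have bound: "(\<integral>x. cutoff a r x * \<bar>f k x\<bar> \<partial>lebesgue_on \<Omega>) \<le> A k / m + e * T" for k
  proof (rule integral_cutoff_abs_le[OF dom L2_imp_integrable[OF dom f] r(1) sub(2)])
    fix \<psi> G
    assume \<psi>: "has_cont_gradient \<psi> G" "\<And>x. \<bar>\<psi> x\<bar> \<le> 1" "\<And>x. x \<notin> cball a r \<Longrightarrow> \<psi> x = 0"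
    have "m * ip \<Omega> (f k) \<psi> \<le> A k + m * (e * T)"
      unfolding m_def A_def using ball_averages_bound[OF dom f T e(1) sub(1) \<psi>] by simp
    then show "(\<integral>x. f k x * \<psi> x \<partial>lebesgue_on \<Omega>) \<le> A k / m + e * T"
      using m by (simp add: ip_def field_simps)
  qed
  have "A \<longlonglongrightarrow> (\<integral>z. indicator (cball a r) z * (0::real) \<partial>lborel)"
    unfolding A_def
  proof (rule integral_dominated_convergence[where
        w = "\<lambda>z. indicator (cball a r) z * (C * nrm \<Omega> (\<lambda>x. 1))"])
    show "integrable lborel (\<lambda>z. indicator (cball a r) z * (C * nrm \<Omega> (\<lambda>x. 1)))"
      by (intro integrable_mult_left integrable_real_indicator emeasure_bounded_finite) auto
    show "AE z in lborel. (\<lambda>k. indicator (cball a r) z * \<bar>ip \<Omega> (f k) (indicator (cball z e))\<bar>)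
        \<longlonglongrightarrow> indicator (cball a r) z * 0"
      using weak[OF indicator_cball_L2[OF dom]] by (intro AE_I2 tendsto_mult_left tendsto_rabs_zero)
    show "AE z in lborel. norm (indicator (cball a r) z * \<bar>ip \<Omega> (f k) (indicator (cball z e))\<bar>)
        \<le> indicator (cball a r) z * (C * nrm \<Omega> (\<lambda>x. 1))" for k
    proof (rule AE_I2)
      fix z
      have "\<bar>ip \<Omega> (f k) (indicator (cball z e))\<bar> \<le> nrm \<Omega> (f k) * nrm \<Omega> (\<lambda>x. 1)"
        using abs_ip_indicator_le[OF dom f] L1_nrm_le_nrm[OF dom f] by (rule order_trans)
      also have "\<dots> \<le> C * nrm \<Omega> (\<lambda>x. 1)"
        using C by (intro mult_right_mono) auto
      finally show "norm (indicator (cball a r) z * \<bar>ip \<Omega> (f k) (indicator (cball z e))\<bar>)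
        \<le> indicator (cball a r) z * (C * nrm \<Omega> (\<lambda>x. 1))"
        by (auto simp: indicator_def)
    qed
    show "(\<lambda>z. indicator (cball a r) z * \<bar>ip \<Omega> (f k) (indicator (cball z e))\<bar>)
        \<in> borel_measurable lborel" for k
      using ball_average_integrable[OF dom f] by (rule borel_measurable_integrable)
  qed simp
  then have "(\<lambda>k. A k / m + e * T) \<longlonglongrightarrow> 0 / m + e * T"
    using m by (intro tendsto_intros) auto
  then have "\<forall>\<^sub>F k in sequentially. A k / m + e * T < \<eta>"
    using e(3) by (intro order_tendstoD(2)) auto
  then obtain k0 where "\<And>k. k \<ge> k0 \<Longrightarrow> A k / m + e * T < \<eta>"
    by (auto simp: eventually_sequentially)
  moreover have "0 \<le> (\<integral>x. cutoff a r x * \<bar>f k x\<bar> \<partial>lebesgue_on \<Omega>)" for k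
    by (intro Bochner_Integration.integral_nonneg mult_nonneg_nonneg cutoff_nonneg abs_ge_zero)
  ultimately show "\<exists>k0. \<forall>k\<ge>k0. norm ((\<integral>x. cutoff a r x * \<bar>f k x\<bar> \<partial>lebesgue_on \<Omega>) - 0) < \<eta>"
    using bound by (auto simp: intro!: exI[of _ k0] intro: le_less_trans)
qed

lemma nrm_indicator:
  assumes "\<Omega> \<in> sets lebesgue" "S \<in> sets lebesgue" "S \<subseteq> \<Omega>"
  shows "nrm \<Omega> (indicator S) = sqrt (measure lebesgue S)"
proof -
  have "S \<in> sets (lebesgue_on \<Omega>)"
    using assms by (auto simp: sets_restrict_space)
  then have "(\<integral>x. indicator S x \<partial>lebesgue_on \<Omega>) = measure (lebesgue_on \<Omega>) S"
    by (simp add: space_restrict_space assms Int_absorb2)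
  moreover have "measure (lebesgue_on \<Omega>) S = measure lebesgue S"
    using assms by (simp add: measure_restrict_space)
  ultimately show ?thesis
    by (simp add: nrm_def ip_def flip: indicator_inter_arith)
qed

text \<open>A closed \<open>S\<close> exhausts \<Omega> up to measure \<open>\<epsilon>\<close>. By
  the Cauchy-Schwarz inequality the mass on the rest is at most \<open>C * sqrt \<epsilon>\<close>
  for every \<open>k\<close>, and \<open>S\<close>, being compact, is covered by finitely many balls
  to which the local lemma applies.\<close>

lemma weak_null_TV_bounded_imp_L1_null:
  assumes dom: "open \<Omega>" "bounded \<Omega>" and f: "\<And>k. f k \<in> L2 \<Omega>"
    and weak: "\<And>h. h \<in> L2 \<Omega> \<Longrightarrow> (\<lambda>k. ip \<Omega> (f k) h) \<longlonglongrightarrow> 0"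
    and C: "\<And>k. nrm \<Omega> (f k) \<le> C" and T: "\<And>k. TV \<Omega> (f k) \<le> ereal T"
  shows "(\<lambda>k. \<integral>x. \<bar>f k x\<bar> \<partial>lebesgue_on \<Omega>) \<longlonglongrightarrow> 0"
proof (rule LIMSEQ_I)
  fix \<eta> :: real assume "0 < \<eta>"
  have \<Omega>: "\<Omega> \<in> sets lebesgue"
    using dom by auto
  have C0: "0 \<le> C"
    using order_trans[OF nrm_ge_zero C] .
  \<comment> \<open>Chosen such that \<open>C * sqrt \<epsilon> < \<eta>\<close>, also for
    \<open>C = 0\<close>.\<close>
  define \<epsilon> where "\<epsilon> = (\<eta> / (2 * (C + 1)))\<^sup>2"
  have "0 < \<epsilon>"
    using \<open>0 < \<eta>\<close> C0 by (simp add: \<epsilon>_def)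
  then obtain S where S: "closed S" "S \<subseteq> \<Omega>" "\<Omega> - S \<in> lmeasurable" "emeasure lebesgue (\<Omega> - S) < ennreal \<epsilon>"
    using sets_lebesgue_inner_closed[OF \<Omega>] by blast
  have "measure lebesgue (\<Omega> - S) < \<epsilon>"
    using S(3,4) \<open>0 < \<epsilon>\<close> by (simp add: emeasure_eq_measure2 ennreal_less_iff)
  then have "sqrt (measure lebesgue (\<Omega> - S)) < \<eta> / (2 * (C + 1))"
    using C0 \<open>0 < \<eta>\<close> by (intro real_less_lsqrt) (auto simp: \<epsilon>_def)
  then have "C * sqrt (measure lebesgue (\<Omega> - S)) \<le> C * (\<eta> / (2 * (C + 1)))"
    using C0 by (intro mult_left_mono) auto
  also have "\<dots> < \<eta>"
    using C0 \<open>0 < \<eta>\<close> by (simp add: field_simps add_nonneg_pos)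
  finally have small: "C * sqrt (measure lebesgue (\<Omega> - S)) < \<eta>" .
  have "\<exists>r>0. cball a (2 * r) \<subseteq> \<Omega>" if a: "a \<in> \<Omega>" for a
  proof -
    obtain R where "0 < R" "cball a R \<subseteq> \<Omega>"
      using dom(1) a open_contains_cball by blast
    then show ?thesis
      by (intro exI[of _ "R / 2"]) auto
  qed
  then obtain r where r: "\<And>a. a \<in> \<Omega> \<Longrightarrow> 0 < r a" "\<And>a. a \<in> \<Omega> \<Longrightarrow> cball a (2 * r a) \<subseteq> \<Omega>"
    by metis
  have "compact S"
    using S dom by (auto simp: compact_eq_bounded_closed intro: bounded_subset)
  moreover have "S \<subseteq> (\<Union>a\<in>S. ball a (r a / 2))"
    using r(1) S(2) by force
  ultimately obtain F where F: "F \<subseteq> S" "finite F" "S \<subseteq> (\<Union>a\<in>F. ball a (r a / 2))"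
    by (elim compactE_image) auto
  have F\<Omega>: "a \<in> \<Omega>" if "a \<in> F" for a
    using that F(1) S(2) by blast
  have ind: "indicator (\<Omega> - S) \<in> L2 \<Omega>"
    using S(3) by (intro L2_bounded_measurable[OF dom, of _ 1])
      (auto simp: indicator_def intro!: borel_measurable_indicator measurable_restrict_space1)
  have cut_L2: "cutoff a s \<in> L2 \<Omega>" for a s
  proof -
    obtain G where "has_cont_gradient (cutoff a s) G"
      using cutoff_has_cont_gradient by blast
    then have "cutoff a s \<in> borel_measurable (lebesgue_on \<Omega>)"
      using has_cont_gradient_imp_continuous \<Omega>
      by (blast intro: continuous_imp_measurable_on_sets_lebesgue)
    then show ?thesis
      by (rule L2_bounded_measurable[OF dom, of _ 1])
        (simp add: cutoff_nonneg cutoff_le_one)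
  qed
  \<comment> \<open>Every point of \<open>S\<close> lies in a ball of half the radius, where the
    matching \<open>cutoff\<close> is at least 1/2: hence the factor 2.\<close>
  have bound: "(\<integral>x. \<bar>f k x\<bar> \<partial>lebesgue_on \<Omega>)
      \<le> (\<Sum>a\<in>F. 2 * (\<integral>x. cutoff a (r a) x * \<bar>f k x\<bar> \<partial>lebesgue_on \<Omega>))
        + C * sqrt (measure lebesgue (\<Omega> - S))" for k
  proof -
    have int: "integrable (lebesgue_on \<Omega>) (\<lambda>x. cutoff a (r a) x * \<bar>f k x\<bar>)"
      "integrable (lebesgue_on \<Omega>) (\<lambda>x. indicator (\<Omega> - S) x * \<bar>f k x\<bar>)" for a
      using f ind cut_L2 by (auto intro: L2_mult_integrable)
    have "(\<integral>x. \<bar>f k x\<bar> \<partial>lebesgue_on \<Omega>)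
        \<le> (\<integral>x. (\<Sum>a\<in>F. 2 * (cutoff a (r a) x * \<bar>f k x\<bar>)) + indicator (\<Omega> - S) x * \<bar>f k x\<bar> \<partial>lebesgue_on \<Omega>)"
    proof (rule integral_mono)
      fix x assume "x \<in> space (lebesgue_on \<Omega>)"
      then have "x \<in> \<Omega>"
        by (simp add: space_restrict_space)
      have nn: "0 \<le> 2 * (cutoff b (r b) x * \<bar>f k x\<bar>)" for b
        by (intro mult_nonneg_nonneg cutoff_nonneg abs_ge_zero) simp
      show "\<bar>f k x\<bar> \<le> (\<Sum>a\<in>F. 2 * (cutoff a (r a) x * \<bar>f k x\<bar>)) + indicator (\<Omega> - S) x * \<bar>f k x\<bar>"
      proof (cases "x \<in> S")
        case True
        then obtain a where a: "a \<in> F" "x \<in> ball a (r a / 2)"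
          using F(3) by blast
        then have "1 / 2 * \<bar>f k x\<bar> \<le> cutoff a (r a) x * \<bar>f k x\<bar>"
          by (intro mult_right_mono cutoff_ge_half r F\<Omega>) auto
        then have "\<bar>f k x\<bar> \<le> 2 * (cutoff a (r a) x * \<bar>f k x\<bar>)"
          by simp
        also have "\<dots> \<le> (\<Sum>a\<in>F. 2 * (cutoff a (r a) x * \<bar>f k x\<bar>))"
          using a F(2) nn by (intro member_le_sum) auto
        finally show ?thesis
          by (simp add: add_increasing2)
      next
        case False
        then show ?thesis
          using \<open>x \<in> \<Omega>\<close> nn by (simp add: sum_nonneg)
      qed
    qed (use f int L2_imp_integrable[OF dom] in auto)
    also have "\<dots> = (\<Sum>a\<in>F. 2 * (\<integral>x. cutoff a (r a) x * \<bar>f k x\<bar> \<partial>lebesgue_on \<Omega>))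
        + ip \<Omega> (indicator (\<Omega> - S)) (\<lambda>x. \<bar>f k x\<bar>)"
      using int by (simp add: ip_def)
    also have "ip \<Omega> (indicator (\<Omega> - S)) (\<lambda>x. \<bar>f k x\<bar>) \<le> sqrt (measure lebesgue (\<Omega> - S)) * nrm \<Omega> (f k)"
      using ip_Cauchy_Schwarz[OF ind L2_abs[OF f], of k] nrm_indicator[OF \<Omega>, of "\<Omega> - S"] S(3)
      by (simp add: fmeasurableD abs_le_iff)
    also have "\<dots> \<le> C * sqrt (measure lebesgue (\<Omega> - S))"
      using C by (simp add: mult.commute mult_right_mono)
    finally show ?thesis by simp
  qed
  have "(\<lambda>k. (\<Sum>a\<in>F. 2 * (\<integral>x. cutoff a (r a) x * \<bar>f k x\<bar> \<partial>lebesgue_on \<Omega>))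
        + C * sqrt (measure lebesgue (\<Omega> - S)))
      \<longlonglongrightarrow> (\<Sum>a\<in>F. 2 * 0) + C * sqrt (measure lebesgue (\<Omega> - S))"
    by (intro tendsto_intros weak_null_TV_bounded_imp_local_L1_null[OF dom f weak C T] r F\<Omega>)
  then have "\<forall>\<^sub>F k in sequentially. (\<Sum>a\<in>F. 2 * (\<integral>x. cutoff a (r a) x * \<bar>f k x\<bar> \<partial>lebesgue_on \<Omega>))
        + C * sqrt (measure lebesgue (\<Omega> - S)) < \<eta>"
    using small by (intro order_tendstoD(2)) auto
  then have "\<forall>\<^sub>F k in sequentially. norm ((\<integral>x. \<bar>f k x\<bar> \<partial>lebesgue_on \<Omega>) - 0) < \<eta>"
    by (rule eventually_mono) (use bound in \<open>auto intro: le_less_trans\<close>)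
  then show "\<exists>k0. \<forall>k\<ge>k0. norm ((\<integral>x. \<bar>f k x\<bar> \<partial>lebesgue_on \<Omega>) - 0) < \<eta>"
    by (simp add: eventually_sequentially)
qed

section \<open>The uniform boundedness principle\<close>

text \<open>Riesz-Fischer argument: the partial sums of absolute values have norms at most
  \<open>S\<close>, so monotone convergence yields a square-integrable majorant \<open>H\<close>,
  and dominated convergence follows. The limit is recorded through its pairings, the form that the
  gliding hump uses.\<close>

lemma L2_series_complete:
  assumes dom: "open \<Omega>" "bounded \<Omega>" and f: "\<And>i. f i \<in> L2 \<Omega>"
    and summ: "summable (\<lambda>i. nrm \<Omega> (f i))"
  obtains h where "h \<in> L2 \<Omega>" "\<And>x. x \<in> L2 \<Omega> \<Longrightarrow> (\<lambda>i. ip \<Omega> x (f i)) sums ip \<Omega> x h"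
proof -
  define S where "S = (\<Sum>i. nrm \<Omega> (f i))"
  define F where "F n x = (\<Sum>i<n. \<bar>f i x\<bar>)" for n x
  define H where "H x = (\<Sum>i. \<bar>f i x\<bar>)" for x
  define h where "h x = (\<Sum>i. f i x)" for x
  have meas [measurable]: "f i \<in> borel_measurable (lebesgue_on \<Omega>)" for i
    using f by (simp add: L2_def)
  have F_L2: "F n \<in> L2 \<Omega>" and F_nrm: "nrm \<Omega> (F n) \<le> S" for n
  proof -
    have "F n \<in> L2 \<Omega> \<and> nrm \<Omega> (F n) \<le> (\<Sum>i<n. nrm \<Omega> (f i))"
    proof (induction n)
      case 0
      show ?case by (simp add: F_def[abs_def] nrm_def ip_def)
    next
      case (Suc n)
      have "F (Suc n) = (\<lambda>x. F n x + \<bar>f n x\<bar>)"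
        by (simp add: F_def fun_eq_iff)
      then show ?case
        using Suc nrm_triangle[of "F n" \<Omega> "\<lambda>x. \<bar>f n x\<bar>"] f by auto
    qed
    then show "F n \<in> L2 \<Omega>" "nrm \<Omega> (F n) \<le> S"
      using sum_le_suminf[OF summ, of "{..<n}"] by (auto simp: S_def)
  qed
  have ae_summable: "AE x in lebesgue_on \<Omega>. summable (\<lambda>i. \<bar>f i x\<bar>)"
  proof -
    have "(\<integral>\<^sup>+x. (\<Sum>i. ennreal \<bar>f i x\<bar>) \<partial>lebesgue_on \<Omega>) = (\<Sum>i. \<integral>\<^sup>+x. ennreal \<bar>f i x\<bar> \<partial>lebesgue_on \<Omega>)"
      by (intro nn_integral_suminf) simp
    also have "\<dots> = (\<Sum>i. ennreal (\<integral>x. \<bar>f i x\<bar> \<partial>lebesgue_on \<Omega>))"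
      using L2_imp_integrable[OF dom f] by (simp add: nn_integral_eq_integral)
    also have "\<dots> \<noteq> \<infinity>"
    proof -
      have "summable (\<lambda>i. \<integral>x. \<bar>f i x\<bar> \<partial>lebesgue_on \<Omega>)"
      proof (rule summable_comparison_test')
        show "summable (\<lambda>i. nrm \<Omega> (f i) * nrm \<Omega> (\<lambda>x. 1))"
          by (intro summable_mult2 summ)
        show "norm (\<integral>x. \<bar>f i x\<bar> \<partial>lebesgue_on \<Omega>) \<le> nrm \<Omega> (f i) * nrm \<Omega> (\<lambda>x. 1)" for i
          using L1_nrm_le_nrm[OF dom f[of i]] by simp
      qed
      then show ?thesis
        by (simp add: suminf_ennreal2)
    qed
    finally have "AE x in lebesgue_on \<Omega>. (\<Sum>i. ennreal \<bar>f i x\<bar>) \<noteq> \<infinity>"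
      by (intro nn_integral_PInf_AE) auto
    then show ?thesis
      by (rule eventually_mono) (auto intro: summable_suminf_not_top)
  qed
  then have F_lim: "AE x in lebesgue_on \<Omega>. (\<lambda>n. F n x) \<longlonglongrightarrow> H x"
    by (rule eventually_mono) (simp add: F_def H_def summable_LIMSEQ)
  have F_int: "integrable (lebesgue_on \<Omega>) (\<lambda>x. (F n x)\<^sup>2)" for n
    using F_L2 by (simp add: L2_def)
  have F_mono: "(F n x)\<^sup>2 \<le> (F (Suc n) x)\<^sup>2" for n x
    by (intro power_mono) (auto simp: F_def intro!: sum_nonneg)
  have "incseq (\<lambda>n. \<integral>x. (F n x)\<^sup>2 \<partial>lebesgue_on \<Omega>)"
    by (intro incseq_SucI integral_mono F_int F_mono)
  moreover have "(\<integral>x. (F n x)\<^sup>2 \<partial>lebesgue_on \<Omega>) \<le> S\<^sup>2" for n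
  proof -
    have "(\<integral>x. (F n x)\<^sup>2 \<partial>lebesgue_on \<Omega>) = (nrm \<Omega> (F n))\<^sup>2"
      unfolding nrm_squared by (simp add: ip_def power2_eq_square)
    then show ?thesis
      using F_nrm by (simp add: power_mono)
  qed
  ultimately obtain L where L: "(\<lambda>n. \<integral>x. (F n x)\<^sup>2 \<partial>lebesgue_on \<Omega>) \<longlonglongrightarrow> L"
    using incseq_convergent by blast
  have H_meas [measurable]: "H \<in> borel_measurable (lebesgue_on \<Omega>)"
    unfolding H_def by measurable
  have "integrable (lebesgue_on \<Omega>) (\<lambda>x. (H x)\<^sup>2)"
  proof (rule integrable_monotone_convergence[OF _ _ _ L])
    show "AE x in lebesgue_on \<Omega>. mono (\<lambda>n. (F n x)\<^sup>2)"
      by (intro AE_I2 incseq_SucI F_mono)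
    show "AE x in lebesgue_on \<Omega>. (\<lambda>n. (F n x)\<^sup>2) \<longlonglongrightarrow> (H x)\<^sup>2"
      using F_lim by (rule eventually_mono) (intro tendsto_intros)
  qed (use F_L2 in \<open>auto simp: L2_def\<close>)
  then have H_L2: "H \<in> L2 \<Omega>"
    by (simp add: L2_def)
  have h_le: "AE x in lebesgue_on \<Omega>. \<bar>h x\<bar> \<le> H x"
    using ae_summable by (rule eventually_mono) (simp add: h_def H_def summable_rabs)
  have h_meas [measurable]: "h \<in> borel_measurable (lebesgue_on \<Omega>)"
    unfolding h_def by measurable
  have "integrable (lebesgue_on \<Omega>) (\<lambda>x. (h x)\<^sup>2)"
  proof (rule Bochner_Integration.integrable_bound)
    show "integrable (lebesgue_on \<Omega>) (\<lambda>x. (H x)\<^sup>2)"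
      using H_L2 by (simp add: L2_def)
    show "AE x in lebesgue_on \<Omega>. norm ((h x)\<^sup>2) \<le> norm ((H x)\<^sup>2)"
      using h_le by (rule eventually_mono) (use power_mono[of "\<bar>h _\<bar>" "H _" 2] in simp)
  qed simp
  then have h_L2: "h \<in> L2 \<Omega>"
    by (simp add: L2_def)
  moreover have "(\<lambda>i. ip \<Omega> x (f i)) sums ip \<Omega> x h" if x: "x \<in> L2 \<Omega>" for x
  proof -
    have [measurable]: "x \<in> borel_measurable (lebesgue_on \<Omega>)"
      using x by (simp add: L2_def)
    have "(\<lambda>n. \<integral>y. x y * (\<Sum>i<n. f i y) \<partial>lebesgue_on \<Omega>) \<longlonglongrightarrow> (\<integral>y. x y * h y \<partial>lebesgue_on \<Omega>)"
    proof (rule integral_dominated_convergence[where w = "\<lambda>y. \<bar>x y\<bar> * H y"])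
      show "integrable (lebesgue_on \<Omega>) (\<lambda>y. \<bar>x y\<bar> * H y)"
        using x H_L2 by (intro L2_mult_integrable) auto
      show "AE y in lebesgue_on \<Omega>. (\<lambda>n. x y * (\<Sum>i<n. f i y)) \<longlonglongrightarrow> x y * h y"
        using ae_summable
        by (rule eventually_mono)
          (auto simp: h_def intro!: tendsto_mult_left summable_LIMSEQ summable_rabs_cancel)
      show "AE y in lebesgue_on \<Omega>. norm (x y * (\<Sum>i<n. f i y)) \<le> \<bar>x y\<bar> * H y" for n
        using ae_summable
      proof (rule eventually_mono)
        fix y assume s: "summable (\<lambda>i. \<bar>f i y\<bar>)"
        have "\<bar>\<Sum>i<n. f i y\<bar> \<le> (\<Sum>i<n. \<bar>f i y\<bar>)"
          by (rule sum_abs)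
        also have "\<dots> \<le> H y"
          unfolding H_def using s by (intro sum_le_suminf) auto
        finally show "norm (x y * (\<Sum>i<n. f i y)) \<le> \<bar>x y\<bar> * H y"
          by (simp add: abs_mult mult_left_mono)
      qed
    qed measurable
    moreover have "(\<integral>y. x y * (\<Sum>i<n. f i y) \<partial>lebesgue_on \<Omega>) = (\<Sum>i<n. ip \<Omega> x (f i))" for n
      using L2_mult_integrable[OF x f] by (simp add: ip_def sum_distrib_left)
    ultimately show ?thesis
      by (simp add: sums_def ip_def)
  qed
  ultimately show ?thesis
    using that by blast
qed

text \<open>
  A gliding hump argument (after Sokal): the signs of the steps of norm \<open>3\<^sup>-\<^sup>j\<close> are chosen such that step \<open>j\<close> does not cancel the preceding partial sum when tested
  with \<open>x\<^sub>j\<close>.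
\<close>

lemma pointwise_bounded_imp_nrm_bounded:
  assumes dom: "open \<Omega>" "bounded \<Omega>" and w: "\<And>k. w k \<in> L2 \<Omega>"
    and bdd: "\<And>h. h \<in> L2 \<Omega> \<Longrightarrow> \<exists>M. \<forall>k::nat. \<bar>ip \<Omega> (w k) h\<bar> \<le> M"
  shows "\<exists>C. \<forall>k. nrm \<Omega> (w k) \<le> C"
proof (rule ccontr)
  assume "\<not> ?thesis"
  \<comment> \<open>Norms above \<open>4 ^ j\<close> against steps of norm
    \<open>(1 / 3) ^ j\<close>: the humps grow like \<open>(4 / 3) ^ j\<close>.\<close>
  then have "\<exists>k. 4 ^ j < nrm \<Omega> (w k)" for j :: nat
    by (metis not_less)
  then obtain \<kappa> where \<kappa>: "\<And>j::nat. 4 ^ j < nrm \<Omega> (w (\<kappa> j))"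
    by metis
  define x where "x j = w (\<kappa> j)" for j
  have x: "x j \<in> L2 \<Omega>" "4 ^ j < nrm \<Omega> (x j)" "0 < nrm \<Omega> (x j)" for j
    using w \<kappa> less_trans[OF zero_less_power[of "4::real" j] \<kappa>] by (auto simp: x_def)
  define c where "c j = (1 / 3) ^ j / nrm \<Omega> (x j)" for j
  define \<sigma> where "\<sigma> j p = (if 0 \<le> ip \<Omega> (x j) p then c j else - c j)" for j p
  \<comment> \<open>The sign of step \<open>j\<close> depends on the partial sum before it, so the
    partial sums are defined by recursion and the steps \<open>f\<close> are read off.\<close>
  define P where "P = rec_nat (\<lambda>y. 0) (\<lambda>j p y. p y + \<sigma> j p * x j y)"
  have P: "P 0 = (\<lambda>y. 0)" "P (Suc j) = (\<lambda>y. P j y + \<sigma> j (P j) * x j y)" for j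
    by (simp_all add: P_def)
  define f where "f j = (\<lambda>y. \<sigma> j (P j) * x j y)" for j
  have f: "f j \<in> L2 \<Omega>" for j
    using x by (simp add: f_def)
  have nrm_f: "nrm \<Omega> (f j) = (1 / 3) ^ j" for j
    using x[of j] by (simp add: f_def nrm_scale \<sigma>_def c_def)
  have P_L2: "P j \<in> L2 \<Omega>" for j
    by (induction j) (use f in \<open>auto simp: P f_def\<close>)
  have sum_P: "(\<Sum>i<j. ip \<Omega> y (f i)) = ip \<Omega> y (P j)" if "y \<in> L2 \<Omega>" for y j
    using that x(1) P_L2
    by (induction j) (auto simp: P f_def ip_linear ip_def[of \<Omega> y "\<lambda>y. 0"])
  have hump: "(1 / 3) ^ j * nrm \<Omega> (x j) \<le> \<bar>ip \<Omega> (x j) (P (Suc j))\<bar>" for j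
  proof -
    have "ip \<Omega> (x j) (P (Suc j)) = ip \<Omega> (x j) (P j) + \<sigma> j (P j) * (nrm \<Omega> (x j))\<^sup>2"
      using x P_L2 by (simp add: P ip_linear nrm_squared)
    moreover have "c j * (nrm \<Omega> (x j))\<^sup>2 = (1 / 3) ^ j * nrm \<Omega> (x j)"
      using x(3)[of j] by (simp add: c_def power2_eq_square)
    moreover have "0 \<le> (1 / 3) ^ j * nrm \<Omega> (x j)"
      by simp
    ultimately show ?thesis
      by (auto simp: \<sigma>_def)
  qed
  have geo: "summable (\<lambda>j. (1 / 3 :: real) ^ j)"
    by (rule summable_geometric) simp
  then have "summable (\<lambda>j. nrm \<Omega> (f j))"
    by (simp add: nrm_f)
  from L2_series_complete[where f = f, OF dom f this] obtain h where h: "h \<in> L2 \<Omega>"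
    and sums: "\<And>y. y \<in> L2 \<Omega> \<Longrightarrow> (\<lambda>i. ip \<Omega> y (f i)) sums ip \<Omega> y h"
    by blast
  have large: "(4 / 3) ^ j / 2 \<le> \<bar>ip \<Omega> (x j) h\<bar>" for j
  proof -
    have tail: "(\<lambda>i. ip \<Omega> (x j) (f (i + Suc j))) sums (ip \<Omega> (x j) h - ip \<Omega> (x j) (P (Suc j)))"
      using sums_split_initial_segment[OF sums[OF x(1)[of j]], of "Suc j"]
      by (simp only: sum_P[OF x(1)])
    \<comment> \<open>All later steps together can cancel at most half of the hump at
      \<open>j\<close>: the sum of \<open>(1 / 3) ^ i\<close> over \<open>i > j\<close> is
      \<open>(1 / 3) ^ j / 2\<close>.\<close>
    have tail_geo: "(\<lambda>i. nrm \<Omega> (x j) * (1 / 3) ^ (i + Suc j)) sums (nrm \<Omega> (x j) * (1 / 3) ^ j / 2)"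
      using sums_mult[OF geometric_sums[of "1 / 3 :: real"], of "nrm \<Omega> (x j) * (1 / 3) ^ Suc j"]
      by (simp add: power_add mult_ac)
    have "norm (ip \<Omega> (x j) (f i)) \<le> nrm \<Omega> (x j) * (1 / 3) ^ i" for i
      using ip_Cauchy_Schwarz[OF x(1) f, of j i] by (simp add: nrm_f)
    from norm_suminf_le[OF this sums_summable[OF tail_geo]]
    have "\<bar>ip \<Omega> (x j) h - ip \<Omega> (x j) (P (Suc j))\<bar> \<le> nrm \<Omega> (x j) * (1 / 3) ^ j / 2"
      unfolding sums_unique[OF tail] sums_unique[OF tail_geo] by simp
    with hump[of j, unfolded mult.commute[of "(1 / 3) ^ j"]] have "nrm \<Omega> (x j) * (1 / 3) ^ j / 2 \<le> \<bar>ip \<Omega> (x j) h\<bar>"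
      by linarith
    then have "(1 / 3) ^ j * nrm \<Omega> (x j) / 2 \<le> \<bar>ip \<Omega> (x j) h\<bar>"
      by (simp add: mult.commute)
    moreover have "(4 / 3) ^ j \<le> (1 / 3) ^ j * nrm \<Omega> (x j)"
    proof -
      have "(4 / 3 :: real) ^ j = (1 / 3) ^ j * 4 ^ j"
        by (simp flip: power_mult_distrib)
      also have "\<dots> \<le> (1 / 3) ^ j * nrm \<Omega> (x j)"
        using x(2)[of j] by (intro mult_left_mono) auto
      finally show ?thesis .
    qed
    ultimately show ?thesis
      by linarith
  qed
  obtain M where M: "\<And>k. \<bar>ip \<Omega> (w k) h\<bar> \<le> M"
    using bdd[OF h] by blast
  obtain j where "2 * M < (4 / 3 :: real) ^ j"
    using real_arch_pow[of "4 / 3" "2 * M"] by auto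
  then show False
    using large[of j] M[of "\<kappa> j"] unfolding x_def by linarith
qed

text \<open>The compactness assumption supplies weak limits without a norm bound, while
  \<open>weak_null_TV_bounded_imp_L1_null\<close> relies on one near the boundary.\<close>

lemma weakly_converges_imp_nrm_bounded:
  assumes dom: "open \<Omega>" "bounded \<Omega>" and w: "weakly_converges \<Omega> w v"
  shows "\<exists>C. \<forall>k. nrm \<Omega> (w k) \<le> C"
proof (rule pointwise_bounded_imp_nrm_bounded[OF dom])
  show "w k \<in> L2 \<Omega>" for k
    using w by (simp add: weakly_converges_def)
  fix h assume "h \<in> L2 \<Omega>"
  then have "(\<lambda>k. ip \<Omega> (w k) h) \<longlonglongrightarrow> ip \<Omega> v h"
    using w by (simp add: weakly_converges_def)
  then have "Bseq (\<lambda>k. ip \<Omega> (w k) h)"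
    by (intro convergent_imp_Bseq convergentI)
  then show "\<exists>M. \<forall>k. \<bar>ip \<Omega> (w k) h\<bar> \<le> M"
    by (auto simp: Bseq_def)
qed

lemma TV_diff_le:
  assumes dom: "open \<Omega>" "bounded \<Omega>" and u: "u \<in> L2 \<Omega>" "v \<in> L2 \<Omega>"
    and "TV \<Omega> u \<le> ereal a" "TV \<Omega> v \<le> ereal b"
  shows "TV \<Omega> (\<lambda>x. u x - v x) \<le> ereal (a + b)"
proof -
  have "distr_deriv \<Omega> (\<lambda>x. u x - v x) \<phi> \<le> a + b" if \<phi>: "\<phi> \<in> unit_fields \<Omega>" for \<phi>
  proof -
    have test: "\<phi> \<in> test_fields \<Omega>"
      using \<phi> by (simp add: unit_fields_def)
    have "distr_deriv \<Omega> (\<lambda>x. u x - v x) \<phi> = distr_deriv \<Omega> u \<phi> + distr_deriv \<Omega> v (\<lambda>x. - \<phi> x)"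
      using u divergence_L2[OF dom test]
      by (simp add: distr_deriv_eq_ip divergence_uminus[OF test] ip_linear)
    also have "\<dots> \<le> a + b"
      using assms \<phi> uminus_unit_field[OF \<phi>] by (intro add_mono) (auto simp: TV_le_iff)
    finally show ?thesis .
  qed
  then show ?thesis
    using dom u by (simp add: TV_le_iff)
qed

lemma weakly_converges_TV_bounded_imp_L1:
  assumes dom: "open \<Omega>" "bounded \<Omega>" and w: "weakly_converges \<Omega> w v"
    and T: "\<And>k. TV \<Omega> (w k) \<le> ereal T"
  shows "(\<lambda>k. L1_nrm \<Omega> (\<lambda>x. w k x - v x)) \<longlonglongrightarrow> 0"
  unfolding L1_nrm_def
proof -
  obtain C where C: "\<And>k. nrm \<Omega> (w k) \<le> C"
    using weakly_converges_imp_nrm_bounded[OF dom w] by blast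
  show "(\<lambda>k. \<integral>x. \<bar>w k x - v x\<bar> \<partial>lebesgue_on \<Omega>) \<longlonglongrightarrow> 0"
  proof (rule weak_null_TV_bounded_imp_L1_null[OF dom])
    have L2: "v \<in> L2 \<Omega>" "w k \<in> L2 \<Omega>" for k
      using w by (auto simp: weakly_converges_def)
    then show "(\<lambda>x. w k x - v x) \<in> L2 \<Omega>" for k
      by simp
    show "(\<lambda>k. ip \<Omega> (\<lambda>x. w k x - v x) h) \<longlonglongrightarrow> 0" if "h \<in> L2 \<Omega>" for h
    proof -
      have "(\<lambda>k. ip \<Omega> (w k) h) \<longlonglongrightarrow> ip \<Omega> v h"
        using w that by (simp add: weakly_converges_def)
      then show ?thesis
        using L2 that by (simp add: ip_linear LIM_zero)
    qed
    show "nrm \<Omega> (\<lambda>x. w k x - v x) \<le> C + nrm \<Omega> v" for k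
      using nrm_triangle[of "w k" \<Omega> "\<lambda>x. - v x"] nrm_scale[of \<Omega> "- 1" v] L2 C[of k] by simp
    have "TV \<Omega> v \<le> ereal T"
      using TV_weakly_lsc[OF dom w T] by simp
    then show "TV \<Omega> (\<lambda>x. w k x - v x) \<le> ereal (T + T)" for k
      using TV_diff_le[OF dom] L2 T by blast
  qed
qed

section \<open>Iterates of the augmented Lagrangian method\<close>

text \<open>One run of the method for arbitrary data \<open>h\<close>, so that the exact run and the
  noisy runs are instances of the same facts. The competitor in \<open>proper\<close> makes the
  total variation of every minimizer finite.\<close>

locale lagrangian_iteration =
  fixes \<Omega> :: "plane set" and K :: "scalar_field \<Rightarrow> scalar_field" and \<tau> :: "nat \<Rightarrow> real"
    and p0 h :: scalar_field and u p :: "nat \<Rightarrow> scalar_field"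
  assumes open_domain: "open \<Omega>" and bounded_domain: "bounded \<Omega>"
    and bounded_K: "bounded_operator \<Omega> K"
    and \<tau>_pos: "\<And>n. n \<ge> 1 \<Longrightarrow> \<tau> n > 0"
    and p0_L2: "p0 \<in> L2 \<Omega>" and h_L2: "h \<in> L2 \<Omega>"
    and proper: "\<exists>v\<in>L2 \<Omega>. TV \<Omega> v < \<infinity>"
    and iteration: "augmented_lagrangian \<Omega> (TV \<Omega>) K \<tau> p0 h u p"
begin

definition residual :: "nat \<Rightarrow> scalar_field" where
  "residual n = (\<lambda>x. K (u n) x - h x)"

definition J :: "nat \<Rightarrow> real" where
  "J n = real_of_ereal (TV \<Omega> (u n))"

text \<open>
  If \<open>c\<close> is the total variation of a solution of \<open>K v = g\<close>, then this is the Bregman distance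
  of that solution from \<open>u n\<close>.
\<close>

definition bregman_gap :: "real \<Rightarrow> scalar_field \<Rightarrow> nat \<Rightarrow> real" where
  "bregman_gap c g n = c - J n - ip \<Omega> (p n) g + ip \<Omega> (p n) (K (u n))"

lemma K_L2 [simp, intro]: "v \<in> L2 \<Omega> \<Longrightarrow> K v \<in> L2 \<Omega>"
  using bounded_K by (simp add: bounded_operator_def)

lemma p_L2 [simp, intro]: "p n \<in> L2 \<Omega>"
  using iteration by (simp add: augmented_lagrangian_def)

lemma arg_min_u:
  "n \<ge> 1 \<Longrightarrow> is_arg_min
     (\<lambda>v. ereal (\<tau> n / 2 * (nrm \<Omega> (\<lambda>x. K v x - h x))\<^sup>2) + TV \<Omega> v
       - ereal (ip \<Omega> (p (n - 1)) (\<lambda>x. K v x - h x)))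
     (\<lambda>v. v \<in> L2 \<Omega>) (u n)"
  using iteration by (simp add: augmented_lagrangian_def)

lemma u_L2 [simp]: "n \<ge> 1 \<Longrightarrow> u n \<in> L2 \<Omega>"
  using arg_min_u by (simp add: is_arg_min_def)

lemma residual_L2 [simp]: "n \<ge> 1 \<Longrightarrow> residual n \<in> L2 \<Omega>"
  using h_L2 by (simp add: residual_def)

lemma objective_le:
  assumes "n \<ge> 1" "v \<in> L2 \<Omega>"
  shows "ereal (\<tau> n / 2 * (nrm \<Omega> (residual n))\<^sup>2) + TV \<Omega> (u n) - ereal (ip \<Omega> (p (n - 1)) (residual n))
    \<le> ereal (\<tau> n / 2 * (nrm \<Omega> (\<lambda>x. K v x - h x))\<^sup>2) + TV \<Omega> v
       - ereal (ip \<Omega> (p (n - 1)) (\<lambda>x. K v x - h x))"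
  using arg_min_u[OF assms(1)] assms(2) by (auto simp: is_arg_min_def residual_def not_less)

lemma TV_u: "n \<ge> 1 \<Longrightarrow> TV \<Omega> (u n) = ereal (J n)"
proof -
  assume n: "n \<ge> 1"
  obtain v c where v: "v \<in> L2 \<Omega>" "TV \<Omega> v = ereal c"
    using proper TV_finite_real[OF open_domain bounded_domain] by metis
  show ?thesis
    using objective_le[OF n v(1)] TV_nonneg[OF open_domain bounded_domain u_L2[OF n]] v(2)
    by (cases "TV \<Omega> (u n)") (auto simp: J_def)
qed

text \<open>The update of \<open>p\<close> holds almost everywhere; paired with a fixed
  \<open>z\<close> it becomes an identity of reals, which is how it is used below.\<close>

lemma ip_p_Suc:
  assumes "z \<in> L2 \<Omega>"
  shows "ip \<Omega> (p (Suc n)) z = ip \<Omega> (p n) z - \<tau> (Suc n) * ip \<Omega> (residual (Suc n)) z"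
proof -
  have "ae_eq \<Omega> (p (Suc n)) (\<lambda>x. p n x + \<tau> (Suc n) * (h x - K (u (Suc n)) x))"
    using iteration by (fastforce simp: augmented_lagrangian_def)
  then have "ip \<Omega> (p (Suc n)) z = ip \<Omega> (\<lambda>x. p n x + \<tau> (Suc n) * (h x - K (u (Suc n)) x)) z"
    using assms h_L2 by (intro ip_ae_cong_left) auto
  also have "\<dots> = ip \<Omega> (p n) z + \<tau> (Suc n) * (ip \<Omega> h z - ip \<Omega> (K (u (Suc n))) z)"
    using assms h_L2 by (simp add: ip_linear)
  also have "ip \<Omega> h z - ip \<Omega> (K (u (Suc n))) z = - ip \<Omega> (residual (Suc n)) z"
    unfolding residual_def using assms h_L2 by (simp add: ip_linear)
  finally show ?thesis
    by simp
qed

lemma K_segment: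
  assumes "v \<in> L2 \<Omega>" "w \<in> L2 \<Omega>"
  shows "ae_eq \<Omega> (K (\<lambda>x. v x + s * (w x - v x))) (\<lambda>x. K v x + s * (K w x - K v x))"
proof -
  have add: "ae_eq \<Omega> (K (\<lambda>x. a x + b x)) (\<lambda>x. K a x + K b x)" if "a \<in> L2 \<Omega>" "b \<in> L2 \<Omega>" for a b
    using that bounded_K by (simp add: bounded_operator_def)
  have scale: "ae_eq \<Omega> (K (\<lambda>x. c * a x)) (\<lambda>x. c * K a x)" if "a \<in> L2 \<Omega>" for a c
    using that bounded_K by (simp add: bounded_operator_def)
  have 1: "ae_eq \<Omega> (K (\<lambda>x. v x + s * (w x - v x))) (\<lambda>x. K v x + K (\<lambda>x. s * (w x - v x)) x)"
    using assms by (intro add) auto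
  have 2: "ae_eq \<Omega> (K (\<lambda>x. s * (w x - v x))) (\<lambda>x. s * K (\<lambda>x. w x - v x) x)"
    using assms by (intro scale) auto
  have 3: "ae_eq \<Omega> (K (\<lambda>x. w x + (- 1) * v x)) (\<lambda>x. K w x + K (\<lambda>x. (- 1) * v x) x)"
    using assms by (intro add) auto
  have 4: "ae_eq \<Omega> (K (\<lambda>x. (- 1) * v x)) (\<lambda>x. (- 1) * K v x)"
    using assms by (intro scale)
  show ?thesis
    using 1 2 3 4 unfolding ae_eq_def by eventually_elim simp
qed

text \<open>
  This says that \<open>K\<^sup>* p\<^sub>n\<close> is a subgradient at \<open>u\<^sub>n\<close>. It is the first order condition along the segment
  from \<open>u\<^sub>n\<close> to \<open>v\<close>.
\<close>

lemma subgradient: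
  assumes n: "n \<ge> 1" and v: "v \<in> L2 \<Omega>" "TV \<Omega> v \<le> ereal b"
  shows "J n + ip \<Omega> (p n) (K v) - ip \<Omega> (p n) (K (u n)) \<le> b"
proof -
  obtain m where m: "n = Suc m"
    using n by (cases n) auto
  define r where "r = residual n"
  define d where "d = (\<lambda>x. K v x - K (u n) x)"
  have L2: "r \<in> L2 \<Omega>" "d \<in> L2 \<Omega>" "u n \<in> L2 \<Omega>"
    using n v by (auto simp: r_def d_def)
  \<comment> \<open>The objective at \<open>u n + s * (v - u n)\<close> is compared with its
    minimum, and the comparison is divided by \<open>s\<close>; only the quadratic term keeps a
    factor \<open>s\<close>.\<close>
  have ineq: "0 \<le> \<tau> n * ip \<Omega> r d + s * (\<tau> n / 2 * ip \<Omega> d d) + (b - J n) - ip \<Omega> (p m) d"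
    if s: "0 < s" "s < 1" for s
  proof -
    define w where "w = (\<lambda>x. u n x + s * (v x - u n x))"
    have w: "w \<in> L2 \<Omega>"
      using L2 v by (simp add: w_def)
    have "ae_eq \<Omega> (\<lambda>x. K w x - h x) (\<lambda>x. r x + s * d x)"
      using K_segment[OF L2(3) v(1), of s] unfolding ae_eq_def w_def r_def d_def residual_def
      by eventually_elim simp
    then have res: "nrm \<Omega> (\<lambda>x. K w x - h x) = nrm \<Omega> (\<lambda>x. r x + s * d x)"
      "ip \<Omega> (p m) (\<lambda>x. K w x - h x) = ip \<Omega> (p m) (\<lambda>x. r x + s * d x)"
      using w L2 h_L2 by (auto intro!: nrm_ae_cong ip_ae_cong_right)
    have sq: "(nrm \<Omega> (\<lambda>x. r x + s * d x))\<^sup>2 = (nrm \<Omega> r)\<^sup>2 + 2 * s * ip \<Omega> r d + s\<^sup>2 * ip \<Omega> d d"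
      unfolding nrm_squared using L2
      by (simp add: ip_linear ip_commute[of \<Omega> d r]) (simp add: power2_eq_square algebra_simps)
    have lin: "ip \<Omega> (p m) (\<lambda>x. r x + s * d x) = ip \<Omega> (p m) r + s * ip \<Omega> (p m) d"
      using L2 by (simp add: ip_linear)
    have "TV \<Omega> w \<le> ereal (J n + s * (b - J n))"
      unfolding w_def using s v L2 TV_u[OF n]
      by (intro TV_segment_le[OF open_domain bounded_domain]) auto
    moreover have "ereal (\<tau> n / 2 * (nrm \<Omega> r)\<^sup>2) + ereal (J n) - ereal (ip \<Omega> (p m) r)
        \<le> ereal (\<tau> n / 2 * (nrm \<Omega> (\<lambda>x. r x + s * d x))\<^sup>2) + TV \<Omega> w
          - ereal (ip \<Omega> (p m) (\<lambda>x. r x + s * d x))"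
      using objective_le[OF n w] TV_u[OF n] res by (simp add: m r_def)
    ultimately have "\<tau> n / 2 * (nrm \<Omega> r)\<^sup>2 + J n - ip \<Omega> (p m) r
        \<le> \<tau> n / 2 * (nrm \<Omega> (\<lambda>x. r x + s * d x))\<^sup>2 + (J n + s * (b - J n))
          - ip \<Omega> (p m) (\<lambda>x. r x + s * d x)"
      by (cases "TV \<Omega> w") auto
    then have "0 \<le> s * (\<tau> n * ip \<Omega> r d + s * (\<tau> n / 2 * ip \<Omega> d d) + (b - J n) - ip \<Omega> (p m) d)"
      unfolding sq lin by (simp add: field_simps power2_eq_square)
    then show ?thesis
      using s by (simp add: zero_le_mult_iff)
  qed
  \<comment> \<open>Letting \<open>s\<close> tend to 0 from the right removes the quadratic term;
    the update rule then absorbs \<open>\<tau> n * ip \<Omega> r d\<close> into the pairing with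
    \<open>p n\<close>.\<close>
  have "((\<lambda>s. \<tau> n * ip \<Omega> r d + s * (\<tau> n / 2 * ip \<Omega> d d) + (b - J n) - ip \<Omega> (p m) d) \<longlongrightarrow>
      \<tau> n * ip \<Omega> r d + 0 * (\<tau> n / 2 * ip \<Omega> d d) + (b - J n) - ip \<Omega> (p m) d) (at_right 0)"
    by (intro tendsto_intros)
  moreover have "\<forall>\<^sub>F s in at_right 0.
      0 \<le> \<tau> n * ip \<Omega> r d + s * (\<tau> n / 2 * ip \<Omega> d d) + (b - J n) - ip \<Omega> (p m) d"
    by (rule eventually_mono[OF eventually_at_right_real[of 0 1]]) (use ineq in auto)
  ultimately have "0 \<le> \<tau> n * ip \<Omega> r d + 0 * (\<tau> n / 2 * ip \<Omega> d d) + (b - J n) - ip \<Omega> (p m) d"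
    by (intro tendsto_lowerbound) auto
  moreover have "ip \<Omega> (p n) d = ip \<Omega> (p m) d - \<tau> n * ip \<Omega> r d"
    using ip_p_Suc[OF L2(2), of m] by (simp add: m r_def)
  moreover have "ip \<Omega> (p n) d = ip \<Omega> (p n) (K v) - ip \<Omega> (p n) (K (u n))"
    using L2 v n by (simp add: d_def ip_linear)
  ultimately show ?thesis
    by simp
qed

lemma gap_nonneg:
  assumes "n \<ge> 1" "v \<in> L2 \<Omega>" "TV \<Omega> v \<le> ereal c" "ae_eq \<Omega> (K v) g" "g \<in> L2 \<Omega>"
  shows "0 \<le> bregman_gap c g n"
proof -
  have "ip \<Omega> (p n) (K v) = ip \<Omega> (p n) g"
    using assms by (intro ip_ae_cong_right) auto
  then show ?thesis
    using subgradient[OF assms(1-3)] by (simp add: bregman_gap_def)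
qed

text \<open>Passing to \<open>Suc n\<close> changes the gap by minus the Bregman distance of
  \<open>u (Suc n)\<close> from \<open>u n\<close>, which is dropped, and by the pairing of
  \<open>p n - p (Suc n)\<close> with \<open>g - K (u (Suc n))\<close>. The latter is the step size
  times the residual against \<open>(g - h)\<close> minus the residual. Index 0 is excluded because
  \<open>p0\<close> need not give a subgradient.\<close>

lemma gap_Suc:
  assumes "n \<ge> 1" "g \<in> L2 \<Omega>" "nrm \<Omega> (\<lambda>x. g x - h x) \<le> d"
  shows "bregman_gap c g (Suc n) \<le> bregman_gap c g n
    + \<tau> (Suc n) * (nrm \<Omega> (residual (Suc n)) * (d - nrm \<Omega> (residual (Suc n))))"
proof -
  let ?r = "residual (Suc n)" and ?z = "\<lambda>x. g x - K (u (Suc n)) x"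
  have L2: "u n \<in> L2 \<Omega>" "u (Suc n) \<in> L2 \<Omega>" "?r \<in> L2 \<Omega>" "h \<in> L2 \<Omega>"
    using assms h_L2 by auto
  have "J n + ip \<Omega> (p n) (K (u (Suc n))) - ip \<Omega> (p n) (K (u n)) \<le> J (Suc n)"
    using assms TV_u[of "Suc n"] by (intro subgradient) auto
  moreover have "bregman_gap c g (Suc n)
      = c - J (Suc n) - (ip \<Omega> (p n) g - ip \<Omega> (p n) (K (u (Suc n)))) + \<tau> (Suc n) * ip \<Omega> ?r ?z"
    using assms L2 by (simp add: bregman_gap_def ip_p_Suc ip_linear algebra_simps)
  ultimately have "bregman_gap c g (Suc n) \<le> bregman_gap c g n + \<tau> (Suc n) * ip \<Omega> ?r ?z"
    by (simp add: bregman_gap_def)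
  moreover have "ip \<Omega> ?r ?z \<le> nrm \<Omega> ?r * (d - nrm \<Omega> ?r)"
  proof -
    have "ip \<Omega> ?r ?z = ip \<Omega> ?r (\<lambda>x. g x - h x) - ip \<Omega> ?r ?r"
      unfolding residual_def using assms L2 by (simp add: ip_linear)
    also have "ip \<Omega> ?r (\<lambda>x. g x - h x) \<le> nrm \<Omega> ?r * nrm \<Omega> (\<lambda>x. g x - h x)"
      using ip_Cauchy_Schwarz[of ?r \<Omega> "\<lambda>x. g x - h x"] assms L2 by (simp add: abs_le_iff)
    also have "\<dots> \<le> nrm \<Omega> ?r * d"
      using assms by (intro mult_left_mono) auto
    finally show ?thesis
      by (simp add: nrm_squared[symmetric] power2_eq_square algebra_simps)
  qed
  then have "\<tau> (Suc n) * ip \<Omega> ?r ?z \<le> \<tau> (Suc n) * (nrm \<Omega> ?r * (d - nrm \<Omega> ?r))"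
    by (rule mult_left_mono) (simp add: \<tau>_pos less_imp_le)
  ultimately show ?thesis
    by linarith
qed

text \<open>Adding the subgradient inequalities at \<open>u n\<close> and \<open>u (Suc n)\<close>
  makes the pairing of the new residual with \<open>K (u (Suc n)) - K (u n)\<close> nonpositive.
  Hence its squared norm is at most its pairing with the old residual.\<close>

lemma residual_Suc_le:
  assumes n: "n \<ge> 1"
  shows "nrm \<Omega> (residual (Suc n)) \<le> nrm \<Omega> (residual n)"
proof -
  let ?r = "residual (Suc n)" and ?q = "residual n"
  have L2: "u n \<in> L2 \<Omega>" "u (Suc n) \<in> L2 \<Omega>" "?r \<in> L2 \<Omega>" "?q \<in> L2 \<Omega>"
    using n by auto
  have "J n + ip \<Omega> (p n) (K (u (Suc n))) - ip \<Omega> (p n) (K (u n)) \<le> J (Suc n)"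
    using n TV_u[of "Suc n"] by (intro subgradient) auto
  moreover have "J (Suc n) + ip \<Omega> (p (Suc n)) (K (u n)) - ip \<Omega> (p (Suc n)) (K (u (Suc n))) \<le> J n"
    using n TV_u[of n] by (intro subgradient) auto
  ultimately have "\<tau> (Suc n) * ip \<Omega> ?r (K (u (Suc n))) \<le> \<tau> (Suc n) * ip \<Omega> ?r (K (u n))"
    using L2 by (simp add: ip_p_Suc)
  then have "ip \<Omega> ?r (K (u (Suc n))) \<le> ip \<Omega> ?r (K (u n))"
    using \<tau>_pos[of "Suc n"] by simp
  moreover have "ip \<Omega> ?r ?r = ip \<Omega> ?r (K (u (Suc n))) - ip \<Omega> ?r h"
    "ip \<Omega> ?r ?q = ip \<Omega> ?r (K (u n)) - ip \<Omega> ?r h"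
    unfolding residual_def using L2 h_L2 by (simp_all add: ip_linear)
  ultimately have "(nrm \<Omega> ?r)\<^sup>2 \<le> ip \<Omega> ?r ?q"
    by (simp add: nrm_squared)
  also have "\<dots> \<le> nrm \<Omega> ?r * nrm \<Omega> ?q"
    using ip_Cauchy_Schwarz[OF L2(3,4)] by (simp add: abs_le_iff)
  finally show ?thesis
    by (metis mult_le_cancel_left_pos nrm_ge_zero order_le_less power2_eq_square)
qed

lemma residual_antimono:
  assumes "1 \<le> m" "m \<le> n"
  shows "nrm \<Omega> (residual n) \<le> nrm \<Omega> (residual m)"
  using assms(2)
proof (induction n rule: dec_induct)
  case (step n)
  then show ?case
    using residual_Suc_le[of n] assms(1) by linarith
qed simp

text \<open>With noise at most \<open>q\<close> times the residual, a step lowers the gap by at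
  least \<open>1 - q\<close> times its weighted squared residual. Exact data use
  \<open>q = 0\<close>, the noisy runs \<open>q = 1 / \<rho>\<close>.\<close>

lemma gap_sum_le:
  assumes m: "1 \<le> m" "m \<le> n" and g: "g \<in> L2 \<Omega>" "nrm \<Omega> (\<lambda>x. g x - h x) \<le> d"
    and q: "\<And>j. m < j \<Longrightarrow> j \<le> n \<Longrightarrow> d \<le> q * nrm \<Omega> (residual j)"
  shows "bregman_gap c g n + (1 - q) * (\<Sum>j\<in>{m<..n}. \<tau> j * (nrm \<Omega> (residual j))\<^sup>2) \<le> bregman_gap c g m"
  using m(2) q
proof (induction n rule: dec_induct)
  case base
  show ?case by simp
next
  case (step n)
  let ?\<rho> = "nrm \<Omega> (residual (Suc n))"
  have "?\<rho> * (d - ?\<rho>) \<le> ?\<rho> * (q * ?\<rho> - ?\<rho>)"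
    using step.prems[of "Suc n"] step.hyps by (intro mult_left_mono) auto
  then have "\<tau> (Suc n) * (?\<rho> * (d - ?\<rho>)) \<le> \<tau> (Suc n) * (?\<rho> * (q * ?\<rho> - ?\<rho>))"
    by (rule mult_left_mono) (simp add: \<tau>_pos less_imp_le)
  also have "\<dots> = - ((1 - q) * (\<tau> (Suc n) * ?\<rho>\<^sup>2))"
    by (simp add: power2_eq_square algebra_simps)
  finally have "bregman_gap c g (Suc n) + (1 - q) * (\<tau> (Suc n) * ?\<rho>\<^sup>2) \<le> bregman_gap c g n"
    using gap_Suc[OF order_trans[OF m(1) step.hyps(1)] g, of c] by linarith
  moreover have "{m<..Suc n} = insert (Suc n) {m<..n}"
    using step.hyps by auto
  ultimately show ?case
    using step.IH step.prems by (simp add: algebra_simps)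
qed

lemma nrm_p_Suc_le: "nrm \<Omega> (p (Suc n)) \<le> nrm \<Omega> (p n) + \<tau> (Suc n) * nrm \<Omega> (residual (Suc n))"
proof -
  let ?r = "residual (Suc n)"
  have "(nrm \<Omega> (p (Suc n)))\<^sup>2 = ip \<Omega> (p n) (p (Suc n)) - \<tau> (Suc n) * ip \<Omega> ?r (p (Suc n))"
    by (simp add: nrm_squared ip_p_Suc)
  also have "\<dots> \<le> nrm \<Omega> (p n) * nrm \<Omega> (p (Suc n)) + \<tau> (Suc n) * (nrm \<Omega> ?r * nrm \<Omega> (p (Suc n)))"
  proof -
    have "- (nrm \<Omega> ?r * nrm \<Omega> (p (Suc n))) \<le> ip \<Omega> ?r (p (Suc n))"
      "ip \<Omega> (p n) (p (Suc n)) \<le> nrm \<Omega> (p n) * nrm \<Omega> (p (Suc n))"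
      using ip_Cauchy_Schwarz[of ?r \<Omega> "p (Suc n)"] ip_Cauchy_Schwarz[of "p n" \<Omega> "p (Suc n)"] by auto
    moreover from this(1) have "\<tau> (Suc n) * - (nrm \<Omega> ?r * nrm \<Omega> (p (Suc n))) \<le> \<tau> (Suc n) * ip \<Omega> ?r (p (Suc n))"
      by (rule mult_left_mono) (simp add: \<tau>_pos less_imp_le)
    ultimately show ?thesis
      by simp
  qed
  also have "\<dots> = nrm \<Omega> (p (Suc n)) * (nrm \<Omega> (p n) + \<tau> (Suc n) * nrm \<Omega> ?r)"
    by (simp add: algebra_simps)
  finally have "nrm \<Omega> (p (Suc n)) * nrm \<Omega> (p (Suc n))
      \<le> nrm \<Omega> (p (Suc n)) * (nrm \<Omega> (p n) + \<tau> (Suc n) * nrm \<Omega> ?r)"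
    by (simp add: power2_eq_square)
  then show ?thesis
    using \<tau>_pos[of "Suc n"] nrm_ge_zero[of \<Omega> "p (Suc n)"]
    by (cases "nrm \<Omega> (p (Suc n)) = 0") auto
qed

text \<open>The weight \<open>\<tau> j\<close> is split into two square roots for the Cauchy-Schwarz
  inequality. A bounded weighted sum of squared residuals thus limits the growth of
  \<open>p n\<close> to the square root of the total step length.\<close>

lemma nrm_p_le:
  "nrm \<Omega> (p n) \<le> nrm \<Omega> (p 0)
    + sqrt (\<Sum>j = 1..n. \<tau> j) * sqrt (\<Sum>j = 1..n. \<tau> j * (nrm \<Omega> (residual j))\<^sup>2)"
proof -
  have "nrm \<Omega> (p n) \<le> nrm \<Omega> (p 0) + (\<Sum>j = 1..n. \<tau> j * nrm \<Omega> (residual j))"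
  proof (induction n)
    case (Suc n)
    then show ?case
      using nrm_p_Suc_le[of n] by simp
  qed simp
  also have "(\<Sum>j = 1..n. \<tau> j * nrm \<Omega> (residual j))
      = (\<Sum>j = 1..n. sqrt (\<tau> j) * (sqrt (\<tau> j) * nrm \<Omega> (residual j)))"
    using \<tau>_pos by (intro sum.cong) (auto simp: less_imp_le simp flip: mult.assoc)
  also have "\<dots> \<le> sqrt ((\<Sum>j = 1..n. (sqrt (\<tau> j))\<^sup>2) * (\<Sum>j = 1..n. (sqrt (\<tau> j) * nrm \<Omega> (residual j))\<^sup>2))"
    by (intro real_le_rsqrt Cauchy_Schwarz_ineq_sum)
  also have "(\<Sum>j = 1..n. (sqrt (\<tau> j))\<^sup>2) = (\<Sum>j = 1..n. \<tau> j)"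
    using \<tau>_pos by (intro sum.cong) (auto simp: less_imp_le)
  also have "(\<Sum>j = 1..n. (sqrt (\<tau> j) * nrm \<Omega> (residual j))\<^sup>2) = (\<Sum>j = 1..n. \<tau> j * (nrm \<Omega> (residual j))\<^sup>2)"
    using \<tau>_pos by (intro sum.cong) (auto simp: less_imp_le power_mult_distrib)
  finally show ?thesis
    by (simp add: real_sqrt_mult)
qed

end

section \<open>Stability and exact data\<close>

lemma nrm_diff_triangle:
  assumes "u \<in> L2 \<Omega>" "v \<in> L2 \<Omega>"
  shows "nrm \<Omega> (\<lambda>x. u x - v x) \<le> nrm \<Omega> u + nrm \<Omega> v"
  using nrm_triangle[OF assms(1) L2_uminus[OF assms(2)]] nrm_scale[of \<Omega> "- 1" v] by simp

text \<open>Both runs share step sizes and starting element, while their minimizers are chosen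
  independently. In the main proof the second run carries the exact data.\<close>

locale two_lagrangian_iterations =
  A: lagrangian_iteration \<Omega> K \<tau> p0 h u p + B: lagrangian_iteration \<Omega> K \<tau> p0 h' u' p'
  for \<Omega> K \<tau> p0 h u p h' u' p' +
  fixes d :: real
  assumes data_dist: "nrm \<Omega> (\<lambda>x. h x - h' x) \<le> d"
begin

lemma d_nonneg: "0 \<le> d"
  using order_trans[OF nrm_ge_zero data_dist] .

text \<open>A step is implicit, like a proximal point step: monotonicity of the subgradients gives
  the term with \<open>K\<close> a favourable sign. The difference of the multipliers therefore
  grows by a summand, the step size times the data distance, and not by a factor.\<close>

lemma nrm_p_diff_Suc_le:
  "nrm \<Omega> (\<lambda>x. p (Suc n) x - p' (Suc n) x) \<le> nrm \<Omega> (\<lambda>x. p n x - p' n x) + \<tau> (Suc n) * d"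
proof -
  let ?e = "\<lambda>x. p n x - p' n x" and ?f = "\<lambda>x. p (Suc n) x - p' (Suc n) x"
  let ?v = "u (Suc n)" and ?v' = "u' (Suc n)"
  have L2: "?e \<in> L2 \<Omega>" "?f \<in> L2 \<Omega>" "K ?v \<in> L2 \<Omega>" "K ?v' \<in> L2 \<Omega>"
    by auto
  have "A.J (Suc n) + ip \<Omega> (p (Suc n)) (K ?v') - ip \<Omega> (p (Suc n)) (K ?v) \<le> B.J (Suc n)"
    using B.TV_u by (intro A.subgradient) auto
  moreover have "B.J (Suc n) + ip \<Omega> (p' (Suc n)) (K ?v) - ip \<Omega> (p' (Suc n)) (K ?v') \<le> A.J (Suc n)"
    using A.TV_u by (intro B.subgradient) auto
  ultimately have mono: "ip \<Omega> (K ?v') ?f \<le> ip \<Omega> (K ?v) ?f"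
    using L2 by (simp add: ip_linear ip_commute)
  have "ip \<Omega> ?f ?f = ip \<Omega> (p (Suc n)) ?f - ip \<Omega> (p' (Suc n)) ?f"
    using L2 by (simp add: ip_diff_left)
  also have "\<dots> = ip \<Omega> ?e ?f - \<tau> (Suc n) * (ip \<Omega> (A.residual (Suc n)) ?f - ip \<Omega> (B.residual (Suc n)) ?f)"
    using L2(2) by (simp add: A.ip_p_Suc[OF L2(2)] B.ip_p_Suc[OF L2(2)] ip_diff_left algebra_simps)
  also have "ip \<Omega> (A.residual (Suc n)) ?f - ip \<Omega> (B.residual (Suc n)) ?f
      = ip \<Omega> (K ?v) ?f - ip \<Omega> (K ?v') ?f - ip \<Omega> (\<lambda>x. h x - h' x) ?f"
    unfolding A.residual_def B.residual_def using L2 A.h_L2 B.h_L2 by (simp add: ip_diff_left)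
  also have "ip \<Omega> ?e ?f - \<tau> (Suc n) * (ip \<Omega> (K ?v) ?f - ip \<Omega> (K ?v') ?f - ip \<Omega> (\<lambda>x. h x - h' x) ?f)
      \<le> nrm \<Omega> ?e * nrm \<Omega> ?f + \<tau> (Suc n) * (d * nrm \<Omega> ?f)"
  proof -
    have "ip \<Omega> ?e ?f \<le> nrm \<Omega> ?e * nrm \<Omega> ?f"
      using ip_Cauchy_Schwarz[OF L2(1,2)] by linarith
    moreover have "ip \<Omega> (\<lambda>x. h x - h' x) ?f \<le> nrm \<Omega> (\<lambda>x. h x - h' x) * nrm \<Omega> ?f"
      using ip_Cauchy_Schwarz[OF L2_diff[OF A.h_L2 B.h_L2] L2(2)] by linarith
    moreover have "nrm \<Omega> (\<lambda>x. h x - h' x) * nrm \<Omega> ?f \<le> d * nrm \<Omega> ?f"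
      using data_dist by (intro mult_right_mono) auto
    ultimately have "- (d * nrm \<Omega> ?f) \<le> ip \<Omega> (K ?v) ?f - ip \<Omega> (K ?v') ?f - ip \<Omega> (\<lambda>x. h x - h' x) ?f"
      using mono by linarith
    then have "\<tau> (Suc n) * - (d * nrm \<Omega> ?f)
        \<le> \<tau> (Suc n) * (ip \<Omega> (K ?v) ?f - ip \<Omega> (K ?v') ?f - ip \<Omega> (\<lambda>x. h x - h' x) ?f)"
      by (rule mult_left_mono) (simp add: A.\<tau>_pos less_imp_le)
    then show ?thesis
      using \<open>ip \<Omega> ?e ?f \<le> nrm \<Omega> ?e * nrm \<Omega> ?f\<close> by simp
  qed
  finally have "nrm \<Omega> ?f * nrm \<Omega> ?f \<le> nrm \<Omega> ?f * (nrm \<Omega> ?e + \<tau> (Suc n) * d)"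
    by (simp add: nrm_squared[symmetric] power2_eq_square algebra_simps)
  moreover have "0 \<le> nrm \<Omega> ?e + \<tau> (Suc n) * d"
    using A.\<tau>_pos[of "Suc n"] d_nonneg by (intro add_nonneg_nonneg mult_nonneg_nonneg) auto
  ultimately show ?thesis
    using nrm_ge_zero[of \<Omega> ?f] by (cases "nrm \<Omega> ?f = 0") auto
qed

lemma nrm_p_diff_le: "nrm \<Omega> (\<lambda>x. p n x - p' n x) \<le> (\<Sum>j = 1..n. \<tau> j) * d"
proof (induction n)
  case 0
  have "ae_eq \<Omega> (p 0) p0" "ae_eq \<Omega> (p' 0) p0"
    using A.iteration B.iteration by (auto simp: augmented_lagrangian_def)
  then have "ae_eq \<Omega> (p 0) (p' 0)"
    unfolding ae_eq_def by eventually_elim simp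
  then show ?case
    by (simp add: ae_eq_iff_diff nrm_def)
next
  case (Suc n)
  then show ?case
    using nrm_p_diff_Suc_le[of n] by (simp add: algebra_simps)
qed

text \<open>Up to sign the residual is the increment of \<open>p\<close> divided by
  \<open>\<tau> n\<close>. The factor 2 comes from using the bound on multipliers at
  \<open>n - 1\<close> and at \<open>n\<close>.\<close>

lemma nrm_residual_diff_le:
  assumes "n \<ge> 1"
  shows "nrm \<Omega> (\<lambda>x. A.residual n x - B.residual n x) \<le> 2 * ((\<Sum>j = 1..n. \<tau> j) * d) / \<tau> n"
proof -
  obtain m where m: "n = Suc m"
    using assms by (cases n) auto
  let ?e = "\<lambda>x. p m x - p' m x" and ?f = "\<lambda>x. p n x - p' n x"
  let ?z = "\<lambda>x. A.residual n x - B.residual n x"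
  have z: "?z \<in> L2 \<Omega>"
    using assms by auto
  have \<tau>: "0 < \<tau> n"
    using A.\<tau>_pos assms by simp
  have "ip \<Omega> (\<lambda>x. ?e x - ?f x) ?z
      = ip \<Omega> (p m) ?z - ip \<Omega> (p' m) ?z - (ip \<Omega> (p n) ?z - ip \<Omega> (p' n) ?z)"
    using z by (simp add: ip_diff_left)
  moreover have "ip \<Omega> ?z ?z = ip \<Omega> (A.residual n) ?z - ip \<Omega> (B.residual n) ?z"
    by (rule ip_diff_left) (use assms z in auto)
  ultimately have "\<tau> n * ip \<Omega> ?z ?z = ip \<Omega> (\<lambda>x. ?e x - ?f x) ?z"
    using A.ip_p_Suc[OF z, of m] B.ip_p_Suc[OF z, of m] by (simp add: m right_diff_distrib)
  also have "\<dots> \<le> nrm \<Omega> (\<lambda>x. ?e x - ?f x) * nrm \<Omega> ?z"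
    using ip_Cauchy_Schwarz[OF _ z, of "\<lambda>x. ?e x - ?f x"] by auto
  also have "\<dots> \<le> (2 * ((\<Sum>j = 1..n. \<tau> j) * d)) * nrm \<Omega> ?z"
  proof (rule mult_right_mono)
    have "(\<Sum>j = 1..m. \<tau> j) * d \<le> (\<Sum>j = 1..n. \<tau> j) * d"
      using \<tau> d_nonneg by (intro mult_right_mono) (auto simp: m)
    then show "nrm \<Omega> (\<lambda>x. ?e x - ?f x) \<le> 2 * ((\<Sum>j = 1..n. \<tau> j) * d)"
      using nrm_diff_triangle[of ?e \<Omega> ?f] nrm_p_diff_le[of m] nrm_p_diff_le[of n] by auto
  qed simp
  finally have "nrm \<Omega> ?z * (\<tau> n * nrm \<Omega> ?z) \<le> nrm \<Omega> ?z * (2 * ((\<Sum>j = 1..n. \<tau> j) * d))"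
    by (simp add: nrm_squared[symmetric] power2_eq_square algebra_simps)
  moreover have "0 \<le> (\<Sum>j = 1..n. \<tau> j) * d"
    using d_nonneg A.\<tau>_pos by (intro mult_nonneg_nonneg sum_nonneg) (auto simp: less_imp_le)
  ultimately have "\<tau> n * nrm \<Omega> ?z \<le> 2 * ((\<Sum>j = 1..n. \<tau> j) * d)"
    using nrm_ge_zero[of \<Omega> ?z] by (cases "nrm \<Omega> ?z = 0") auto
  then show ?thesis
    using \<tau> by (simp add: field_simps)
qed

lemma nrm_residual_le:
  assumes "n \<ge> 1"
  shows "nrm \<Omega> (A.residual n) \<le> nrm \<Omega> (B.residual n) + 2 * ((\<Sum>j = 1..n. \<tau> j) * d) / \<tau> n"
  using nrm_triangle[of "\<lambda>x. A.residual n x - B.residual n x" \<Omega> "B.residual n"]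
    nrm_residual_diff_le[OF assms] assms by auto

text \<open>The subgradient inequality of the second run at \<open>u' n\<close>, evaluated at
  \<open>u n\<close>, leaves only the pairing of \<open>p n - p' n\<close> with
  \<open>K (u n) - h'\<close>. The primal iterates are not compared with each other.\<close>

lemma gap_le:
  assumes n: "n \<ge> 1"
  shows "A.bregman_gap c h' n \<le> B.bregman_gap c h' n
    + (nrm \<Omega> (B.residual n) + 2 * ((\<Sum>j = 1..n. \<tau> j) * d) / \<tau> n + d) * ((\<Sum>j = 1..n. \<tau> j) * d)"
proof -
  let ?e = "\<lambda>x. p n x - p' n x" and ?z = "\<lambda>x. K (u n) x - h' x"
  have L2: "u n \<in> L2 \<Omega>" "u' n \<in> L2 \<Omega>" "?e \<in> L2 \<Omega>" "?z \<in> L2 \<Omega>"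
    using n B.h_L2 by auto
  have "B.J n + ip \<Omega> (p' n) (K (u n)) - ip \<Omega> (p' n) (K (u' n)) \<le> A.J n"
    using n A.TV_u by (intro B.subgradient) auto
  then have "A.bregman_gap c h' n \<le> B.bregman_gap c h' n + ip \<Omega> ?e ?z"
    using L2 B.h_L2 by (simp add: A.bregman_gap_def B.bregman_gap_def ip_diff_left ip_diff_right)
  also have "ip \<Omega> ?e ?z \<le> nrm \<Omega> ?z * nrm \<Omega> ?e"
    using ip_Cauchy_Schwarz[OF L2(3,4)] by (simp add: abs_le_iff mult.commute)
  also have "\<dots> \<le> (nrm \<Omega> (B.residual n) + 2 * ((\<Sum>j = 1..n. \<tau> j) * d) / \<tau> n + d) * ((\<Sum>j = 1..n. \<tau> j) * d)"
  proof (rule mult_mono)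
    have "nrm \<Omega> ?z \<le> nrm \<Omega> (A.residual n) + nrm \<Omega> (\<lambda>x. h x - h' x)"
      using nrm_triangle[of "A.residual n" \<Omega> "\<lambda>x. h x - h' x"] n A.h_L2 B.h_L2
      by (simp add: A.residual_def)
    then show "nrm \<Omega> ?z \<le> nrm \<Omega> (B.residual n) + 2 * ((\<Sum>j = 1..n. \<tau> j) * d) / \<tau> n + d"
      using nrm_residual_le[OF n] data_dist by linarith
    then show "0 \<le> nrm \<Omega> (B.residual n) + 2 * ((\<Sum>j = 1..n. \<tau> j) * d) / \<tau> n + d"
      using nrm_ge_zero order_trans by blast
  qed (use nrm_p_diff_le in auto)
  finally show ?thesis
    by simp
qed

end

text \<open>The adjoint carries weak convergence through \<open>K\<close>. Testing with the defect
  \<open>K v - g\<close> itself shows that its norm vanishes.\<close>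

lemma weak_limit_solves:
  assumes K: "bounded_operator \<Omega> K" "is_adjoint \<Omega> K Kadj" and g: "g \<in> L2 \<Omega>"
    and w: "weakly_converges \<Omega> w v"
    and lim: "(\<lambda>k. nrm \<Omega> (\<lambda>x. K (w k) x - g x)) \<longlonglongrightarrow> 0"
  shows "ae_eq \<Omega> (K v) g"
proof -
  have L2: "v \<in> L2 \<Omega>" "w k \<in> L2 \<Omega>" for k
    using w by (auto simp: weakly_converges_def)
  then have KL2: "K v \<in> L2 \<Omega>" "K (w k) \<in> L2 \<Omega>" for k
    using K(1) by (auto simp: bounded_operator_def)
  define z where "z = (\<lambda>x. K v x - g x)"
  have z: "z \<in> L2 \<Omega>"
    using KL2 g by (simp add: z_def)
  then have Kz: "Kadj z \<in> L2 \<Omega>" and adj: "\<And>y. y \<in> L2 \<Omega> \<Longrightarrow> ip \<Omega> (K y) z = ip \<Omega> y (Kadj z)"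
    using K(2) by (auto simp: is_adjoint_def)
  have "(\<lambda>k. ip \<Omega> (K (w k)) z) \<longlonglongrightarrow> ip \<Omega> (K v) z"
    using w Kz L2 by (simp add: weakly_converges_def adj)
  moreover have "(\<lambda>k. ip \<Omega> (K (w k)) z - ip \<Omega> g z) \<longlonglongrightarrow> 0"
  proof (rule Lim_null_comparison)
    show "\<forall>\<^sub>F k in sequentially. norm (ip \<Omega> (K (w k)) z - ip \<Omega> g z) \<le> nrm \<Omega> (\<lambda>x. K (w k) x - g x) * nrm \<Omega> z"
      using ip_Cauchy_Schwarz[OF L2_diff[OF KL2(2) g] z] KL2 g z
      by (intro always_eventually) (simp add: ip_diff_left)
    show "(\<lambda>k. nrm \<Omega> (\<lambda>x. K (w k) x - g x) * nrm \<Omega> z) \<longlonglongrightarrow> 0"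
      using tendsto_mult_left_zero[OF lim] .
  qed
  ultimately have "ip \<Omega> (K v) z = ip \<Omega> g z"
    by (rule LIMSEQ_unique[OF _ LIM_zero_cancel])
  moreover have "ip \<Omega> (\<lambda>x. K v x - g x) z = ip \<Omega> (K v) z - ip \<Omega> g z"
    using KL2(1) g z by (rule ip_diff_left)
  ultimately have "ip \<Omega> z z = 0"
    by (simp flip: z_def)
  then show ?thesis
    using KL2 g by (simp add: ae_eq_iff_diff z_def)
qed

text \<open>Abel-Olivier argument: by monotonicity \<open>(t n - t m) * x n\<close> lies below a
  tail of the convergent sum, and for fixed \<open>m\<close> the rest \<open>t m * x n\<close> tends
  to 0 because \<open>x n\<close> is at most the full sum divided by \<open>t n\<close>.\<close>

lemma antimono_weighted_bounded_imp_null: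
  fixes \<tau> x :: "nat \<Rightarrow> real"
  assumes \<tau>: "\<And>j. j \<ge> 1 \<Longrightarrow> 0 < \<tau> j" and t: "filterlim (\<lambda>n. \<Sum>j = 1..n. \<tau> j) at_top sequentially"
    and x: "\<And>j. 0 \<le> x j" "\<And>m n. 1 \<le> m \<Longrightarrow> m \<le> n \<Longrightarrow> x n \<le> x m"
    and B: "\<And>n. (\<Sum>j = 1..n. \<tau> j * x j) \<le> B"
  shows "(\<lambda>n. (\<Sum>j = 1..n. \<tau> j) * x n) \<longlonglongrightarrow> 0"
proof (rule LIMSEQ_I)
  fix \<epsilon> :: real assume "0 < \<epsilon>"
  define t where "t n = (\<Sum>j = 1..n. \<tau> j)" for n
  define S where "S n = (\<Sum>j = 1..n. \<tau> j * x j)" for n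
  have tnn: "0 \<le> t n" for n
    unfolding t_def using \<tau> by (intro sum_nonneg) (auto simp: less_imp_le)
  have "incseq S"
    unfolding S_def using \<tau> x(1) by (intro incseq_SucI) (simp add: less_imp_le)
  then obtain L where L: "S \<longlonglongrightarrow> L" "\<And>n. S n \<le> L"
    using incseq_convergent[of S B] B unfolding S_def by metis
  have tail: "(t n - t m) * x n \<le> S n - S m" if "m \<le> n" for m n
  proof -
    have split: "{1..n} = {1..m} \<union> {m<..n}" "{1..m} \<inter> {m<..n} = {}"
      using that by auto
    have "(t n - t m) * x n = (\<Sum>j\<in>{m<..n}. \<tau> j * x n)"
      unfolding t_def split(1) by (subst sum.union_disjoint) (use split(2) in \<open>auto simp: sum_distrib_right\<close>)
    also have "\<dots> \<le> (\<Sum>j\<in>{m<..n}. \<tau> j * x j)"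
      using \<tau> x(2) by (intro sum_mono mult_left_mono) (auto simp: less_imp_le)
    also have "\<dots> = S n - S m"
      unfolding S_def split(1) by (subst sum.union_disjoint) (use split(2) in auto)
    finally show ?thesis .
  qed
  obtain m where m: "L - \<epsilon> / 2 < S m"
    using order_tendstoD(1)[OF L(1), of "L - \<epsilon> / 2"] \<open>0 < \<epsilon>\<close> by (auto simp: eventually_sequentially)
  have "(\<lambda>n. t m * (L / t n)) \<longlonglongrightarrow> t m * 0"
    using t unfolding t_def by (intro tendsto_intros real_tendsto_divide_at_top) auto
  then have "\<forall>\<^sub>F n in sequentially. t m * (L / t n) < \<epsilon> / 2"
    using \<open>0 < \<epsilon>\<close> by (intro order_tendstoD(2)) auto
  moreover have "\<forall>\<^sub>F n in sequentially. 0 < t n"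
    using t unfolding t_def by (simp add: filterlim_at_top_dense)
  ultimately have "\<forall>\<^sub>F n in sequentially. t n * x n < \<epsilon>"
    using eventually_ge_at_top[of m]
  proof eventually_elim
    case (elim n)
    have "t n * x n \<le> L"
      using tail[of 0 n] L(2)[of n] by (simp add: t_def S_def)
    then have "x n \<le> L / t n"
      using elim by (simp add: field_simps)
    then have "t m * x n \<le> t m * (L / t n)"
      using tnn by (intro mult_left_mono)
    moreover have "t n * x n \<le> (S n - S m) + t m * x n"
      using tail[OF elim(3)] by (simp add: algebra_simps)
    ultimately show ?case
      using elim m L(2)[of n] by linarith
  qed
  moreover have "0 \<le> t n * x n" for n
    using tnn x(1) by simp
  ultimately show "\<exists>n0. \<forall>n\<ge>n0. norm ((\<Sum>j = 1..n. \<tau> j) * x n - 0) < \<epsilon>"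
    by (auto simp: eventually_sequentially t_def)
qed

text \<open>Once \<open>T k\<close> is at least 1, constants are absorbed in
  \<open>sqrt (T k)\<close>, and \<open>sqrt (T k) * x k\<close> is the root of a null sequence. It
  serves for multipliers against residuals or noise levels, and with constant \<open>P\<close> for
  the residuals alone.\<close>

lemma sqrt_growth_times_null:
  fixes T x P :: "nat \<Rightarrow> real"
  assumes T: "filterlim T at_top sequentially" and lim: "(\<lambda>k. T k * (x k)\<^sup>2) \<longlonglongrightarrow> 0"
    and x: "\<And>k. 0 \<le> x k" and P: "\<forall>\<^sub>F k in sequentially. 0 \<le> P k \<and> P k \<le> A + B * sqrt (T k)"
  shows "(\<lambda>k. P k * x k) \<longlonglongrightarrow> 0"
proof (rule Lim_null_comparison)
  show "(\<lambda>k. (\<bar>A\<bar> + \<bar>B\<bar>) * sqrt (T k * (x k)\<^sup>2)) \<longlonglongrightarrow> 0"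
    using tendsto_real_sqrt[OF lim] by (intro tendsto_mult_right_zero) simp
  have "\<forall>\<^sub>F k in sequentially. 1 \<le> T k"
    using T by (simp add: filterlim_at_top)
  with P show "\<forall>\<^sub>F k in sequentially. norm (P k * x k) \<le> (\<bar>A\<bar> + \<bar>B\<bar>) * sqrt (T k * (x k)\<^sup>2)"
  proof eventually_elim
    case (elim k)
    have "1 \<le> sqrt (T k)"
      using elim by simp
    then have "\<bar>A\<bar> * 1 \<le> \<bar>A\<bar> * sqrt (T k)" "B * sqrt (T k) \<le> \<bar>B\<bar> * sqrt (T k)"
      using mult_left_mono[of 1 "sqrt (T k)" "\<bar>A\<bar>"] mult_right_mono[of B "\<bar>B\<bar>" "sqrt (T k)"] by auto
    then have "P k \<le> (\<bar>A\<bar> + \<bar>B\<bar>) * sqrt (T k)"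
      using elim unfolding distrib_right by linarith
    then have "P k * x k \<le> (\<bar>A\<bar> + \<bar>B\<bar>) * sqrt (T k) * x k"
      using x by (intro mult_right_mono)
    also have "\<dots> = (\<bar>A\<bar> + \<bar>B\<bar>) * sqrt (T k * (x k)\<^sup>2)"
      using x[of k] by (simp add: real_sqrt_mult)
    finally show ?case
      using elim x[of k] by simp
  qed
qed

lemma LIMSEQ_imp_bounded_above:
  fixes X :: "nat \<Rightarrow> real"
  assumes "X \<longlonglongrightarrow> l"
  shows "\<exists>B. \<forall>k. X k \<le> B"
  using convergent_imp_bounded[OF assms] unfolding bounded_iff by (auto simp: abs_le_iff)

text \<open>The decreasing gap has a limit \<open>L\<close>, and \<open>J n\<close> equals
  \<open>c\<close> minus the gap plus a null sequence. Along a weakly convergent subsequence lower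
  semicontinuity yields \<open>c \<le> c - L\<close>, so \<open>L\<close> is 0. The weak limit is
  itself a minimizing solution, so the existence of one is a by-product.\<close>

lemma exact_data_gap_null:
  assumes iter: "lagrangian_iteration \<Omega> K \<tau> p0 g u p" and adj: "is_adjoint \<Omega> K Kadj"
    and weak_compactness:
      "\<And>c w. (\<And>k. w k \<in> L2 \<Omega> \<and> ereal ((nrm \<Omega> (K (w k)))\<^sup>2) + TV \<Omega> (w k) \<le> ereal c)
         \<Longrightarrow> \<exists>r v. strict_mono (r :: nat \<Rightarrow> nat) \<and> weakly_converges \<Omega> (w \<circ> r) v"
    and attainable: "\<exists>v\<in>L2 \<Omega>. ae_eq \<Omega> (K v) g \<and> TV \<Omega> v < \<infinity>"
    and t: "filterlim (\<lambda>n. \<Sum>j = 1..n. \<tau> j) at_top sequentially"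
  obtains v c where "minimizing_solution \<Omega> (TV \<Omega>) K g v" "TV \<Omega> v = ereal c"
    "lagrangian_iteration.bregman_gap \<Omega> K u p c g \<longlonglongrightarrow> 0"
proof -
  interpret lagrangian_iteration \<Omega> K \<tau> p0 g u p
    by (rule iter)
  note dom = open_domain bounded_domain
  obtain z0 c0 where z0: "z0 \<in> L2 \<Omega>" "ae_eq \<Omega> (K z0) g" "TV \<Omega> z0 = ereal c0"
    using attainable TV_finite_real[OF dom] by metis
  have gg: "nrm \<Omega> (\<lambda>x. g x - g x) \<le> 0"
    by (simp add: nrm_def ip_def)
  define a where "a j = \<tau> j * (nrm \<Omega> (residual j))\<^sup>2" for j
  have a_nonneg: "0 \<le> a j" if "j \<ge> 1" for j
    using \<tau>_pos[OF that] by (simp add: a_def)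
  \<comment> \<open>\<open>a 1\<close> stands apart: no gap estimate covers the first step, since
    \<open>p0\<close> need not give a subgradient.\<close>
  have a_sum: "(\<Sum>j = 1..n. a j) \<le> a 1 + bregman_gap c0 g 1" for n
  proof (cases "n \<ge> 1")
    case True
    then have "(\<Sum>j\<in>{1<..n}. a j) \<le> bregman_gap c0 g 1"
      using gap_sum_le[OF order_refl True h_L2 gg, of 0 c0] gap_nonneg[OF True z0(1) _ z0(2) h_L2, of c0] z0(3)
      by (simp add: a_def)
    moreover have "{1..n} = insert 1 {1<..n}"
      using True by auto
    ultimately show ?thesis
      by simp
  next
    case False
    then show ?thesis
      using a_nonneg[of 1] gap_nonneg[OF order_refl z0(1) _ z0(2) h_L2, of c0] z0(3) by simp
  qed
  have decay: "(\<lambda>n. (\<Sum>j = 1..n. \<tau> j) * (nrm \<Omega> (residual n))\<^sup>2) \<longlonglongrightarrow> 0"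
    using a_sum[unfolded a_def] residual_antimono
    by (intro antimono_weighted_bounded_imp_null[OF \<tau>_pos t]) (auto intro: power_mono)
  have pr: "(\<lambda>n. nrm \<Omega> (p n) * nrm \<Omega> (residual n)) \<longlonglongrightarrow> 0"
  proof (rule sqrt_growth_times_null[OF t decay])
    have "nrm \<Omega> (p n) \<le> nrm \<Omega> (p 0) + sqrt (a 1 + bregman_gap c0 g 1) * sqrt (\<Sum>j = 1..n. \<tau> j)" for n
    proof -
      have "sqrt (\<Sum>j = 1..n. \<tau> j) * sqrt (\<Sum>j = 1..n. a j) \<le> sqrt (\<Sum>j = 1..n. \<tau> j) * sqrt (a 1 + bregman_gap c0 g 1)"
        using a_sum \<tau>_pos by (intro mult_left_mono) (auto intro!: sum_nonneg simp: less_imp_le)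
      then show ?thesis
        using nrm_p_le[of n] by (simp add: a_def mult.commute)
    qed
    then show "\<forall>\<^sub>F n in sequentially. 0 \<le> nrm \<Omega> (p n) \<and>
        nrm \<Omega> (p n) \<le> nrm \<Omega> (p 0) + sqrt (a 1 + bregman_gap c0 g 1) * sqrt (\<Sum>j = 1..n. \<tau> j)"
      by simp
  qed simp
  \<comment> \<open>This is the part of the gap that is not a difference of total variations. The
    shift to \<open>Suc n\<close> below skips index 0, where no optimality condition holds.\<close>
  define \<epsilon> where "\<epsilon> n = ip \<Omega> (p n) (residual n)" for n
  have \<epsilon>_Suc: "(\<lambda>n. \<epsilon> (Suc n)) \<longlonglongrightarrow> 0"
  proof (rule Lim_null_comparison)
    show "\<forall>\<^sub>F n in sequentially. norm (\<epsilon> (Suc n)) \<le> nrm \<Omega> (p (Suc n)) * nrm \<Omega> (residual (Suc n))"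
      using ip_Cauchy_Schwarz by (intro always_eventually) (simp add: \<epsilon>_def)
    show "(\<lambda>n. nrm \<Omega> (p (Suc n)) * nrm \<Omega> (residual (Suc n))) \<longlonglongrightarrow> 0"
      using LIMSEQ_Suc[OF pr] .
  qed
  have gap_eq: "bregman_gap c g n = c - J n + \<epsilon> n" if "n \<ge> 1" for c n
    using that h_L2 unfolding bregman_gap_def \<epsilon>_def residual_def by (simp add: ip_diff_right)
  have J_le: "J (Suc n) \<le> c + \<epsilon> (Suc n)" if "z \<in> L2 \<Omega>" "TV \<Omega> z \<le> ereal c" "ae_eq \<Omega> (K z) g" for z c n
    using gap_nonneg[of "Suc n" z c g] that gap_eq[of "Suc n" c] h_L2 by simp
  have residual_null: "(\<lambda>n. nrm \<Omega> (residual (Suc n))) \<longlonglongrightarrow> 0"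
  proof -
    have "(\<lambda>n. 1 * nrm \<Omega> (residual n)) \<longlonglongrightarrow> 0"
      by (rule sqrt_growth_times_null[OF t decay, where A = 1 and B = 0]) auto
    then show ?thesis
      using LIMSEQ_Suc by fastforce
  qed
  obtain E where E: "\<And>n. \<epsilon> (Suc n) \<le> E"
    using LIMSEQ_imp_bounded_above[OF \<epsilon>_Suc] by blast
  have "\<exists>r v. strict_mono (r :: nat \<Rightarrow> nat) \<and> weakly_converges \<Omega> ((\<lambda>n. u (Suc n)) \<circ> r) v"
  proof (rule weak_compactness)
    fix n
    have "nrm \<Omega> (K (u (Suc n))) \<le> nrm \<Omega> (residual (Suc n)) + nrm \<Omega> g"
      using nrm_triangle[of "residual (Suc n)" \<Omega> g] h_L2 by (simp add: residual_def)
    also have "\<dots> \<le> nrm \<Omega> (residual 1) + nrm \<Omega> g"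
      using residual_antimono[of 1 "Suc n"] by simp
    finally have "(nrm \<Omega> (K (u (Suc n))))\<^sup>2 \<le> (nrm \<Omega> (residual 1) + nrm \<Omega> g)\<^sup>2"
      by (intro power_mono) auto
    then have "(nrm \<Omega> (K (u (Suc n))))\<^sup>2 + J (Suc n) \<le> (nrm \<Omega> (residual 1) + nrm \<Omega> g)\<^sup>2 + (c0 + E)"
      using J_le[OF z0(1) _ z0(2), of c0 n] E[of n] z0(3) by (intro add_mono) auto
    then show "u (Suc n) \<in> L2 \<Omega> \<and> ereal ((nrm \<Omega> (K (u (Suc n))))\<^sup>2) + TV \<Omega> (u (Suc n))
        \<le> ereal ((nrm \<Omega> (residual 1) + nrm \<Omega> g)\<^sup>2 + (c0 + E))"
      by (simp add: TV_u)
  qed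
  then obtain r v where r: "strict_mono (r :: nat \<Rightarrow> nat)"
    and w: "weakly_converges \<Omega> (\<lambda>n. u (Suc (r n))) v"
    by (auto simp: o_def)
  have v: "v \<in> L2 \<Omega>"
    using w by (simp add: weakly_converges_def)
  have sub: "(\<lambda>n. s (r n)) \<longlonglongrightarrow> l" if "s \<longlonglongrightarrow> l" for s and l :: real
    using LIMSEQ_subseq_LIMSEQ[OF that r] by (simp add: o_def)
  have Kv: "ae_eq \<Omega> (K v) g"
    using weak_limit_solves[OF bounded_K adj h_L2 w] sub[OF residual_null] by (simp add: residual_def)
  have min: "TV \<Omega> v \<le> TV \<Omega> z" if z: "z \<in> L2 \<Omega>" "ae_eq \<Omega> (K z) g" for z
  proof (cases "TV \<Omega> z < \<infinity>")
    case True
    then obtain c where c: "TV \<Omega> z = ereal c"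
      using TV_finite_real[OF dom z(1)] by metis
    have "(\<lambda>n. c + \<epsilon> (Suc (r n))) \<longlonglongrightarrow> c + 0"
      using sub[OF \<epsilon>_Suc] by (intro tendsto_intros)
    then have "TV \<Omega> v \<le> ereal (c + 0)"
      using J_le[OF z(1) _ z(2)] c by (intro TV_weakly_lsc[OF dom w, of "\<lambda>n. c + \<epsilon> (Suc (r n))"]) (auto simp: TV_u)
    then show ?thesis
      by (simp add: c)
  qed simp
  obtain c where c: "TV \<Omega> v = ereal c"
    using min[OF z0(1,2)] z0(3) TV_nonneg[OF dom v] by (cases "TV \<Omega> v") auto
  have gap_pos: "0 \<le> bregman_gap c g (Suc n)" for n
    using gap_nonneg[OF _ v _ Kv h_L2, of "Suc n" c] c by simp
  have "decseq (\<lambda>n. bregman_gap c g (Suc n))"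
  proof (rule decseq_SucI)
    fix n
    show "bregman_gap c g (Suc (Suc n)) \<le> bregman_gap c g (Suc n)"
    proof -
      have "\<tau> (Suc (Suc n)) * (nrm \<Omega> (residual (Suc (Suc n))) * (0 - nrm \<Omega> (residual (Suc (Suc n))))) \<le> 0"
        using \<tau>_pos[of "Suc (Suc n)"] by (intro mult_nonneg_nonpos) auto
      then show ?thesis
        using gap_Suc[OF _ h_L2 gg, of "Suc n" c] by linarith
    qed
  qed
  then obtain L where L: "(\<lambda>n. bregman_gap c g (Suc n)) \<longlonglongrightarrow> L"
    using decseq_convergent[of _ 0] gap_pos by metis
  have "(\<lambda>n. c - bregman_gap c g (Suc (r n)) + \<epsilon> (Suc (r n))) \<longlonglongrightarrow> c - L + 0"
    using sub[OF L] sub[OF \<epsilon>_Suc] by (intro tendsto_intros)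
  then have "TV \<Omega> v \<le> ereal (c - L + 0)"
    by (intro TV_weakly_lsc[OF dom w]) (auto simp: TV_u gap_eq)
  then have "L \<le> 0"
    by (simp add: c)
  moreover have "0 \<le> L"
    using L gap_pos by (intro LIMSEQ_le_const) auto
  ultimately have "bregman_gap c g \<longlonglongrightarrow> 0"
    using L LIMSEQ_imp_Suc by (metis order_antisym)
  moreover have "minimizing_solution \<Omega> (TV \<Omega>) K g v"
    using v Kv min by (auto simp: minimizing_solution_def is_arg_min_def not_less)
  ultimately show ?thesis
    using that c by blast
qed

section \<open>Morozov's discrepancy principle\<close>

text \<open>Nothing is uniform in \<open>m\<close>: a good \<open>m\<close> is picked by means of
  \<open>l\<close>, and then \<open>k\<close> tends to infinity with this \<open>m\<close> fixed.
  Below, \<open>m\<close> is the step at which noisy and exact runs are compared.\<close>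

lemma null_by_double_limit:
  fixes a :: "nat \<Rightarrow> real" and l :: "nat \<Rightarrow> real"
  assumes a: "\<And>k. 0 \<le> a k" and le: "\<And>m. 1 \<le> m \<Longrightarrow> \<forall>\<^sub>F k in sequentially. a k \<le> b m k"
    and b: "\<And>m. 1 \<le> m \<Longrightarrow> b m \<longlonglongrightarrow> l m" and l: "l \<longlonglongrightarrow> 0"
  shows "a \<longlonglongrightarrow> 0"
proof (rule order_tendstoI)
  fix \<epsilon> :: real assume "0 < \<epsilon>"
  then have "\<forall>\<^sub>F m in sequentially. l m < \<epsilon>"
    using order_tendstoD(2)[OF l] by simp
  then have "\<forall>\<^sub>F m in sequentially. 1 \<le> m \<and> l m < \<epsilon>"
    using eventually_ge_at_top[of "1::nat"] by eventually_elim simp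
  then obtain m where m: "1 \<le> m" "l m < \<epsilon>"
    by (auto simp: eventually_sequentially)
  have "\<forall>\<^sub>F k in sequentially. b m k < \<epsilon>"
    using order_tendstoD(2)[OF b[OF m(1)] m(2)] .
  with le[OF m(1)] show "\<forall>\<^sub>F k in sequentially. a k < \<epsilon>"
    by eventually_elim simp
next
  fix \<epsilon> :: real assume "\<epsilon> < 0"
  then show "\<forall>\<^sub>F k in sequentially. \<epsilon> < a k"
    using a by (intro always_eventually) (auto intro: less_le_trans)
qed

theorem proposition5p1:
  fixes \<Omega> :: "(real ^ 2) set"
    and K Kadj :: "(real ^ 2 \<Rightarrow> real) \<Rightarrow> (real ^ 2 \<Rightarrow> real)"
    and \<tau> t \<delta> :: "nat \<Rightarrow> real"
    and p0 g :: "real ^ 2 \<Rightarrow> real"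
    and gs u \<xi> :: "nat \<Rightarrow> (real ^ 2 \<Rightarrow> real)"
    and R Rs :: "nat \<Rightarrow> (real ^ 2 \<Rightarrow> real) \<Rightarrow> (real ^ 2 \<Rightarrow> real)"
    and \<rho> :: real
    and N :: "nat \<Rightarrow> nat"
  assumes "open \<Omega>" and "bounded \<Omega>"
    and "bounded_operator \<Omega> K" and "is_adjoint \<Omega> K Kadj"
    and weak_compactness:
      "\<And>(c::real) (w::nat \<Rightarrow> real ^ 2 \<Rightarrow> real). (\<And>k. w k \<in> L2 \<Omega> \<and> ereal ((nrm \<Omega> (K (w k)))\<^sup>2) + TV \<Omega> (w k) \<le> ereal c)
         \<Longrightarrow> \<exists>r v. strict_mono r \<and> weakly_converges \<Omega> (w \<circ> r) v"
    and "g \<in> L2 \<Omega>"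
    and attainable: "\<exists>v\<in>L2 \<Omega>. ae_eq \<Omega> (K v) g \<and> TV \<Omega> v < \<infinity>"
    and "\<And>n. n \<ge> 1 \<Longrightarrow> \<tau> n > 0"
    and "\<And>n. t n = (\<Sum>k = 1..n. \<tau> k)"
    and "filterlim t at_top sequentially"
    and "bdd_above (\<tau> ` {1..})"
    and "p0 \<in> L2 \<Omega>"
    and iterates: "\<And>h. h \<in> L2 \<Omega> \<Longrightarrow>
      augmented_lagrangian \<Omega> (TV \<Omega>) K \<tau> p0 h (\<lambda>n. R n h) (\<lambda>n. Rs n h)"
    and "\<rho> > 1"
    and "\<And>k. gs k \<in> L2 \<Omega>"
    and "\<And>k. \<delta> k > 0"
    and "\<And>k. nrm \<Omega> (\<lambda>x. g x - gs k x) \<le> \<delta> k"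
    and "\<delta> \<longlonglongrightarrow> 0"
    and "\<And>k. N k = morozov \<Omega> K R \<rho> (\<delta> k) (gs k)"
    and "filterlim N at_top sequentially"
    and "\<And>k. u k = R (N k) (gs k)"
    and "\<And>k. \<xi> k = Kadj (Rs (N k) (gs k))"
  shows "(\<forall>k. \<xi> k \<in> subdifferential \<Omega> (TV \<Omega>) (u k))
    \<and> (\<forall>ud. minimizing_solution \<Omega> (TV \<Omega>) K g ud \<longrightarrow>
          (\<lambda>k. TV \<Omega> (u k)) \<longlonglongrightarrow> TV \<Omega> ud
        \<and> (\<lambda>k. bregman \<Omega> (TV \<Omega>) (\<xi> k) ud (u k)) \<longlonglongrightarrow> 0)
    \<and> (\<lambda>k. nrm \<Omega> (\<lambda>x. K (u k) x - g x)) \<in> O(\<lambda>k. t (N k) powr (- 1 / 2))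
    \<and> (\<exists>r v. strict_mono r \<and> minimizing_solution \<Omega> (TV \<Omega>) K g v
          \<and> strictly_converges \<Omega> (u \<circ> r) v)"
proof -
  note dom = assms(1,2) and K = assms(3) and adj = assms(4) and g = assms(6)
    and \<tau>_pos = assms(8) and t_eq = assms(9) and t_top = assms(10) and p0 = assms(12)
    and \<rho> = assms(14) and gs = assms(15) and \<delta>_pos = assms(16) and noise = assms(17)
    and \<delta>_null = assms(18) and N_top = assms(20)
  have iter: "lagrangian_iteration \<Omega> K \<tau> p0 h (\<lambda>n. R n h) (\<lambda>n. Rs n h)" if "h \<in> L2 \<Omega>" for h
    using dom K \<tau>_pos p0 that attainable iterates[OF that] by unfold_locales auto
  have K_L2: "K v \<in> L2 \<Omega>" if "v \<in> L2 \<Omega>" for v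
    using K that by (simp add: bounded_operator_def)
  have t_top': "filterlim (\<lambda>n. \<Sum>j = 1..n. \<tau> j) at_top sequentially"
    using t_top by (simp add: t_eq[abs_def])

  \<comment> \<open>Noisy runs against the exact run: Bregman gaps at a fixed step\<close>
  define res where "res k n = nrm \<Omega> (lagrangian_iteration.residual K (gs k) (\<lambda>n. R n (gs k)) n)" for k n
  define res0 where "res0 n = nrm \<Omega> (lagrangian_iteration.residual K g (\<lambda>n. R n g) n)" for n
  define J where "J k n = lagrangian_iteration.J \<Omega> (\<lambda>n. R n (gs k)) n" for k n
  obtain v0 c where v0: "minimizing_solution \<Omega> (TV \<Omega>) K g v0" "TV \<Omega> v0 = ereal c"
    and gap0: "lagrangian_iteration.bregman_gap \<Omega> K (\<lambda>n. R n g) (\<lambda>n. Rs n g) c g \<longlonglongrightarrow> 0"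
    by (rule exact_data_gap_null[OF iter[OF g] adj weak_compactness attainable t_top'])
  define G0 where "G0 = lagrangian_iteration.bregman_gap \<Omega> K (\<lambda>n. R n g) (\<lambda>n. Rs n g) c g"
  define G where "G k = lagrangian_iteration.bregman_gap \<Omega> K (\<lambda>n. R n (gs k)) (\<lambda>n. Rs n (gs k)) c g" for k
  have v0_sol: "v0 \<in> L2 \<Omega>" "ae_eq \<Omega> (K v0) g"
    and min: "\<And>z. z \<in> L2 \<Omega> \<Longrightarrow> ae_eq \<Omega> (K z) g \<Longrightarrow> ereal c \<le> TV \<Omega> z"
    using v0 by (auto simp: minimizing_solution_def is_arg_min_def not_less)
  \<comment> \<open>Before the stopping index the noise level is at most \<open>q\<close> times the
    residual; \<open>\<rho> > 1\<close> makes \<open>1 - q\<close> positive.\<close>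
  define q where "q = 1 / \<rho>"
  have q: "0 < 1 - q" "q * \<rho> = 1"
    using \<rho> by (auto simp: q_def field_simps)
  \<comment> \<open>The bound from \<open>gap_le\<close> for the noisy gap at step \<open>m\<close>;
    for fixed \<open>m\<close> it tends to the exact gap \<open>G0 m\<close>.\<close>
  define U where "U m k = G0 m + (res0 m + 2 * (t m * \<delta> k) / \<tau> m + \<delta> k) * (t m * \<delta> k)" for m k
  have two: "two_lagrangian_iterations \<Omega> K \<tau> p0 (gs k) (\<lambda>n. R n (gs k)) (\<lambda>n. Rs n (gs k)) g
      (\<lambda>n. R n g) (\<lambda>n. Rs n g) (\<delta> k)" for k
    using iter[OF g] iter[OF gs[of k]] noise[of k] nrm_minus_commute[of \<Omega> g "gs k"]
    by (simp add: two_lagrangian_iterations_def two_lagrangian_iterations_axioms_def)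
  have G_nonneg: "0 \<le> G k n" if "n \<ge> 1" for k n
    using lagrangian_iteration.gap_nonneg[OF iter[OF gs[of k]] that v0_sol(1) _ v0_sol(2) g, of c] v0(2)
    by (simp add: G_def)
  have G_le_U: "G k m \<le> U m k" if "m \<ge> 1" for k m
    using two_lagrangian_iterations.gap_le[OF two that, of k c]
    by (simp add: G_def U_def G0_def res0_def t_eq)
  have U_lim: "U m \<longlonglongrightarrow> G0 m" for m
  proof -
    have "(\<lambda>k. G0 m + (res0 m + 2 * (t m * \<delta> k) / \<tau> m + \<delta> k) * (t m * \<delta> k))
        \<longlonglongrightarrow> G0 m + (res0 m + 2 * (t m * 0) / \<tau> m + 0) * (t m * 0)"
      unfolding divide_inverse by (intro tendsto_intros \<delta>_null)
    then show ?thesis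
      by (simp add: U_def[abs_def])
  qed
  have G_sum: "G k n + (1 - q) * (\<Sum>j\<in>{m<..n}. \<tau> j * (res k j)\<^sup>2) \<le> G k m"
    if "1 \<le> m" "m \<le> n" "\<And>j. m < j \<Longrightarrow> j \<le> n \<Longrightarrow> \<rho> * \<delta> k \<le> res k j" for k m n
  proof -
    have "\<delta> k \<le> q * res k j" if "\<rho> * \<delta> k \<le> res k j" for j
      using mult_left_mono[OF that, of q] q \<rho> by (simp add: q_def flip: mult.assoc)
    then show ?thesis
      using lagrangian_iteration.gap_sum_le[OF iter[OF gs[of k]] that(1,2) g noise, of q c] that(3)
      by (simp add: G_def res_def)
  qed
  have t_diff: "t n - t m = (\<Sum>j\<in>{m<..n}. \<tau> j)" if "m \<le> n" for m n
  proof -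
    have "{1..n} = {1..m} \<union> {m<..n}" "{1..m} \<inter> {m<..n} = {}"
      using that by auto
    then show ?thesis
      by (simp add: t_eq sum.union_disjoint)
  qed
  \<comment> \<open>Each step before stopping lowers the gap by at least
    \<open>(1 - q) * \<tau> j * (\<rho> * \<delta> k)\<^sup>2\<close>, and the gap stays
    nonnegative.\<close>
  have G_tail: "(1 - q) * \<rho>\<^sup>2 * ((\<delta> k)\<^sup>2 * (t n - t m)) \<le> G k m"
    if mn: "1 \<le> m" "m \<le> n" "\<And>j. m < j \<Longrightarrow> j \<le> n \<Longrightarrow> \<rho> * \<delta> k \<le> res k j" for k m n
  proof -
    have "\<rho>\<^sup>2 * ((\<delta> k)\<^sup>2 * (t n - t m)) = (\<Sum>j\<in>{m<..n}. \<tau> j * (\<rho> * \<delta> k)\<^sup>2)"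
      by (simp add: t_diff[OF mn(2)] power_mult_distrib mult_ac sum_distrib_left sum_distrib_right)
    also have "\<dots> \<le> (\<Sum>j\<in>{m<..n}. \<tau> j * (res k j)\<^sup>2)"
      using mn \<rho> \<delta>_pos[of k] \<tau>_pos by (intro sum_mono mult_left_mono power_mono) (auto simp: less_imp_le)
    finally have "(1 - q) * (\<rho>\<^sup>2 * ((\<delta> k)\<^sup>2 * (t n - t m))) \<le> (1 - q) * (\<Sum>j\<in>{m<..n}. \<tau> j * (res k j)\<^sup>2)"
      using q by (intro mult_left_mono) auto
    moreover have "0 \<le> G k n"
      using G_nonneg mn by simp
    ultimately show ?thesis
      using G_sum[OF mn] by (simp add: mult.assoc)
  qed

  \<comment> \<open>The stopping index\<close>
  have stop_ex: "\<exists>n. n \<ge> 1 \<and> res k n < \<rho> * \<delta> k" for k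
  proof (rule ccontr)
    assume "\<not> ?thesis"
    then have large: "\<And>j. 1 \<le> j \<Longrightarrow> \<rho> * \<delta> k \<le> res k j"
      by (meson not_less)
    have pos: "0 < (1 - q) * \<rho>\<^sup>2 * (\<delta> k)\<^sup>2"
      using q \<rho> \<delta>_pos[of k] by simp
    obtain n where n: "1 \<le> n" "t 1 + G k 1 / ((1 - q) * \<rho>\<^sup>2 * (\<delta> k)\<^sup>2) < t n"
    proof -
      have "\<forall>\<^sub>F n in sequentially. t 1 + G k 1 / ((1 - q) * \<rho>\<^sup>2 * (\<delta> k)\<^sup>2) < t n"
        using t_top by (simp add: filterlim_at_top_dense)
      then have "\<forall>\<^sub>F n in sequentially. 1 \<le> n \<and> t 1 + G k 1 / ((1 - q) * \<rho>\<^sup>2 * (\<delta> k)\<^sup>2) < t n"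
        using eventually_ge_at_top[of "1::nat"] by eventually_elim simp
      then show ?thesis
        using that by (auto simp: eventually_sequentially)
    qed
    have "(1 - q) * \<rho>\<^sup>2 * (\<delta> k)\<^sup>2 * (t n - t 1) \<le> G k 1"
      using G_tail[OF order_refl n(1), of k] large by (simp add: mult.assoc)
    moreover have "G k 1 < (1 - q) * \<rho>\<^sup>2 * (\<delta> k)\<^sup>2 * (t n - t 1)"
    proof -
      have "G k 1 / ((1 - q) * \<rho>\<^sup>2 * (\<delta> k)\<^sup>2) < t n - t 1"
        using n(2) by linarith
      then show ?thesis
        by (simp only: pos_divide_less_eq[OF pos] mult.commute[of _ "t n - t 1"])
    qed
    ultimately show False
      by linarith
  qed
  have N_eq: "N k = (LEAST n. n \<ge> 1 \<and> res k n < \<rho> * \<delta> k)" for k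
    using assms(19) by (simp add: morozov_def res_def lagrangian_iteration.residual_def[OF iter[OF gs]])
  have N_ge: "1 \<le> N k" and stop: "res k (N k) < \<rho> * \<delta> k" for k
    using LeastI_ex[OF stop_ex[of k]] by (auto simp: N_eq)
  have before: "\<rho> * \<delta> k \<le> res k j" if "1 \<le> j" "j < N k" for k j
    using not_less_Least[of j "\<lambda>n. n \<ge> 1 \<and> res k n < \<rho> * \<delta> k"] that by (simp add: N_eq)
  obtain \<tau>m where \<tau>m: "\<And>n. n \<ge> 1 \<Longrightarrow> \<tau> n \<le> \<tau>m"
    using assms(11) by (auto simp: bdd_above_def)
  have \<tau>m_pos: "0 < \<tau>m"
    using \<tau>m[of 1] \<tau>_pos[of 1] by simp
  \<comment> \<open>The lower bound \<open>before\<close> ends just below \<open>N k\<close>, so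
    \<open>N k\<close> is written as \<open>Suc n\<close> and the monotone estimates run up to
    \<open>n\<close>.\<close>
  have N_late: "\<forall>\<^sub>F k in sequentially. \<exists>n. N k = Suc n \<and> m \<le> n" for m
  proof -
    have "\<forall>\<^sub>F k in sequentially. Suc m \<le> N k"
      using N_top by (simp add: filterlim_at_top)
    then show ?thesis
      by eventually_elim (auto simp: Suc_le_eq gr0_conv_Suc dest: less_imp_Suc_add)
  qed

  \<comment> \<open>Bregman gap and total step length at the stopping index\<close>
  have G_null: "(\<lambda>k. G k (N k)) \<longlonglongrightarrow> 0"
  proof (rule null_by_double_limit)
    show "0 \<le> G k (N k)" for k
      using G_nonneg N_ge .
    \<comment> \<open>From \<open>m\<close> to \<open>n\<close> the gap decreases. The last step may
      raise it, but by at most \<open>\<tau>m * \<rho>\<close> times the squared noise level, since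
      the residual there is below \<open>\<rho> * \<delta> k\<close>.\<close>
    show "\<forall>\<^sub>F k in sequentially. G k (N k) \<le> U m k + \<tau>m * (\<rho> * \<delta> k * \<delta> k)" if m: "1 \<le> m" for m
      using N_late[of m]
    proof eventually_elim
      case (elim k)
      then obtain n where n: "N k = Suc n" "m \<le> n"
        by blast
      have "0 \<le> (\<Sum>j\<in>{m<..n}. \<tau> j * (res k j)\<^sup>2)"
        using \<tau>_pos by (intro sum_nonneg mult_nonneg_nonneg) (auto simp: less_imp_le)
      then have "0 \<le> (1 - q) * (\<Sum>j\<in>{m<..n}. \<tau> j * (res k j)\<^sup>2)"
        using q by simp
      then have "G k n \<le> G k m"
        using G_sum[OF m n(2), of k] before[of _ k] m n(1) by fastforce
      moreover have "G k (Suc n) \<le> G k n + \<tau> (Suc n) * (res k (Suc n) * (\<delta> k - res k (Suc n)))"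
        using lagrangian_iteration.gap_Suc[OF iter[OF gs[of k]] _ g noise, of n c] m n(2)
        by (simp add: G_def res_def)
      moreover have "\<tau> (Suc n) * (res k (Suc n) * (\<delta> k - res k (Suc n))) \<le> \<tau>m * (\<rho> * \<delta> k * \<delta> k)"
      proof -
        have "res k (Suc n) * (\<delta> k - res k (Suc n)) \<le> res k (Suc n) * \<delta> k"
          by (intro mult_left_mono) (auto simp: res_def)
        also have "\<dots> \<le> \<rho> * \<delta> k * \<delta> k"
          using stop[of k] n(1) \<delta>_pos[of k] by (intro mult_right_mono) auto
        finally have "\<tau> (Suc n) * (res k (Suc n) * (\<delta> k - res k (Suc n))) \<le> \<tau> (Suc n) * (\<rho> * \<delta> k * \<delta> k)"
          by (rule mult_left_mono) (simp add: \<tau>_pos less_imp_le)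
        also have "\<dots> \<le> \<tau>m * (\<rho> * \<delta> k * \<delta> k)"
          using \<tau>m[of "Suc n"] \<rho> \<delta>_pos[of k] by (intro mult_right_mono) auto
        finally show ?thesis .
      qed
      ultimately show ?case
        using G_le_U[OF m, of k] n(1) by simp
    qed
    show "(\<lambda>k. U m k + \<tau>m * (\<rho> * \<delta> k * \<delta> k)) \<longlonglongrightarrow> G0 m" for m
    proof -
      have "(\<lambda>k. U m k + \<tau>m * (\<rho> * \<delta> k * \<delta> k)) \<longlonglongrightarrow> G0 m + \<tau>m * (\<rho> * 0 * 0)"
        by (intro tendsto_intros U_lim \<delta>_null)
      then show ?thesis by simp
    qed
    show "G0 \<longlonglongrightarrow> 0"
      using gap0 by (simp add: G0_def)
  qed
  have \<delta>t_null: "(\<lambda>k. t (N k) * (\<delta> k)\<^sup>2) \<longlonglongrightarrow> 0"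
  proof (rule null_by_double_limit)
    show "0 \<le> t (N k) * (\<delta> k)\<^sup>2" for k
      unfolding t_eq using \<tau>_pos by (intro mult_nonneg_nonneg sum_nonneg) (auto simp: less_imp_le)
    \<comment> \<open>The stretch from \<open>m\<close> to \<open>n\<close> is paid for by the gap
      at \<open>m\<close>; what remains of \<open>t (N k)\<close> is
      \<open>t m + \<tau> (Suc n)\<close>, bounded for fixed \<open>m\<close>.\<close>
    show "\<forall>\<^sub>F k in sequentially. t (N k) * (\<delta> k)\<^sup>2
        \<le> U m k / ((1 - q) * \<rho>\<^sup>2) + (t m + \<tau>m) * (\<delta> k)\<^sup>2" if m: "1 \<le> m" for m
      using N_late[of m]
    proof eventually_elim
      case (elim k)
      then obtain n where n: "N k = Suc n" "m \<le> n"
        by blast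
      have "(1 - q) * \<rho>\<^sup>2 * ((\<delta> k)\<^sup>2 * (t n - t m)) \<le> U m k"
        using G_tail[OF m n(2), of k] before[of _ k] m n(1) G_le_U[OF m, of k] by fastforce
      moreover have "0 < (1 - q) * \<rho>\<^sup>2"
        using q \<rho> by simp
      ultimately have "(\<delta> k)\<^sup>2 * (t n - t m) \<le> U m k / ((1 - q) * \<rho>\<^sup>2)"
        by (simp only: pos_le_divide_eq mult.commute[of "(1 - q) * \<rho>\<^sup>2"])
      moreover have "t (N k) * (\<delta> k)\<^sup>2 = (\<delta> k)\<^sup>2 * (t n - t m) + (t m + \<tau> (Suc n)) * (\<delta> k)\<^sup>2"
        by (simp add: n(1) t_eq algebra_simps)
      moreover have "(t m + \<tau> (Suc n)) * (\<delta> k)\<^sup>2 \<le> (t m + \<tau>m) * (\<delta> k)\<^sup>2"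
        using \<tau>m[of "Suc n"] by (intro mult_right_mono) auto
      ultimately show ?case
        by linarith
    qed
    show "(\<lambda>k. U m k / ((1 - q) * \<rho>\<^sup>2) + (t m + \<tau>m) * (\<delta> k)\<^sup>2) \<longlonglongrightarrow> G0 m / ((1 - q) * \<rho>\<^sup>2)" for m
    proof -
      have "(\<lambda>k. U m k / ((1 - q) * \<rho>\<^sup>2) + (t m + \<tau>m) * (\<delta> k)\<^sup>2)
          \<longlonglongrightarrow> G0 m / ((1 - q) * \<rho>\<^sup>2) + (t m + \<tau>m) * 0\<^sup>2"
        using q \<rho> by (intro tendsto_intros U_lim \<delta>_null) auto
      then show ?thesis by simp
    qed
    have "(\<lambda>m. G0 m / ((1 - q) * \<rho>\<^sup>2)) \<longlonglongrightarrow> 0 / ((1 - q) * \<rho>\<^sup>2)"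
      using gap0 q \<rho> unfolding G0_def by (intro tendsto_intros) auto
    then show "(\<lambda>m. G0 m / ((1 - q) * \<rho>\<^sup>2)) \<longlonglongrightarrow> 0"
      by simp
  qed

  \<comment> \<open>Growth of the multipliers and convergence of the total variation\<close>
  have u_L2: "u k \<in> L2 \<Omega>" and p_L2: "Rs n (gs k) \<in> L2 \<Omega>" for k n
    using lagrangian_iteration.u_L2[OF iter[OF gs[of k]] N_ge] lagrangian_iteration.p_L2[OF iter[OF gs[of k]]]
    by (simp_all add: assms(21))
  have TV_u: "TV \<Omega> (u k) = ereal (J k (N k))" for k
    using lagrangian_iteration.TV_u[OF iter[OF gs[of k]] N_ge] by (simp add: J_def assms(21))
  have K_err: "nrm \<Omega> (\<lambda>x. K (u k) x - g x) \<le> (\<rho> + 1) * \<delta> k" for k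
  proof -
    have "nrm \<Omega> (\<lambda>x. K (u k) x - g x) \<le> nrm \<Omega> (\<lambda>x. K (u k) x - gs k x) + nrm \<Omega> (\<lambda>x. gs k x - g x)"
      using nrm_triangle[of "\<lambda>x. K (u k) x - gs k x" \<Omega> "\<lambda>x. gs k x - g x"] K_L2[OF u_L2[of k]] gs g by simp
    moreover have "nrm \<Omega> (\<lambda>x. K (u k) x - gs k x) = res k (N k)"
      by (simp add: res_def lagrangian_iteration.residual_def[OF iter[OF gs]] assms(21))
    ultimately show ?thesis
      using stop[of k] noise[of k] nrm_minus_commute[of \<Omega> g "gs k"] by (simp add: distrib_right)
  qed
  \<comment> \<open>Bounds the weighted squared residuals up to \<open>N k\<close> in three pieces:
    step 1 by comparison with the exact run, as no gap estimate covers it; steps 2 to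
    \<open>n\<close> by the decrease of the gap; step \<open>N k\<close> by the stopping
    rule.\<close>
  define M where "M k = \<tau> 1 * (res0 1 + 2 * (t 1 * \<delta> k) / \<tau> 1)\<^sup>2 + U 1 k / (1 - q) + \<tau>m * (\<rho> * \<delta> k)\<^sup>2" for k
  have "M \<longlonglongrightarrow> \<tau> 1 * (res0 1 + 2 * (t 1 * 0) / \<tau> 1)\<^sup>2 + G0 1 / (1 - q) + \<tau>m * (\<rho> * 0)\<^sup>2"
    unfolding M_def using q \<tau>_pos[of 1] by (intro tendsto_intros U_lim \<delta>_null) auto
  then obtain B where B: "\<And>k. M k \<le> B"
    using LIMSEQ_imp_bounded_above by blast
  have p_bound: "\<forall>\<^sub>F k in sequentially. 0 \<le> nrm \<Omega> (Rs (N k) (gs k)) \<and>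
      nrm \<Omega> (Rs (N k) (gs k)) \<le> nrm \<Omega> p0 + sqrt B * sqrt (t (N k))"
    using N_late[of 1]
  proof eventually_elim
    case (elim k)
    then obtain n where n: "N k = Suc n" "1 \<le> n"
      by blast
    have "(1 - q) * (\<Sum>j\<in>{1<..n}. \<tau> j * (res k j)\<^sup>2) \<le> U 1 k"
      using G_sum[OF order_refl n(2), of k] before[of _ k] n(1) G_le_U[of 1 k] G_nonneg[OF n(2), of k]
      by fastforce
    then have mid: "(\<Sum>j\<in>{1<..n}. \<tau> j * (res k j)\<^sup>2) \<le> U 1 k / (1 - q)"
      using q by (simp add: field_simps)
    have "res k 1 \<le> res0 1 + 2 * (t 1 * \<delta> k) / \<tau> 1"
      using two_lagrangian_iterations.nrm_residual_le[OF two order_refl, of k]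
      by (simp add: res_def res0_def t_eq)
    then have "\<tau> 1 * (res k 1)\<^sup>2 \<le> \<tau> 1 * (res0 1 + 2 * (t 1 * \<delta> k) / \<tau> 1)\<^sup>2"
      using \<tau>_pos[of 1] by (intro mult_left_mono power_mono) (auto simp: res_def)
    moreover have "\<tau> (Suc n) * (res k (Suc n))\<^sup>2 \<le> \<tau>m * (\<rho> * \<delta> k)\<^sup>2"
      using \<tau>m[of "Suc n"] \<tau>m_pos stop[of k] n(1) by (intro mult_mono power_mono) (auto simp: res_def)
    moreover have "{1..Suc n} = insert 1 (insert (Suc n) {1<..n})"
      using n(2) by auto
    ultimately have "(\<Sum>j = 1..N k. \<tau> j * (res k j)\<^sup>2) \<le> B"
      using mid B[of k] n by (simp add: M_def)
    then have "sqrt (t (N k)) * sqrt (\<Sum>j = 1..N k. \<tau> j * (res k j)\<^sup>2) \<le> sqrt (t (N k)) * sqrt B"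
      unfolding t_eq using \<tau>_pos by (intro mult_left_mono) (auto intro!: sum_nonneg simp: less_imp_le)
    moreover have "nrm \<Omega> (Rs 0 (gs k)) = nrm \<Omega> p0"
      using iterates[OF gs[of k]] p0 by (intro nrm_ae_cong) (auto simp: augmented_lagrangian_def)
    ultimately show ?case
      using lagrangian_iteration.nrm_p_le[OF iter[OF gs[of k]], of "N k"]
      by (simp add: res_def t_eq mult.commute)
  qed
  have tN_top: "filterlim (\<lambda>k. t (N k)) at_top sequentially"
    using filterlim_compose[OF t_top N_top] .
  \<comment> \<open>The multipliers grow at most like \<open>sqrt (t (N k))\<close>, and by
    \<open>\<delta>t_null\<close> the noise level decays faster than the inverse of this
    root.\<close>
  have cross_null: "(\<lambda>k. ip \<Omega> (Rs (N k) (gs k)) (\<lambda>x. K (u k) x - g x)) \<longlonglongrightarrow> 0"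
  proof (rule Lim_null_comparison)
    have "(\<lambda>k. nrm \<Omega> (Rs (N k) (gs k)) * \<delta> k) \<longlonglongrightarrow> 0"
      using \<delta>_pos by (intro sqrt_growth_times_null[OF tN_top \<delta>t_null _ p_bound]) (simp add: less_imp_le)
    then show "(\<lambda>k. (\<rho> + 1) * (nrm \<Omega> (Rs (N k) (gs k)) * \<delta> k)) \<longlonglongrightarrow> 0"
      by (rule tendsto_mult_right_zero)
    show "\<forall>\<^sub>F k in sequentially. norm (ip \<Omega> (Rs (N k) (gs k)) (\<lambda>x. K (u k) x - g x))
        \<le> (\<rho> + 1) * (nrm \<Omega> (Rs (N k) (gs k)) * \<delta> k)"
    proof (intro always_eventually allI)
      fix k
      have "\<bar>ip \<Omega> (Rs (N k) (gs k)) (\<lambda>x. K (u k) x - g x)\<bar>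
          \<le> nrm \<Omega> (Rs (N k) (gs k)) * nrm \<Omega> (\<lambda>x. K (u k) x - g x)"
        using p_L2 K_L2[OF u_L2] g by (intro ip_Cauchy_Schwarz) auto
      also have "\<dots> \<le> nrm \<Omega> (Rs (N k) (gs k)) * ((\<rho> + 1) * \<delta> k)"
        using K_err by (intro mult_left_mono) auto
      finally show "norm (ip \<Omega> (Rs (N k) (gs k)) (\<lambda>x. K (u k) x - g x))
        \<le> (\<rho> + 1) * (nrm \<Omega> (Rs (N k) (gs k)) * \<delta> k)"
        by (simp add: mult_ac)
    qed
  qed
  have G_eq: "G k (N k) = c - J k (N k) - ip \<Omega> (Rs (N k) (gs k)) g + ip \<Omega> (Rs (N k) (gs k)) (K (u k))" for k
    by (simp add: G_def J_def lagrangian_iteration.bregman_gap_def[OF iter[OF gs]] assms(21))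
  \<comment> \<open>The gap is \<open>c - J k (N k)\<close> plus the cross term, and both the gap
    and the cross term vanish.\<close>
  have J_lim: "(\<lambda>k. J k (N k)) \<longlonglongrightarrow> c"
  proof -
    have "(\<lambda>k. c - G k (N k) + ip \<Omega> (Rs (N k) (gs k)) (\<lambda>x. K (u k) x - g x)) \<longlonglongrightarrow> c - 0 + 0"
      by (intro tendsto_intros G_null cross_null)
    moreover have "c - G k (N k) + ip \<Omega> (Rs (N k) (gs k)) (\<lambda>x. K (u k) x - g x) = J k (N k)" for k
      using p_L2 K_L2[OF u_L2] g by (simp add: G_eq ip_diff_right)
    ultimately show ?thesis
      by simp
  qed

  \<comment> \<open>Subgradients and Bregman distances for an arbitrary minimizing solution\<close>
  have ip_\<xi>: "ip \<Omega> (\<xi> k) v = ip \<Omega> (Rs (N k) (gs k)) (K v)" if "v \<in> L2 \<Omega>" for k v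
    using adj p_L2 that
    by (simp add: is_adjoint_def assms(22) ip_commute[of \<Omega> "Kadj _"] ip_commute[of \<Omega> "Rs _ _"])
  have \<xi>_L2: "\<xi> k \<in> L2 \<Omega>" for k
    using adj p_L2 by (simp add: is_adjoint_def assms(22))
  have subdiff: "\<xi> k \<in> subdifferential \<Omega> (TV \<Omega>) (u k)" for k
  proof -
    have "TV \<Omega> (u k) + ereal (ip \<Omega> (\<xi> k) (\<lambda>x. v x - u k x)) \<le> TV \<Omega> v" if v: "v \<in> L2 \<Omega>" for v
    proof (cases "TV \<Omega> v < \<infinity>")
      case True
      then obtain b where b: "TV \<Omega> v = ereal b"
        using TV_finite_real[OF dom v] by metis
      then show ?thesis
        unfolding TV_u
        using lagrangian_iteration.subgradient[OF iter[OF gs[of k]] N_ge v, of b k] v u_L2 \<xi>_L2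
        by (simp add: J_def ip_diff_right ip_\<xi> assms(21))
    qed simp
    then show ?thesis
      using \<xi>_L2 u_L2 TV_u by (simp add: subdifferential_def)
  qed
  \<comment> \<open>All minimizing solutions share the value \<open>c\<close> and are mapped to
    \<open>g\<close> almost everywhere, so each Bregman distance equals the same gap.\<close>
  have lim: "(\<lambda>k. TV \<Omega> (u k)) \<longlonglongrightarrow> TV \<Omega> ud \<and> (\<lambda>k. bregman \<Omega> (TV \<Omega>) (\<xi> k) ud (u k)) \<longlonglongrightarrow> 0"
    if ud: "minimizing_solution \<Omega> (TV \<Omega>) K g ud" for ud
  proof -
    have ud_sol: "ud \<in> L2 \<Omega>" "ae_eq \<Omega> (K ud) g" "TV \<Omega> ud \<le> TV \<Omega> v0"
      using ud v0_sol by (auto simp: minimizing_solution_def is_arg_min_def not_less)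
    then have TV_ud: "TV \<Omega> ud = ereal c"
      using min[OF ud_sol(1,2)] v0(2) by simp
    have "ip \<Omega> (Rs (N k) (gs k)) (K ud) = ip \<Omega> (Rs (N k) (gs k)) g" for k
      using ud_sol K_L2 p_L2 g by (intro ip_ae_cong_right) auto
    then have "bregman \<Omega> (TV \<Omega>) (\<xi> k) ud (u k) = ereal (G k (N k))" for k
      using \<xi>_L2 ud_sol(1) u_L2 by (simp add: bregman_def TV_ud TV_u ip_diff_right ip_\<xi> G_eq)
    then show ?thesis
      using J_lim G_null by (simp add: TV_ud TV_u zero_ereal_def)
  qed

  \<comment> \<open>Rate of the residual\<close>
  have bigo: "(\<lambda>k. nrm \<Omega> (\<lambda>x. K (u k) x - g x)) \<in> O(\<lambda>k. t (N k) powr (- 1 / 2))"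
  proof (rule landau_o.bigI)
    show "0 < \<rho> + 1"
      using \<rho> by simp
    \<comment> \<open>The threshold 1 puts \<open>\<delta> k\<close> below the required power of
      \<open>t (N k)\<close>; the constant \<open>\<rho> + 1\<close> comes from
      \<open>K_err\<close>.\<close>
    have "\<forall>\<^sub>F k in sequentially. t (N k) * (\<delta> k)\<^sup>2 < 1"
      using order_tendstoD(2)[OF \<delta>t_null] by simp
    moreover have "\<forall>\<^sub>F k in sequentially. 0 < t (N k)"
      using tN_top by (simp add: filterlim_at_top_dense)
    ultimately show "\<forall>\<^sub>F k in sequentially. norm (nrm \<Omega> (\<lambda>x. K (u k) x - g x))
        \<le> (\<rho> + 1) * norm (t (N k) powr (- 1 / 2))"
    proof eventually_elim
      case (elim k)
      have "sqrt (t (N k)) * \<delta> k = sqrt (t (N k) * (\<delta> k)\<^sup>2)"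
        using \<delta>_pos[of k] by (simp add: real_sqrt_mult)
      also have "\<dots> \<le> 1"
        using elim by simp
      finally have "\<delta> k \<le> 1 / sqrt (t (N k))"
        using elim by (simp add: field_simps)
      also have "\<dots> = t (N k) powr (- 1 / 2)"
        using elim by (simp add: powr_minus powr_half_sqrt inverse_eq_divide)
      finally have "(\<rho> + 1) * \<delta> k \<le> (\<rho> + 1) * t (N k) powr (- 1 / 2)"
        using \<rho> by (intro mult_left_mono) auto
      then show ?case
        using K_err[of k] by simp
    qed
  qed

  \<comment> \<open>Strict convergence of a subsequence\<close>
  have "\<exists>r v. strict_mono r \<and> weakly_converges \<Omega> (u \<circ> r) v"
  proof -
    obtain b where b: "\<And>k. J k (N k) \<le> b"
      using LIMSEQ_imp_bounded_above[OF J_lim] by blast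
    obtain e where e: "\<And>k. \<delta> k \<le> e"
      using LIMSEQ_imp_bounded_above[OF \<delta>_null] by blast
    show ?thesis
    proof (rule weak_compactness)
      fix k
      have "nrm \<Omega> (K (u k)) \<le> nrm \<Omega> (\<lambda>x. K (u k) x - g x) + nrm \<Omega> g"
        using nrm_triangle[of "\<lambda>x. K (u k) x - g x" \<Omega> g] K_L2[OF u_L2[of k]] g by simp
      also have "\<dots> \<le> (\<rho> + 1) * e + nrm \<Omega> g"
      proof -
        have "(\<rho> + 1) * \<delta> k \<le> (\<rho> + 1) * e"
          using e \<rho> by (intro mult_left_mono) auto
        then show ?thesis
          using K_err[of k] by linarith
      qed
      finally have "(nrm \<Omega> (K (u k)))\<^sup>2 + J k (N k) \<le> ((\<rho> + 1) * e + nrm \<Omega> g)\<^sup>2 + b"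
        using b[of k] by (intro add_mono power_mono) auto
      then show "u k \<in> L2 \<Omega> \<and> ereal ((nrm \<Omega> (K (u k)))\<^sup>2) + TV \<Omega> (u k)
          \<le> ereal (((\<rho> + 1) * e + nrm \<Omega> g)\<^sup>2 + b)"
        using u_L2 by (simp add: TV_u)
    qed
  qed
  then obtain r v where r: "strict_mono (r :: nat \<Rightarrow> nat)" and w: "weakly_converges \<Omega> (\<lambda>k. u (r k)) v"
    by (auto simp: o_def)
  have v: "v \<in> L2 \<Omega>"
    using w by (simp add: weakly_converges_def)
  have sub: "(\<lambda>n. s (r n)) \<longlonglongrightarrow> l" if "s \<longlonglongrightarrow> l" for s and l :: real
    using LIMSEQ_subseq_LIMSEQ[OF that r] by (simp add: o_def)
  have "(\<lambda>k. nrm \<Omega> (\<lambda>x. K (u k) x - g x)) \<longlonglongrightarrow> 0"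
  proof (rule Lim_null_comparison)
    show "\<forall>\<^sub>F k in sequentially. norm (nrm \<Omega> (\<lambda>x. K (u k) x - g x)) \<le> (\<rho> + 1) * \<delta> k"
      using K_err by simp
    show "(\<lambda>k. (\<rho> + 1) * \<delta> k) \<longlonglongrightarrow> 0"
      using \<delta>_null by (rule tendsto_mult_right_zero)
  qed
  from weak_limit_solves[OF K adj g w sub[OF this]] have Kv: "ae_eq \<Omega> (K v) g" .
  \<comment> \<open>Lower semicontinuity from above and minimality from below give the weak limit
    exactly the limiting total variation, which is what strict convergence asks beyond convergence
    in the mean.\<close>
  have "TV \<Omega> v \<le> ereal c"
    using TV_weakly_lsc[OF dom w _ sub[OF J_lim]] by (simp add: TV_u)
  then have TV_v: "TV \<Omega> v = ereal c"
    using min[OF v Kv] by simp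
  have "minimizing_solution \<Omega> (TV \<Omega>) K g v"
    using v Kv min TV_v by (auto simp: minimizing_solution_def is_arg_min_def not_less)
  moreover have "strictly_converges \<Omega> (u \<circ> r) v"
  proof -
    obtain b where b: "\<And>k. J k (N k) \<le> b"
      using LIMSEQ_imp_bounded_above[OF J_lim] by blast
    have "(\<lambda>k. L1_nrm \<Omega> (\<lambda>x. u (r k) x - v x)) \<longlonglongrightarrow> 0"
      using b by (intro weakly_converges_TV_bounded_imp_L1[OF dom w, of b]) (simp add: TV_u)
    moreover have "(\<lambda>k. \<bar>J (r k) (N (r k)) - c\<bar>) \<longlonglongrightarrow> 0"
      using sub[OF J_lim] by (intro tendsto_rabs_zero LIM_zero)
    ultimately have "(\<lambda>k. strict_dist \<Omega> (u (r k)) v) \<longlonglongrightarrow> 0 + 0"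
      unfolding strict_dist_def TV_u TV_v real_of_ereal.simps by (rule tendsto_add)
    then show ?thesis
      using BV_iff_TV_finite[OF dom] u_L2 v TV_u TV_v by (simp add: strictly_converges_def)
  qed
  ultimately show ?thesis
    using subdiff lim bigo r by blast
qed

end
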